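(* Let $m\in \mathbb{Z}_{\geq 1}$, $n\in \mathbb{Z}_{\geq 0}$, let $q$ be a prime power, and put $t:=q^{-s}$. Then the following hold. (a) (Ramified) If $R=R_{2,2m+1} = \mathbb{F}_q[[X,Y]]/(Y^2-X^{2m+1})$, then $$(q^{-s};q)_n\, \zeta_{\widetilde R^{n}}^R(s) = \sum_{r\in \mathbb{Z},\,\mathbf{s}\in \mathbb{Z}^m} {n\brack r}_q (-1)^r q^{\binom{r}{2}}\, t^{2mn-|\mathbf{s}|}\, G^{((2n)^{m-1},\,2n-r)}_{\mathbf{s}}(q).$$ (b) (Split) If $R=R_{2,2m} = \mathbb{F}_q[[X,Y]]/(Y(Y-X^{m}))$, then $$(q^{-s};q)_n^2\, \zeta_{\widetilde R^{n}}^R(s) = \sum_{r_1,r_2\in \mathbb{Z},\, \mathbf{s}\in \mathbb{Z}^m}{n\brack r_1}_q{n\brack r_2}_q(-1)^{r_1+r_2} q^{\binom{r_1}{2}+\binom{r_2}{2}}\,t^{2mn-|\mathbf{s}|}\,G^{((2n)^{m-1},\,2n-r_1-r_2)}_{\mathbf{s}}(q).$$ (c) (Inert) If $R=R'_{2,2m} = \mathbb{F}_q[[T]]+T^m\mathbb{F}_{q^2}[[T]]$, then $$(q^{-2s};q^2)_n\, \zeta_{\widetilde R^{n}}^R(s) = \sum_{r\in \mathbb{Z},\, \mathbf{s}\in \mathbb{Z}^m} {n\brack r}_{q^2} (-1)^r q^{r^2-r}\, t^{2mn-|\mathbf{s}|}\,G^{((2n)^{m-1},\,2n-2r)}_{\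mathbf{s}}(q).$$
   Context: $\widetilde R$ denotes the normalization of $R$ (its integral closure in its total ring of fractions), and $\widetilde R^n=\widetilde R^{\oplus n}$ is viewed as an $R$-module. For an $R$-module $M$ having finitely many submodules of each finite index, $\zeta_M^R(s)=\sum_{L\subseteq_R M}(M:L)^{-s}$ is the formal Dirichlet series summed over all $R$-submodules $L\subseteq M$ of finite index $(M:L)=|M/L|$. Notation: $(a;x)_k=\prod_{l=0}^{k-1}(1-ax^l)$; ${n\brack k}_x=\frac{(x;x)_n}{(x;x)_k(x;x)_{n-k}}$ if $0\le k\le n$, and $0$ if $k<0$ or $k>n$. For tuples of integers $\mathbf r=(r_1,\dots,r_m)$ and $\mathbf s=(s_1,\dots,s_m)$, set $|\mathbf s|:=s_1+\dots+s_m$ and $$G^{\mathbf r}_{\mathbf s}(q):=q^{\sum_{i=1}^m s_i(r_i-s_i)}\prod_{i=1}^m{r_i-s_{i+1}\brack r_i-s_i}_{q^{-1}},\qquad s_{m+1}:=0.$$ The superscript $((2n)^{m-1},c)$ denotes the $m$-tuple $(2n,\dots,2n,c)$ with $m-1$ entries equal to $2n$. All sums have finitely many nonzero terms. *)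

theory Defs
  imports
    "HOL-Algebra.Algebra"
    "HOL-Algebra.Algebraic_Closure_Type"
    "HOL-Computational_Algebra.Formal_Power_Series"
    "HOL-Number_Theory.Prime_Powers"
    "HOL-Library.Groups_Big_Fun"
    "HOL-Library.Cardinality"
begin

section \<open>Formal Dirichlet series\<close>

text \<open>The coefficient of \<open>k\<^sup>-\<^sup>s\<close> is the value at \<open>k\<close>; the index 0 does not occur.\<close>

typedef (overloaded) 'a dirichlet = "{f :: nat \<Rightarrow> 'a::zero. f 0 = 0}"
  morphisms dir_nth Abs_dirichlet
  by (rule exI[of _ "\<lambda>_. 0"]) simp

setup_lifting type_definition_dirichlet

lemma dir_nth_0 [simp]: "dir_nth f 0 = 0"
  by transfer simp

lemma dirichlet_eqI: "(\<And>k. k > 0 \<Longrightarrow> dir_nth f k = dir_nth g k) \<Longrightarrow> f = g"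
  by transfer (metis ext gr0I)

lemma finite_factor_pairs: "n > 0 \<Longrightarrow> finite {(a, b). a * b = (n :: nat)}"
  by (rule finite_subset[of _ "{..n} \<times> {..n}"]) auto

instantiation dirichlet :: (comm_ring_1) comm_ring_1
begin

lift_definition zero_dirichlet :: "'a dirichlet" is "\<lambda>_. 0" by simp

lift_definition one_dirichlet :: "'a dirichlet" is "\<lambda>k. if k = 1 then 1 else 0" by simp

lift_definition plus_dirichlet :: "'a dirichlet \<Rightarrow> 'a dirichlet \<Rightarrow> 'a dirichlet"
  is "\<lambda>f g k. f k + g k" by simp

lift_definition minus_dirichlet :: "'a dirichlet \<Rightarrow> 'a dirichlet \<Rightarrow> 'a dirichlet"
  is "\<lambda>f g k. f k - g k" by simp

lift_definition uminus_dirichlet :: "'a dirichlet \<Rightarrow> 'a dirichlet"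
  is "\<lambda>f k. - f k" by simp

lift_definition times_dirichlet :: "'a dirichlet \<Rightarrow> 'a dirichlet \<Rightarrow> 'a dirichlet"
  is "\<lambda>f g k. if k = 0 then 0 else \<Sum>(a, b) | a * b = k. f a * g b" by simp

lemma dir_nth_times:
  "k > 0 \<Longrightarrow> dir_nth (f * g) k = (\<Sum>(a, b) | a * b = k. dir_nth f a * dir_nth g b)"
  by transfer simp

lemma dirichlet_assoc: "(f * g) * h = f * (g * h :: 'a dirichlet)"
proof (rule dirichlet_eqI)
  fix n :: nat
  assume n: "n > 0"
  let ?P = "{(a, b). a * b = n}"
  have fin: "finite {(a, b). a * b = k}" if "(k, c) \<in> ?P \<or> (c, k) \<in> ?P" for k c :: nat
    using that n by (intro finite_factor_pairs) (auto intro: Nat.gr0I)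
  have "dir_nth ((f * g) * h) n
      = (\<Sum>(k, c)\<in>?P. \<Sum>(a, b) | a * b = k. dir_nth f a * dir_nth g b * dir_nth h c)"
    using n by (auto simp: dir_nth_times sum_distrib_right case_prod_unfold intro!: sum.cong)
  also have "\<dots> = (\<Sum>((k, c), (a, b))\<in>(SIGMA p:?P. {(a, b). a * b = fst p}).
      dir_nth f a * dir_nth g b * dir_nth h c)"
    using n fin by (subst sum.Sigma[symmetric]) (auto simp: finite_factor_pairs case_prod_unfold)
  also have "\<dots> = (\<Sum>((a, k), (b, c))\<in>(SIGMA p:?P. {(b, c). b * c = snd p}).
      dir_nth f a * (dir_nth g b * dir_nth h c))"
    by (rule sum.reindex_bij_witness[of _ "\<lambda>((a, k), (b, c)). ((a * b, c), (a, b))"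
          "\<lambda>((k, c), (a, b)). ((a, b * c), (b, c))"]) (auto simp: mult.assoc)
  also have "\<dots> = (\<Sum>(a, k)\<in>?P. \<Sum>(b, c) | b * c = k. dir_nth f a * (dir_nth g b * dir_nth h c))"
    using n fin by (subst sum.Sigma[symmetric]) (auto simp: finite_factor_pairs case_prod_unfold)
  also have "\<dots> = dir_nth (f * (g * h)) n"
    using n by (auto simp: dir_nth_times sum_distrib_left case_prod_unfold intro!: sum.cong)
  finally show "dir_nth ((f * g) * h) n = dir_nth (f * (g * h)) n" .
qed

instance
proof
  fix f g h :: "'a dirichlet"
  show "f * g * h = f * (g * h)"
    by (rule dirichlet_assoc)
  show "f * g = g * f"
  proof (rule dirichlet_eqI)
    fix n :: nat
    assume "n > 0"
    then show "dir_nth (f * g) n = dir_nth (g * f) n"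
      unfolding dir_nth_times[OF \<open>n > 0\<close>]
      by (intro sum.reindex_bij_witness[of _ prod.swap prod.swap]) (auto simp: mult.commute)
  qed
  show "1 * f = f"
  proof (rule dirichlet_eqI)
    fix n :: nat
    assume n: "n > 0"
    have "dir_nth (1 * f) n = (\<Sum>p | fst p * snd p = n. dir_nth 1 (fst p) * dir_nth f (snd p))"
      using n by (simp add: dir_nth_times case_prod_unfold)
    also have "\<dots> = (\<Sum>p\<in>{(1, n)}. dir_nth 1 (fst p) * dir_nth f (snd p))"
    proof (rule sum.mono_neutral_right)
      show "finite {p. fst p * snd p = n}"
        using finite_factor_pairs[OF n] by (simp add: case_prod_unfold)
    qed (auto simp: one_dirichlet.rep_eq)
    also have "\<dots> = dir_nth f n"
      by (simp add: one_dirichlet.rep_eq)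
    finally show "dir_nth (1 * f) n = dir_nth f n" .
  qed
  show "(f + g) * h = f * h + g * h"
    by (rule dirichlet_eqI)
      (simp add: dir_nth_times plus_dirichlet.rep_eq distrib_right case_prod_unfold sum.distrib)
  show "f + g + h = f + (g + h)" by transfer (simp add: add.assoc)
  show "f + g = g + f" by transfer (simp add: add.commute)
  show "0 + f = f" by transfer simp
  show "- f + f = 0" by transfer simp
  show "f - g = f + - g" by transfer simp
  show "(0 :: 'a dirichlet) \<noteq> 1" by transfer (metis zero_neq_one)
qed

end

text \<open>\<open>dir_monom c k\<close> is \<open>c k\<^sup>-\<^sup>s\<close>; in particular \<open>dir_monom c 1\<close> is the constant \<open>c\<close>.\<close>

definition dir_monom :: "'a::zero \<Rightarrow> nat \<Rightarrow> 'a dirichlet" where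
  "dir_monom c k = Abs_dirichlet (\<lambda>j. if j = k \<and> 0 < j then c else 0)"


section \<open>Normalization\<close>

definition nonzerodivisors :: "('a, 'r) ring_scheme \<Rightarrow> 'a set" where
  "nonzerodivisors R =
     {s \<in> carrier R. \<forall>a\<in>carrier R. a \<otimes>\<^bsub>R\<^esub> s = \<zero>\<^bsub>R\<^esub> \<longrightarrow> a = \<zero>\<^bsub>R\<^esub>}"

text \<open>\<open>fraction R a s\<close> is the class of \<open>a / s\<close>.\<close>

definition fraction :: "('a, 'r) ring_scheme \<Rightarrow> 'a \<Rightarrow> 'a \<Rightarrow> ('a \<times> 'a) set" where
  "fraction R a s = {(b, u). b \<in> carrier R \<and> u \<in> nonzerodivisors R \<and> a \<otimes>\<^bsub>R\<^esub> u = b \<otimes>\<^bsub>R\<^esub> s}"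

text \<open>The unions below are unions of copies of one class, as the operations do not depend on
  the representatives.\<close>

definition total_fractions :: "('a, 'r) ring_scheme \<Rightarrow> ('a \<times> 'a) set ring" where
  "total_fractions R =
     \<lparr>carrier = {fraction R a s | a s. a \<in> carrier R \<and> s \<in> nonzerodivisors R},
      monoid.mult = (\<lambda>A B. \<Union>(a, s)\<in>A. \<Union>(b, u)\<in>B. fraction R (a \<otimes>\<^bsub>R\<^esub> b) (s \<otimes>\<^bsub>R\<^esub> u)),
      one = fraction R \<one>\<^bsub>R\<^esub> \<one>\<^bsub>R\<^esub>,
      ring.zero = fraction R \<zero>\<^bsub>R\<^esub> \<one>\<^bsub>R\<^esub>,
      add = (\<lambda>A B. \<Union>(a, s)\<in>A. \<Union>(b, u)\<in>B.
        fraction R (a \<otimes>\<^bsub>R\<^esub> u \<oplus>\<^bsub>R\<^esub> b \<otimes>\<^bsub>R\<^esub> s) (s \<otimes>\<^bsub>R\<^esub> u))\<rparr>"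

definition to_fraction :: "('a, 'r) ring_scheme \<Rightarrow> 'a \<Rightarrow> ('a \<times> 'a) set" where
  "to_fraction R a = fraction R a \<one>\<^bsub>R\<^esub>"

text \<open>HOL-Algebra polynomials are coefficient lists with the leading coefficient first.\<close>

definition integral_closure :: "('a, 'r) ring_scheme \<Rightarrow> 'a set \<Rightarrow> 'a set" where
  "integral_closure K A =
     {x \<in> carrier K. \<exists>p. p \<noteq> [] \<and> set p \<subseteq> A \<and> hd p = \<one>\<^bsub>K\<^esub> \<and> ring.eval K p x = \<zero>\<^bsub>K\<^esub>}"

definition normalization :: "('a, 'r) ring_scheme \<Rightarrow> ('a \<times> 'a) set ring" where
  "normalization R = (total_fractions R)
     \<lparr>carrier := integral_closure (total_fractions R) (to_fraction R ` carrier R)\<rparr>"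

text \<open>The direct sum of \<open>n\<close> copies of the normalization, as an \<open>R\<close>-module.\<close>

definition normalization_power ::
  "('a, 'r) ring_scheme \<Rightarrow> nat \<Rightarrow> ('a, nat \<Rightarrow> ('a \<times> 'a) set) module" where
  "normalization_power R n =
     (let N = normalization R in
     \<lparr>carrier = {..<n} \<rightarrow>\<^sub>E carrier N,
      monoid.mult = (\<lambda>f g. \<lambda>i\<in>{..<n}. f i \<otimes>\<^bsub>N\<^esub> g i),
      one = (\<lambda>i\<in>{..<n}. \<one>\<^bsub>N\<^esub>),
      ring.zero = (\<lambda>i\<in>{..<n}. \<zero>\<^bsub>N\<^esub>),
      add = (\<lambda>f g. \<lambda>i\<in>{..<n}. f i \<oplus>\<^bsub>N\<^esub> g i),
      module.smult = (\<lambda>a f. \<lambda>i\<in>{..<n}. to_fraction R a \<otimes>\<^bsub>N\<^esub> f i)\<rparr>)"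


section \<open>Zeta functions of modules\<close>

definition submodules_of_index ::
  "('a, 'r) ring_scheme \<Rightarrow> ('a, 'b, 'm) module_scheme \<Rightarrow> nat \<Rightarrow> 'b set set" where
  "submodules_of_index R M k =
     {L. submodule L R M \<and> finite (a_rcosets\<^bsub>M\<^esub> L) \<and> card (a_rcosets\<^bsub>M\<^esub> L) = k}"

definition has_zeta :: "('a, 'r) ring_scheme \<Rightarrow> ('a, 'b, 'm) module_scheme \<Rightarrow> bool" where
  "has_zeta R M \<longleftrightarrow> (\<forall>k. finite (submodules_of_index R M k))"

text \<open>Meaningful only if \<^term>\<open>has_zeta R M\<close>, since \<^const>\<open>card\<close> is 0 on infinite sets.\<close>

definition module_zeta ::
  "('a, 'r) ring_scheme \<Rightarrow> ('a, 'b, 'm) module_scheme \<Rightarrow> 'c::comm_ring_1 dirichlet" where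
  "module_zeta R M = Abs_dirichlet (\<lambda>k. if k = 0 then 0 else of_nat (card (submodules_of_index R M k)))"


section \<open>The rings\<close>

text \<open>\<open>k[[X, Y]]\<close> is represented by \<open>k[[X]][[Y]]\<close>, the type \<open>'a fps fps\<close>.\<close>

definition pX :: "'a::field fps fps" where "pX = fps_const fps_X"

definition pY :: "'a::field fps fps" where "pY = fps_X"

definition ramified_ring :: "nat \<Rightarrow> 'a::field fps fps set ring" where
  "ramified_ring m =
     ring_of_type_algebra Quot (PIdl\<^bsub>ring_of_type_algebra\<^esub> (pY ^ 2 - pX ^ (2 * m + 1)))"

definition split_ring :: "nat \<Rightarrow> 'a::field fps fps set ring" where
  "split_ring m =
     ring_of_type_algebra Quot (PIdl\<^bsub>ring_of_type_algebra\<^esub> (pY * (pY - pX ^ m)))"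

text \<open>\<open>k[[T]] + T\<^sup>m F[[T]]\<close> for a subfield \<open>k\<close> of the field \<open>F\<close> of the type \<open>'b\<close>.\<close>

definition inert_ring :: "'b set \<Rightarrow> nat \<Rightarrow> 'b::field fps ring" where
  "inert_ring k m = ring_of_type_algebra
     \<lparr>carrier := {a + fps_X ^ m * b | a b. \<forall>i. fps_nth a i \<in> k}\<rparr>"


section \<open>The \<open>q\<close>-series\<close>

definition qpoch :: "'a::comm_ring_1 \<Rightarrow> 'a \<Rightarrow> nat \<Rightarrow> 'a" where
  "qpoch a x k = (\<Prod>l<k. 1 - a * x ^ l)"

definition qbinom :: "'a::field \<Rightarrow> int \<Rightarrow> int \<Rightarrow> 'a" where
  "qbinom x n k =
     (if 0 \<le> k \<and> k \<le> n
      then qpoch x x (nat n) / (qpoch x x (nat k) * qpoch x x (nat (n - k))) else 0)"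

text \<open>Tuples are lists, so entries are indexed from 0; appending 0 to \<open>s\<close> encodes
  \<open>s\<^sub>m\<^sub>+\<^sub>1 = 0\<close>.\<close>

definition Gq :: "int list \<Rightarrow> int list \<Rightarrow> 'a::field \<Rightarrow> 'a" where
  "Gq r s q =
     q powi (\<Sum>i<length r. s ! i * (r ! i - s ! i)) *
     (\<Prod>i<length r. qbinom (1 / q) (r ! i - (s @ [0]) ! (i + 1)) (r ! i - s ! i))"

end

theory Submission
  imports Defs "HOL-Library.Function_Algebras"
begin

text \<open>Let \<open>S\<close> be the normalization of \<open>R\<close>, \<open>J\<close> its Jacobson radical, \<open>P = S\<^sup>n\<close>, and let \<open>x\<close> be the generator of a
  power series ring \<open>B \<subseteq> R\<close> over a field with \<open>q\<close> elements, such that \<open>R = B + x\<^sup>m S\<close> and \<open>S\<close> is free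
  of rank 2 over \<open>B\<close>. The \<open>S\<close>-modules \<open>M\<close> between \<open>J P\<close> and \<open>P\<close> correspond to subspaces over the residue
  fields of \<open>S\<close>; let \<open>\<mu>(M)\<close> be the Moebius function of the interval from \<open>M\<close> to \<open>P\<close>.

  Consider \<open>\<Sum>\<^sub>M \<mu>(M) \<Sum>\<^sub>L (P : L)\<^sup>-\<^sup>s\<close> with \<open>L \<subseteq> M\<close>. As \<open>M \<cong> P\<close>, the inner sum is \<open>(P : M)\<^sup>-\<^sup>s \<zeta>(s)\<close>, and by
  the \<open>q\<close>-binomial theorem the factors \<open>\<mu>(M) (P : M)\<^sup>-\<^sup>s\<close> add up to the Pochhammer symbol on the left hand
  side. On the other hand, the \<open>\<mu>(M)\<close> with \<open>L \<subseteq> M\<close> cancel unless \<open>S L = P\<close>, by Nakayama, and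
  \<open>S L = P\<close> implies \<open>x\<^sup>m P = x\<^sup>m S L \<subseteq> L\<close>. So only the \<open>L\<close> that contain \<open>x\<^sup>m P\<close> matter. These are just
  the \<open>x\<close>-stable subspaces of \<open>P\<close> containing \<open>x\<^sup>m P\<close>, and the pairs \<open>(L + x P, x\<^sup>-\<^sup>1 (L \<inter> x P))\<close> give a
  recursion in \<open>m\<close> for their number, which is solved by \<open>G\<close>.\<close>

section \<open>Subgroups and indices\<close>

text \<open>The three formulas share one lattice count: for \<open>L\<close> containing
  \<open>x^m P\<close>, being a module over the order only means stability under \<open>K\<close>
  and \<open>x\<close>, so the ring structure of \<open>S\<close> is invisible there and the same
  \<open>G\<close> appears each time. \<open>S\<close> enters only through the modules
  \<open>M\<close>: their Moebius function depends on the residue fields, and the last upper entry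
  of \<open>G\<close> is the dimension over \<open>K\<close> of \<open>M/xP\<close>. This explains
  \<open>2n - r\<close>, \<open>2n - r1 - r2\<close> and \<open>2n - 2r\<close>. The recursion rests
  on lifting: adding one dimension of \<open>V/xP\<close> to a lattice means choosing a vector of
  \<open>L'\<close> modulo \<open>xL'\<close>, and there are \<open>(P : L' + xP)\<close> choices.
  Finite index replaces completeness: the powers of \<open>x\<close> repeat modulo \<open>L\<close>,
  and \<open>1 - x^e\<close> is invertible, so some power of \<open>x\<close> maps \<open>P\<close>
  into \<open>L\<close>. The module \<open>S L\<close> is never formed. Its role is taken by the
  largest \<open>S\<close>-module \<open>W\<close> with \<open>x^m W\<close> in \<open>L\<close>,
  which contains \<open>L\<close> and equals \<open>P\<close> exactly when \<open>x^m P\<close> lies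
  in \<open>L\<close>.\<close>

definition add_subgrp :: "'v::ab_group_add set \<Rightarrow> bool" where
  "add_subgrp A \<longleftrightarrow> 0 \<in> A \<and> (\<forall>x\<in>A. \<forall>y\<in>A. x - y \<in> A)"

definition cosets :: "'v::ab_group_add set \<Rightarrow> 'v set \<Rightarrow> 'v set set" where
  "cosets A C = (\<lambda>c. (+) c ` A) ` C"

text \<open>An infinite index is recorded as 0, so finiteness of \<open>cosets A C\<close> travels
  as a separate hypothesis; conversely, a nonzero \<open>idx\<close> proves it.\<close>

definition idx :: "'v::ab_group_add set \<Rightarrow> 'v set \<Rightarrow> nat" where
  "idx A C = card (cosets A C)"

definition ssum :: "'v::ab_group_add set \<Rightarrow> 'v set \<Rightarrow> 'v set" where
  "ssum A B = {a + b | a b. a \<in> A \<and> b \<in> B}"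

lemma add_subgrpI:
  "0 \<in> A \<Longrightarrow> (\<And>x y. x \<in> A \<Longrightarrow> y \<in> A \<Longrightarrow> x - y \<in> A) \<Longrightarrow> add_subgrp A"
  by (auto simp: add_subgrp_def)

context
  fixes A :: "'v::ab_group_add set"
  assumes A: "add_subgrp A"
begin

lemma add_subgrp_0: "0 \<in> A"
  using A by (simp add: add_subgrp_def)

lemma add_subgrp_diff: "x \<in> A \<Longrightarrow> y \<in> A \<Longrightarrow> x - y \<in> A"
  using A by (simp add: add_subgrp_def)

lemma add_subgrp_minus: "x \<in> A \<Longrightarrow> - x \<in> A"
  using add_subgrp_diff[OF add_subgrp_0, of x] by simp

lemma add_subgrp_add: "x \<in> A \<Longrightarrow> y \<in> A \<Longrightarrow> x + y \<in> A"
  using add_subgrp_diff[of x "- y"] add_subgrp_minus by simp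

lemma add_subgrp_add_iff: "x \<in> A \<Longrightarrow> x + y \<in> A \<longleftrightarrow> y \<in> A"
  using add_subgrp_add add_subgrp_diff[of "x + y" x] by auto

lemma add_subgrp_diff_commute: "x - y \<in> A \<longleftrightarrow> y - x \<in> A"
  using add_subgrp_minus[of "x - y"] add_subgrp_minus[of "y - x"] by auto

lemma coset_eq_iff: "(+) c ` A = (+) d ` A \<longleftrightarrow> c - d \<in> A"
proof
  assume "(+) c ` A = (+) d ` A"
  then have "c + 0 \<in> (+) d ` A" using add_subgrp_0 by blast
  then obtain a where "a \<in> A" "c = d + a" by auto
  then show "c - d \<in> A" by simp
next
  assume cd: "c - d \<in> A"
  have "c + a \<in> (+) d ` A" if "a \<in> A" for a
    using add_subgrp_add[OF cd that] by (intro image_eqI[of _ _ "(c - d) + a"]) auto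
  moreover have "d + a \<in> (+) c ` A" if "a \<in> A" for a
    using add_subgrp_diff[OF that cd] by (intro image_eqI[of _ _ "a - (c - d)"]) auto
  ultimately show "(+) c ` A = (+) d ` A" by blast
qed

lemma mem_coset_iff: "x \<in> (+) c ` A \<longleftrightarrow> x - c \<in> A"
  by (auto intro!: image_eqI[of _ _ "x - c"])

end

lemma add_subgrp_Int: "add_subgrp A \<Longrightarrow> add_subgrp B \<Longrightarrow> add_subgrp (A \<inter> B)"
  by (auto simp: add_subgrp_def)

lemma add_subgrp_ssum:
  assumes "add_subgrp A" "add_subgrp B" shows "add_subgrp (ssum A B)"
proof (rule add_subgrpI)
  show "0 \<in> ssum A B"
    using add_subgrp_0[OF assms(1)] add_subgrp_0[OF assms(2)] unfolding ssum_def by force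
  fix x y assume "x \<in> ssum A B" "y \<in> ssum A B"
  then obtain a b c d where "a \<in> A" "b \<in> B" "c \<in> A" "d \<in> B" "x = a + b" "y = c + d"
    by (auto simp: ssum_def)
  then have "x - y = (a - c) + (b - d)" "a - c \<in> A" "b - d \<in> B"
    using assms by (auto intro: add_subgrp_diff)
  then show "x - y \<in> ssum A B" unfolding ssum_def by blast
qed

lemma ssum_memI: "a \<in> A \<Longrightarrow> b \<in> B \<Longrightarrow> a + b \<in> ssum A B"
  by (auto simp: ssum_def)

lemma ssum_memE:
  assumes "x \<in> ssum A B" obtains a b where "a \<in> A" "b \<in> B" "x = a + b"
  using assms by (auto simp: ssum_def)

lemma ssum_upper1: "add_subgrp B \<Longrightarrow> A \<subseteq> ssum A B"
  using ssum_memI[of _ A 0 B] add_subgrp_0[of B] by auto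

lemma ssum_upper2: "add_subgrp A \<Longrightarrow> B \<subseteq> ssum A B"
  using ssum_memI[of 0 A _ B] add_subgrp_0[of A] by auto

lemma ssum_least: "add_subgrp C \<Longrightarrow> A \<subseteq> C \<Longrightarrow> B \<subseteq> C \<Longrightarrow> ssum A B \<subseteq> C"
  by (auto simp: ssum_def intro: add_subgrp_add)

lemma ssum_mono: "A \<subseteq> C \<Longrightarrow> B \<subseteq> D \<Longrightarrow> ssum A B \<subseteq> ssum C D"
  unfolding ssum_def by blast

lemma ssum_commute: "ssum A B = ssum B A"
proof -
  have "ssum A B \<subseteq> ssum B A" for A B :: "'a set"
  proof
    fix x assume "x \<in> ssum A B"
    then obtain a b where "a \<in> A" "b \<in> B" "x = a + b" by (rule ssum_memE)
    then show "x \<in> ssum B A" using ssum_memI[of b B a A] by (simp add: add.commute)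
  qed
  then show ?thesis by blast
qed

lemma ssum_absorb: "add_subgrp A \<Longrightarrow> add_subgrp B \<Longrightarrow> B \<subseteq> A \<Longrightarrow> ssum A B = A"
  using ssum_least[of A A B] ssum_upper1[of B A] by blast

text \<open>The cosets of \<open>A\<close> in \<open>C\<close> are sorted by the coset of
  \<open>B\<close> that contains them. Translation by \<open>c\<close> identifies the fibre over
  \<open>c + B\<close> with the cosets of \<open>A\<close> in \<open>B\<close>, so all fibres have
  the same size.\<close>

lemma cosets_tower:
  assumes A: "add_subgrp A" and B: "add_subgrp B" and C: "add_subgrp C"
    and AB: "A \<subseteq> B" and BC: "B \<subseteq> C"
  shows "finite (cosets A C) \<longleftrightarrow> finite (cosets A B) \<and> finite (cosets B C)"
    and "finite (cosets A C) \<Longrightarrow> idx A C = idx A B * idx B C"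
proof -
  define fib where "fib D = {E \<in> cosets A C. E \<subseteq> D}" for D
  have fib: "bij_betw ((`) ((+) c)) (cosets A B) (fib ((+) c ` B))" if c: "c \<in> C" for c
  proof (rule bij_betwI')
    fix E E' show "((+) c ` E = (+) c ` E') \<longleftrightarrow> E = E'"
      by (simp add: inj_image_eq_iff)
  next
    fix E assume "E \<in> cosets A B"
    then obtain b where b: "b \<in> B" "E = (+) b ` A" by (auto simp: cosets_def)
    then have "(+) c ` E = (+) (c + b) ` A" by (auto simp: image_image add.assoc)
    moreover have "c + b \<in> C" using b BC c add_subgrp_add[OF C] by auto
    moreover have "(+) c ` E \<subseteq> (+) c ` B" using b AB add_subgrp_add[OF B] by auto
    ultimately show "(+) c ` E \<in> fib ((+) c ` B)" by (auto simp: fib_def cosets_def)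
  next
    fix D assume "D \<in> fib ((+) c ` B)"
    then obtain d where d: "d \<in> C" "D = (+) d ` A" "D \<subseteq> (+) c ` B"
      by (auto simp: fib_def cosets_def)
    then have "d + 0 \<in> (+) c ` B" using add_subgrp_0[OF A] by blast
    then have "d - c \<in> B" using mem_coset_iff[OF B] by simp
    moreover have "D = (+) c ` ((+) (d - c) ` A)" using d by (auto simp: image_image)
    ultimately show "\<exists>E\<in>cosets A B. D = (+) c ` E" by (auto simp: cosets_def)
  qed
  have un: "cosets A C = (\<Union>D\<in>cosets B C. fib D)"
  proof -
    have "E \<in> (\<Union>D\<in>cosets B C. fib D)" if "E \<in> cosets A C" for E
    proof -
      from that obtain c where c: "c \<in> C" "E = (+) c ` A" by (auto simp: cosets_def)
      then have "E \<in> fib ((+) c ` B)" using AB that by (auto simp: fib_def)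
      then show ?thesis using c by (auto simp: cosets_def)
    qed
    then show ?thesis by (auto simp: fib_def)
  qed
  have disj: "fib D \<inter> fib D' = {}" if D: "D \<in> cosets B C" "D' \<in> cosets B C" "D \<noteq> D'" for D D'
  proof (rule ccontr)
    assume "fib D \<inter> fib D' \<noteq> {}"
    then obtain c where "(+) c ` A \<subseteq> D" "(+) c ` A \<subseteq> D'" by (auto simp: fib_def cosets_def)
    then have c: "c \<in> D" "c \<in> D'" using add_subgrp_0[OF A] by auto
    obtain d d' where d: "D = (+) d ` B" "D' = (+) d' ` B" using D by (auto simp: cosets_def)
    then have "c - d \<in> B" "c - d' \<in> B" using c mem_coset_iff[OF B] by simp_all
    then have "(+) c ` B = D" "(+) c ` B = D'"
      unfolding d using coset_eq_iff[OF B, of c] by simp_all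
    then show False using D by simp
  qed
  have AB_sub: "cosets A B \<subseteq> cosets A C" using BC by (auto simp: cosets_def)
  \<comment> \<open>Enlarging cosets of \<open>A\<close> by \<open>B\<close> reaches every coset of
    \<open>B\<close>, which bounds their number.\<close>
  have BC_im: "cosets B C \<subseteq> (\<lambda>E. ssum E B) ` cosets A C"
  proof
    fix D assume "D \<in> cosets B C"
    then obtain c where c: "c \<in> C" "D = (+) c ` B" by (auto simp: cosets_def)
    have "ssum ((+) c ` A) B = (+) c ` B"
    proof
      show "ssum ((+) c ` A) B \<subseteq> (+) c ` B"
        using AB add_subgrp_add[OF B] by (auto simp: ssum_def add.assoc)
      show "(+) c ` B \<subseteq> ssum ((+) c ` A) B"
        using add_subgrp_0[OF A] by (force simp: ssum_def)
    qed
    then show "D \<in> (\<lambda>E. ssum E B) ` cosets A C" using c by (force simp: cosets_def)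
  qed
  show iff: "finite (cosets A C) \<longleftrightarrow> finite (cosets A B) \<and> finite (cosets B C)"
  proof
    assume "finite (cosets A C)"
    then show "finite (cosets A B) \<and> finite (cosets B C)"
      using AB_sub BC_im by (meson finite_imageI finite_subset)
  next
    assume fin: "finite (cosets A B) \<and> finite (cosets B C)"
    have "finite (fib D)" if "D \<in> cosets B C" for D
      using that bij_betw_finite[OF fib] fin by (auto simp: cosets_def[of B])
    then show "finite (cosets A C)" using un fin by auto
  qed
  assume "finite (cosets A C)"
  then have fin: "finite (cosets A B)" "finite (cosets B C)" using iff by auto
  have card: "card (fib D) = idx A B \<and> finite (fib D)" if "D \<in> cosets B C" for D
    using that bij_betw_finite[OF fib] bij_betw_same_card[OF fib] fin
    by (auto simp: cosets_def[of B] idx_def)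
  have "idx A C = (\<Sum>D\<in>cosets B C. card (fib D))"
    unfolding idx_def un using card disj fin by (intro card_UN_disjoint) auto
  also have "\<dots> = idx A B * idx B C" using card by (simp add: idx_def)
  finally show "idx A C = idx A B * idx B C" .
qed

text \<open>The hypotheses are what \<open>f\<close> needs to induce a bijection from
  \<open>C/A\<close> to \<open>C'/A'\<close>: additivity on \<open>C\<close> only, and surjectivity
  only up to \<open>A'\<close>. The second isomorphism theorem, residue maps and projections are
  instances.\<close>

lemma cosets_bij:
  assumes A: "add_subgrp A" and C: "add_subgrp C" and A': "add_subgrp A'"
    and add: "\<And>x y. x \<in> C \<Longrightarrow> y \<in> C \<Longrightarrow> f (x - y) = f x - f y"
    and onto: "\<And>y. y \<in> C' \<Longrightarrow> \<exists>x\<in>C. y - f x \<in> A'"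
    and into: "\<And>x. x \<in> C \<Longrightarrow> f x \<in> C'"
    and ker: "\<And>x. x \<in> C \<Longrightarrow> f x \<in> A' \<longleftrightarrow> x \<in> A"
  shows "idx A C = idx A' C'" "finite (cosets A C) \<longleftrightarrow> finite (cosets A' C')"
proof -
  define g where "g E = (+) (f (SOME c. c \<in> C \<and> E = (+) c ` A)) ` A'" for E
  have g: "g ((+) c ` A) = (+) (f c) ` A'" if c: "c \<in> C" for c
  proof -
    define d where "d = (SOME d. d \<in> C \<and> (+) c ` A = (+) d ` A)"
    have "d \<in> C \<and> (+) c ` A = (+) d ` A"
      unfolding d_def by (rule someI[of "\<lambda>d. d \<in> C \<and> (+) c ` A = (+) d ` A" c]) (simp add: c)
    then have d: "d \<in> C" "d - c \<in> A" using coset_eq_iff[OF A] add_subgrp_diff_commute[OF A] by auto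
    then have "f d - f c \<in> A'" using ker[of "d - c"] add[of d c] c add_subgrp_diff[OF C, of d c] by simp
    then show ?thesis unfolding g_def d_def[symmetric] by (simp add: coset_eq_iff[OF A'])
  qed
  have "bij_betw g (cosets A C) (cosets A' C')"
  proof (rule bij_betwI')
    fix E E' assume "E \<in> cosets A C" "E' \<in> cosets A C"
    then obtain c d where c: "c \<in> C" "E = (+) c ` A" "d \<in> C" "E' = (+) d ` A"
      by (auto simp: cosets_def)
    then show "g E = g E' \<longleftrightarrow> E = E'"
      using ker[of "c - d"] add[of c d] add_subgrp_diff[OF C]
      by (simp add: g coset_eq_iff[OF A] coset_eq_iff[OF A'])
  next
    fix E assume "E \<in> cosets A C" then show "g E \<in> cosets A' C'"
      using into by (auto simp: cosets_def g)
  next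
    fix D assume "D \<in> cosets A' C'"
    then obtain y where y: "y \<in> C'" "D = (+) y ` A'" by (auto simp: cosets_def)
    then obtain x where x: "x \<in> C" "y - f x \<in> A'" using onto by blast
    then have "D = g ((+) x ` A)" using y by (simp add: g coset_eq_iff[OF A'])
    then show "\<exists>E\<in>cosets A C. D = g E" using x by (auto simp: cosets_def)
  qed
  then show "idx A C = idx A' C'" "finite (cosets A C) \<longleftrightarrow> finite (cosets A' C')"
    unfolding idx_def by (rule bij_betw_same_card, rule bij_betw_finite)
qed

lemma cosets_second_iso:
  assumes A: "add_subgrp A" and B: "add_subgrp B"
  shows "idx (A \<inter> B) B = idx A (ssum A B)"
    and "finite (cosets (A \<inter> B) B) \<longleftrightarrow> finite (cosets A (ssum A B))"
proof -
  have *: "\<exists>x\<in>B. y - x \<in> A" if "y \<in> ssum A B" for y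
    using that by (metis ssum_memE add_diff_cancel)
  have **: "x \<in> ssum A B" if "x \<in> B" for x using that ssum_upper2[OF A] by auto
  show "idx (A \<inter> B) B = idx A (ssum A B)"
    "finite (cosets (A \<inter> B) B) \<longleftrightarrow> finite (cosets A (ssum A B))"
    using cosets_bij[of "A \<inter> B" B A "\<lambda>x. x" "ssum A B"] A B * ** by (auto simp: add_subgrp_Int)
qed

lemma cosets_inj_image:
  assumes A: "add_subgrp A" and C: "add_subgrp C" and AC: "A \<subseteq> C"
    and add: "\<And>x y. x \<in> C \<Longrightarrow> y \<in> C \<Longrightarrow> f (x - y) = f x - f y" and inj: "inj_on f C"
  shows "idx (f ` A) (f ` C) = idx A C"
    and "finite (cosets (f ` A) (f ` C)) \<longleftrightarrow> finite (cosets A C)"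
    and "add_subgrp (f ` A)"
proof -
  have f0: "f 0 = 0" using add[of 0 0] add_subgrp_0[OF C] by simp
  show fA: "add_subgrp (f ` A)"
  proof (rule add_subgrpI)
    show "0 \<in> f ` A" using f0 add_subgrp_0[OF A] by force
    fix x y assume "x \<in> f ` A" "y \<in> f ` A"
    then obtain a b where "a \<in> A" "b \<in> A" "x = f a" "y = f b" by auto
    then show "x - y \<in> f ` A" using add[of a b] AC add_subgrp_diff[OF A, of a b] by (metis image_eqI subsetD)
  qed
  have *: "\<exists>x\<in>C. y - f x \<in> f ` A" if y: "y \<in> f ` C" for y
  proof -
    from y obtain x where "x \<in> C" "y = f x" by auto
    then show ?thesis using add_subgrp_0[OF fA] by (intro bexI[of _ x]) auto
  qed
  show "idx (f ` A) (f ` C) = idx A C" "finite (cosets (f ` A) (f ` C)) \<longleftrightarrow> finite (cosets A C)"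
    using cosets_bij[OF A C fA add *] inj_on_image_mem_iff[OF inj _ AC] by auto
qed

lemma idx_eq_1_iff:
  assumes A: "add_subgrp A" and C: "add_subgrp C" and AC: "A \<subseteq> C"
  shows "idx A C = 1 \<longleftrightarrow> A = C"
proof
  assume "idx A C = 1"
  then obtain D where D: "cosets A C = {D}" by (auto simp: idx_def card_1_singleton_iff)
  have "c \<in> A" if "c \<in> C" for c
  proof -
    have "(+) c ` A \<in> cosets A C" "(+) 0 ` A \<in> cosets A C"
      unfolding cosets_def using that add_subgrp_0[OF C] by blast+
    then have "(+) c ` A = (+) 0 ` A" using D by auto
    then show ?thesis using coset_eq_iff[OF A, of c 0] by simp
  qed
  then show "A = C" using AC by auto
next
  assume "A = C"
  then have "(+) c ` A = A" if "c \<in> C" for c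
    using that coset_eq_iff[OF A, of c 0] by simp
  then have "cosets A C = {A}" using add_subgrp_0[OF C] unfolding cosets_def by blast
  then show "idx A C = 1" by (simp add: idx_def)
qed

lemma idx_self: "add_subgrp A \<Longrightarrow> idx A A = 1"
  using idx_eq_1_iff[of A A] by simp

lemma idx_pos: "add_subgrp C \<Longrightarrow> finite (cosets A C) \<Longrightarrow> idx A C > 0"
  by (auto simp: idx_def card_gt_0_iff cosets_def dest: add_subgrp_0)

lemma finite_cosets_self: "add_subgrp A \<Longrightarrow> finite (cosets A A)"
  using idx_self[of A] by (metis card.infinite idx_def zero_neq_one)

text \<open>An intermediate group is the union of its cosets of \<open>A\<close>, hence determined
  by a subset of the finite set \<open>cosets A C\<close>.\<close>

lemma finite_between:
  assumes A: "add_subgrp A" and C: "add_subgrp C" and fin: "finite (cosets A C)"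
  shows "finite {B. add_subgrp B \<and> A \<subseteq> B \<and> B \<subseteq> C}"
proof (rule finite_imageD)
  show "finite (cosets A ` {B. add_subgrp B \<and> A \<subseteq> B \<and> B \<subseteq> C})"
    by (rule finite_subset[of _ "Pow (cosets A C)"]) (use fin in \<open>auto simp: cosets_def\<close>)
  have "B = \<Union>(cosets A B)" if "add_subgrp B" "A \<subseteq> B" for B
  proof -
    have "b \<in> \<Union>(cosets A B)" if "b \<in> B" for b
      using that add_subgrp_0[OF A] by (force simp: cosets_def)
    moreover have "\<Union>(cosets A B) \<subseteq> B"
      using that add_subgrp_add[of B] by (auto simp: cosets_def)
    ultimately show ?thesis by auto
  qed
  then show "inj_on (cosets A) {B. add_subgrp B \<and> A \<subseteq> B \<and> B \<subseteq> C}"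
    by (intro inj_onI) (simp, metis)
qed

section \<open>\<open>q\<close>-binomial coefficients\<close>

lemma qpoch_Suc: "qpoch a x (Suc n) = qpoch a x n * (1 - a * x ^ n)"
  by (simp add: qpoch_def)

lemma qpoch_0: "qpoch a x 0 = 1"
  by (simp add: qpoch_def)

text \<open>This keeps the denominators of \<open>qbinom\<close> nonzero, and it passes from
  \<open>Q\<close> to \<open>1/Q\<close>, the base that occurs in \<open>Gq\<close>.\<close>

locale q_not_root_of_unity =
  fixes Q :: "'a::field"
  assumes Q_nonzero: "Q \<noteq> 0" and Q_power_neq_1: "n > 0 \<Longrightarrow> Q ^ n \<noteq> 1"
begin

lemma qpoch_self_nonzero: "qpoch Q Q n \<noteq> 0"
proof -
  have "1 - Q * Q ^ l \<noteq> 0" for l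
    using Q_power_neq_1[of "Suc l"] by (metis power_Suc right_minus_eq zero_less_Suc)
  then show ?thesis by (simp add: qpoch_def)
qed

lemma qbinom_0_right: "qbinom Q (int n) 0 = 1"
  using qpoch_self_nonzero[of n] by (simp add: qbinom_def qpoch_0)

lemma qbinom_self: "qbinom Q (int n) (int n) = 1"
  using qpoch_self_nonzero[of n] by (simp add: qbinom_def qpoch_0)

lemma qbinom_sym: "qbinom x n (n - k) = qbinom x n k"
  by (auto simp: qbinom_def mult.commute)

lemma qbinom_eq:
  "k \<le> n \<Longrightarrow> qbinom x (int n) (int k) = qpoch x x n / (qpoch x x k * qpoch x x (n - k))"
  by (simp add: qbinom_def of_nat_diff[symmetric] del: of_nat_diff)

text \<open>The division-free relation between neighbouring coefficients. It is the identity that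
  double counting of subspaces produces, and it determines the upper coefficient because
  \<open>Q ^ Suc k\<close> is not 1.\<close>

lemma qbinom_absorb:
  "qbinom Q (int (Suc n)) (int (Suc k)) * (Q ^ Suc k - 1) = (Q ^ Suc n - 1) * qbinom Q (int n) (int k)"
proof (cases "k \<le> n")
  case True
  define a where "a = 1 - Q ^ Suc k"
  define b where "b = 1 - Q ^ Suc n"
  have a: "a \<noteq> 0" using Q_power_neq_1[of "Suc k"] by (simp add: a_def)
  have 1: "Q ^ Suc k - 1 = - a" "Q ^ Suc n - 1 = - b" by (simp_all add: a_def b_def)
  have 2: "qbinom Q (int (Suc n)) (int (Suc k)) =
      (qpoch Q Q n * b) / ((qpoch Q Q k * a) * qpoch Q Q (n - k))"
    using True by (subst qbinom_eq) (simp_all add: qpoch_Suc a_def b_def)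
  have 3: "qbinom Q (int n) (int k) = qpoch Q Q n / (qpoch Q Q k * qpoch Q Q (n - k))"
    using True by (rule qbinom_eq)
  show ?thesis unfolding 1 2 3 using a by simp
next
  case False
  then show ?thesis by (simp add: qbinom_def)
qed

lemma qbinom_Suc_Suc:
  "qbinom Q (int (Suc n)) (int (Suc k)) =
     qbinom Q (int n) (int (Suc k)) + Q ^ (n - k) * qbinom Q (int n) (int k)"
proof (cases "k \<le> n")
  case le: True
  show ?thesis
  proof (cases "k = n")
    case True
    then show ?thesis using qbinom_self[of n] qbinom_self[of "Suc n"] by (simp add: qbinom_def)
  next
    case False
    then have "Suc k \<le> n" using le by simp
    then obtain d where d: "n = Suc k + d" using le_Suc_ex by blast
    define a where "a = 1 - Q ^ Suc k"
    define b where "b = 1 - Q ^ Suc d"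
    have a: "a \<noteq> 0" "b \<noteq> 0"
      using Q_power_neq_1[of "Suc k"] Q_power_neq_1[of "Suc d"] by (simp_all add: a_def b_def)
    define e where "e = Q ^ Suc d"
    have 1: "qbinom Q (int (Suc n)) (int (Suc k)) =
        (qpoch Q Q n * (1 - Q ^ Suc n)) / ((qpoch Q Q k * a) * (qpoch Q Q d * b))"
      by (subst qbinom_eq) (simp_all add: d qpoch_Suc a_def b_def)
    have 2: "qbinom Q (int n) (int (Suc k)) =
        qpoch Q Q n / ((qpoch Q Q k * a) * qpoch Q Q d)"
      by (subst qbinom_eq) (simp_all add: d qpoch_Suc a_def b_def)
    have 3: "qbinom Q (int n) (int k) = qpoch Q Q n / (qpoch Q Q k * (qpoch Q Q d * b))"
      by (subst qbinom_eq) (simp_all add: d qpoch_Suc a_def b_def)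
    \<comment> \<open>Pascal's rule comes from splitting \<open>1 - Q^(n+1)\<close> at the power
      \<open>Q^(n-k)\<close>, here \<open>e\<close>.\<close>
    have 4: "1 - Q ^ Suc n = b + e * a"
      by (simp add: a_def b_def d e_def algebra_simps power_add)
    have 5: "Q ^ (n - k) = e" using d by (simp add: e_def)
    show ?thesis
      unfolding 1 2 3 4 5 using a qpoch_self_nonzero[of k] qpoch_self_nonzero[of d]
      by (simp add: field_simps)
  qed
next
  case False
  then show ?thesis by (simp add: qbinom_def)
qed

end

lemma q_not_root_of_unity_of_nat:
  assumes "k \<ge> 2" shows "q_not_root_of_unity (rat_of_nat k)"
proof
  show "rat_of_nat k \<noteq> 0" using assms by simp
  fix n :: nat assume "n > 0"
  then have "1 < k ^ n" using assms by (intro one_less_power) auto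
  then show "rat_of_nat k ^ n \<noteq> 1" by (metis less_irrefl of_nat_1_eq_iff of_nat_power)
qed

section \<open>Counting subspaces\<close>

text \<open>\<open>K\<close> is a finite subfield, given as a set because in the inert case the base
  field is a proper subfield of the coefficient field. Dimensions are read off from indices that are
  powers of \<open>card K\<close>.\<close>

locale finite_scalars = vector_space scale
  for scale :: "'b::field \<Rightarrow> 'v::ab_group_add \<Rightarrow> 'v" +
  fixes K :: "'b set"
  assumes finite_K: "finite K" and add_subgrp_K: "add_subgrp K" and one_K: "1 \<in> K"
    and mult_K: "a \<in> K \<Longrightarrow> b \<in> K \<Longrightarrow> a * b \<in> K"
    and inverse_K: "a \<in> K \<Longrightarrow> inverse a \<in> K"
begin

abbreviation "q \<equiv> card K"

definition ksub :: "'v set \<Rightarrow> bool" where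
  "ksub U \<longleftrightarrow> add_subgrp U \<and> (\<forall>c\<in>K. \<forall>u\<in>U. scale c u \<in> U)"

definition line :: "'v \<Rightarrow> 'v set" where
  "line v = (\<lambda>c. scale c v) ` K"

lemma q_ge_2: "q \<ge> 2"
proof -
  have "card {0 :: 'b, 1} \<le> q"
    using finite_K add_subgrp_0[OF add_subgrp_K] one_K by (intro card_mono) auto
  then show ?thesis by simp
qed

lemma ksub_add_subgrp: "ksub U \<Longrightarrow> add_subgrp U"
  by (simp add: ksub_def)

lemma ksub_scale: "ksub U \<Longrightarrow> c \<in> K \<Longrightarrow> u \<in> U \<Longrightarrow> scale c u \<in> U"
  by (simp add: ksub_def)

lemma ksub_Int: "ksub U \<Longrightarrow> ksub V \<Longrightarrow> ksub (U \<inter> V)"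
  by (auto simp: ksub_def add_subgrp_Int)

lemma ksub_ssum: "ksub U \<Longrightarrow> ksub V \<Longrightarrow> ksub (ssum U V)"
  by (auto simp: ksub_def add_subgrp_ssum scale_right_distrib elim!: ssum_memE intro!: ssum_memI)

lemma ksub_line: "ksub (line v)"
proof -
  have "add_subgrp (line v)"
  proof (rule add_subgrpI)
    show "0 \<in> line v"
      using add_subgrp_0[OF add_subgrp_K] by (auto simp: line_def intro!: image_eqI[of _ _ 0])
    fix x y assume "x \<in> line v" "y \<in> line v"
    then obtain a b where "a \<in> K" "b \<in> K" "x = scale a v" "y = scale b v" by (auto simp: line_def)
    then show "x - y \<in> line v"
      using add_subgrp_diff[OF add_subgrp_K]
      by (auto simp: line_def scale_left_diff_distrib intro!: image_eqI[of _ _ "a - b"])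
  qed
  then show ?thesis using mult_K by (auto simp: ksub_def line_def)
qed

lemma mem_line: "v \<in> line v"
  using one_K by (auto simp: line_def intro!: image_eqI[of _ _ 1])

lemma line_subset_iff: "ksub U \<Longrightarrow> line v \<subseteq> U \<longleftrightarrow> v \<in> U"
  using mem_line by (auto simp: line_def ksub_scale)

lemma ssum_line_subset_iff:
  "ksub A \<Longrightarrow> ksub V \<Longrightarrow> ssum A (line v) \<subseteq> V \<longleftrightarrow> A \<subseteq> V \<and> v \<in> V"
  by (meson ksub_add_subgrp ksub_line line_subset_iff order_trans ssum_least ssum_upper1 ssum_upper2)

lemma ssum_line_between:
  assumes "ksub A" "ksub C" "A \<subseteq> C" "v \<in> C"
  shows "ksub (ssum A (line v))" "ssum A (line v) \<subseteq> C" "A \<subseteq> ssum A (line v)"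
  using assms ssum_line_subset_iff[of A C v] ksub_ssum[OF assms(1) ksub_line]
    ssum_upper1[OF ksub_add_subgrp[OF ksub_line]] by auto

text \<open>Multiples of \<open>v\<close> represent all classes of \<open>A + K v\<close> modulo
  \<open>A\<close>; as \<open>K\<close> has inverses and \<open>v \<notin> A\<close>, only the
  scalar 0 gives the trivial class.\<close>

lemma idx_ssum_line:
  assumes A: "ksub A" and v: "v \<notin> A"
  shows "idx A (ssum A (line v)) = q" "finite (cosets A (ssum A (line v)))"
proof -
  have 0: "add_subgrp {0 :: 'b}" by (auto simp: add_subgrp_def)
  have 1: "scale c v \<in> A \<longleftrightarrow> c \<in> {0}" if "c \<in> K" for c
  proof
    assume cA: "scale c v \<in> A"
    show "c \<in> {0}"
    proof (rule ccontr)
      assume "c \<notin> {0}"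
      then have "scale (inverse c) (scale c v) = v" by simp
      then show False using ksub_scale[OF A inverse_K[OF that] cA] v by simp
    qed
  qed (use add_subgrp_0[OF ksub_add_subgrp[OF A]] in auto)
  have 2: "\<exists>c\<in>K. y - scale c v \<in> A" if y: "y \<in> ssum A (line v)" for y
  proof -
    from y obtain a c where "a \<in> A" "c \<in> K" "y = a + scale c v" by (auto elim!: ssum_memE simp: line_def)
    then show ?thesis by (intro bexI[of _ c]) auto
  qed
  have 3: "scale c v \<in> ssum A (line v)" if "c \<in> K" for c
    using that ssum_upper2[OF ksub_add_subgrp[OF A], of "line v"] by (auto simp: line_def)
  note * = cosets_bij[OF 0 add_subgrp_K ksub_add_subgrp[OF A], of "\<lambda>c. scale c v" "ssum A (line v)",
      OF scale_left_diff_distrib 2 3 1]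
  have "cosets {0} K = (\<lambda>c. {c}) ` K" by (auto simp: cosets_def)
  then have "idx {0} K = q" "finite (cosets {0} K)"
    using finite_K by (auto simp: idx_def card_image)
  then show "idx A (ssum A (line v)) = q" "finite (cosets A (ssum A (line v)))"
    using * by auto
qed

lemma idx_ssum_line_tower:
  assumes A: "ksub A" and C: "ksub C" and AC: "A \<subseteq> C" and fin: "finite (cosets A C)"
    and v: "v \<in> C" "v \<notin> A"
  shows "idx A C = q * idx (ssum A (line v)) C" "finite (cosets (ssum A (line v)) C)"
proof -
  have s: "ksub (ssum A (line v))" using A ksub_line ksub_ssum by blast
  have le: "A \<subseteq> ssum A (line v)" "ssum A (line v) \<subseteq> C"
    using ssum_line_subset_iff[OF A s] ssum_line_subset_iff[OF A C] v AC by auto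
  show "idx A C = q * idx (ssum A (line v)) C" "finite (cosets (ssum A (line v)) C)"
    using cosets_tower[OF ksub_add_subgrp[OF A] ksub_add_subgrp[OF s] ksub_add_subgrp[OF C] le] fin
      idx_ssum_line[OF A v(2)] by auto
qed

lemma idx_eq_power:
  assumes "ksub A" "ksub C" "A \<subseteq> C" "finite (cosets A C)"
  shows "\<exists>d. idx A C = q ^ d"
  using assms
proof (induction "idx A C" arbitrary: A rule: less_induct)
  case less
  show ?case
  proof (cases "A = C")
    case True
    then show ?thesis using idx_self[OF ksub_add_subgrp[OF less(3)]] by (auto intro: exI[of _ 0])
  next
    case False
    then obtain v where v: "v \<in> C" "v \<notin> A" using less by auto
    let ?A = "ssum A (line v)"
    note t = idx_ssum_line_tower[OF less(2-5) v]
    have "idx ?A C < idx A C"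
      using t q_ge_2 idx_pos[OF ksub_add_subgrp[OF less(3)] t(2)] by simp
    then obtain d where "idx ?A C = q ^ d"
      using less(1)[OF _ _ less(3)] t(2) ssum_line_between[OF less(2-4) v(1)] by blast
    then show ?thesis using t by (auto intro: exI[of _ "Suc d"])
  qed
qed

text \<open>Lines are adjoined to \<open>A\<close> one at a time until only index \<open>q\<close>
  is left; the hyperplane found above the enlarged space also serves for \<open>A\<close>.\<close>

lemma exists_hyperplane:
  assumes "ksub A" "ksub C" "A \<subseteq> C" "finite (cosets A C)" "idx A C = q ^ Suc a"
  shows "\<exists>B. ksub B \<and> A \<subseteq> B \<and> B \<subseteq> C \<and> idx A B = q ^ a \<and> idx B C = q"
  using assms
proof (induction a arbitrary: A)
  case 0
  then show ?case using idx_self[OF ksub_add_subgrp[OF 0(1)]] by auto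
next
  case (Suc a)
  have "1 < q ^ Suc (Suc a)" using q_ge_2 by (intro one_less_power) auto
  then have "A \<noteq> C" using idx_self[OF ksub_add_subgrp[OF Suc(3)]] Suc.prems by auto
  then obtain v where v: "v \<in> C" "v \<notin> A" using Suc by auto
  let ?A = "ssum A (line v)"
  note t = idx_ssum_line_tower[OF Suc(2-5) v]
  note A = ssum_line_between[OF Suc(2-4) v(1)]
  have "idx ?A C = q ^ Suc a" using Suc.prems t q_ge_2 by auto
  then obtain B where B: "ksub B" "?A \<subseteq> B" "B \<subseteq> C" "idx ?A B = q ^ a" "idx B C = q"
    using Suc.IH[OF A(1) Suc(3) A(2) t(2)] by blast
  have "finite (cosets A B)"
    using cosets_tower(1)[of A B C] Suc.prems B A ksub_add_subgrp by auto
  then have "idx A B = q ^ Suc a"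
    using idx_ssum_line_tower(1)[of A B v] Suc.prems B A v mem_line ssum_line_subset_iff[OF Suc(2) B(1)]
    by auto
  then show ?case using B A by (intro exI[of _ B]) auto
qed

definition kbetween :: "'v set \<Rightarrow> 'v set \<Rightarrow> 'v set set" where
  "kbetween A C = {V. ksub V \<and> A \<subseteq> V \<and> V \<subseteq> C}"

lemma finite_kbetween:
  "ksub A \<Longrightarrow> ksub C \<Longrightarrow> finite (cosets A C) \<Longrightarrow> finite (kbetween A C)"
  by (rule finite_subset[OF _ finite_between[of A C]]) (auto simp: kbetween_def ksub_add_subgrp)

lemma kbetween_idx:
  assumes "ksub A" "ksub C" "finite (cosets A C)" "V \<in> kbetween A C"
  shows "finite (cosets A V)" "finite (cosets V C)" "idx A C = idx A V * idx V C"
  using cosets_tower[of A V C] assms by (auto simp: kbetween_def ksub_add_subgrp)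

text \<open>Double counting of the pairs of an intermediate space \<open>V\<close> and a nontrivial coset of \<open>A\<close> in \<open>V\<close>.\<close>

lemma card_kbetween_idx:
  assumes "ksub A" "ksub C" "A \<subseteq> C" "finite (cosets A C)" "idx A C = q ^ d"
  shows "rat_of_nat (card {V \<in> kbetween A C. idx A V = q ^ e}) = qbinom (of_nat q) (int d) (int e)"
  using assms
proof (induction e arbitrary: A d)
  case 0
  interpret q_not_root_of_unity "of_nat q :: rat" by (rule q_not_root_of_unity_of_nat[OF q_ge_2])
  have "{V \<in> kbetween A C. idx A V = q ^ 0} = {A}"
    using 0 idx_eq_1_iff[of A] idx_self[of A] by (auto simp: kbetween_def ksub_add_subgrp)
  then show ?case by (simp add: qbinom_0_right)
next
  case (Suc e)
  interpret q_not_root_of_unity "of_nat q :: rat" by (rule q_not_root_of_unity_of_nat[OF q_ge_2])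
  have q_pow: "q ^ Suc e > 1" using q_ge_2 by (intro one_less_power) auto
  note sub = ksub_add_subgrp[OF Suc(2)] ksub_add_subgrp[OF Suc(3)]
  let ?V = "{V \<in> kbetween A C. idx A V = q ^ Suc e}"
  show ?case
  proof (cases d)
    case 0
    then have "A = C" using idx_eq_1_iff[OF sub] Suc by auto
    then have "V = A" if "V \<in> kbetween A C" for V using that by (auto simp: kbetween_def)
    then have "?V = {}" using idx_self[OF sub(1)] q_pow by force
    then show ?thesis unfolding \<open>?V = {}\<close> using 0 by (simp add: qbinom_def)
  next
    case (Suc d')
    have finV: "finite ?V" using finite_kbetween[OF Suc.prems(1,2,4)] by auto
    have cosA: "A \<in> cosets A V" if "add_subgrp V" for V
      using add_subgrp_0[OF that] by (force simp: cosets_def)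
    have "(\<Sum>V\<in>?V. card (cosets A V - {A})) = (\<Sum>V\<in>?V. \<Sum>D\<in>cosets A C - {A}. if D \<in> cosets A V then 1 else 0)"
    proof (rule sum.cong[OF refl])
      fix V assume V: "V \<in> ?V"
      then have "cosets A V - {A} = {D \<in> cosets A C - {A}. D \<in> cosets A V}"
        by (auto simp: cosets_def kbetween_def)
      then show "card (cosets A V - {A}) = (\<Sum>D\<in>cosets A C - {A}. if D \<in> cosets A V then 1 else 0)"
        using Suc.prems by (simp add: sum.If_cases Int_def)
    qed
    also have "\<dots> = (\<Sum>D\<in>cosets A C - {A}. card {V \<in> ?V. D \<in> cosets A V})"
      using finV by (subst sum.swap) (simp add: sum.If_cases Int_def)
    finally have eq: "(\<Sum>V\<in>?V. card (cosets A V - {A})) = (\<Sum>D\<in>cosets A C - {A}. card {V \<in> ?V. D \<in> cosets A V})" .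
    have "card (cosets A V - {A}) = q ^ Suc e - 1" if "V \<in> ?V" for V
      using that cosA[of V] kbetween_idx[OF Suc.prems(1,2,4), of V]
      by (auto simp: idx_def kbetween_def ksub_add_subgrp)
    then have l: "(\<Sum>V\<in>?V. card (cosets A V - {A})) = card ?V * (q ^ Suc e - 1)" by simp
    \<comment> \<open>A coset \<open>v + A\<close> belongs to \<open>V\<close> exactly when
      \<open>v \<in> V\<close>, so the \<open>V\<close> in question are the spaces above
      \<open>A + K v\<close>. Both dimensions drop by one, and the induction hypothesis counts
      them.\<close>
    have "rat_of_nat (card {V \<in> ?V. D \<in> cosets A V}) = qbinom (of_nat q) (int d') (int e)"
      if "D \<in> cosets A C - {A}" for D
    proof -
      from that obtain v where v: "v \<in> C" "D = (+) v ` A" "D \<noteq> A" by (auto simp: cosets_def)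
      have vA: "v \<notin> A" using v coset_eq_iff[OF sub(1), of v 0] by auto
      have DV: "D \<in> cosets A V \<longleftrightarrow> v \<in> V" if "ksub V" "A \<subseteq> V" for V
      proof
        assume "D \<in> cosets A V"
        then obtain w where w: "w \<in> V" "(+) v ` A = (+) w ` A" using v by (auto simp: cosets_def)
        then have "v - w \<in> V" using coset_eq_iff[OF sub(1)] that by auto
        then show "v \<in> V" using w add_subgrp_add[OF ksub_add_subgrp[OF that(1)], of "v - w" w] by auto
      qed (auto simp: cosets_def v)
      let ?A = "ssum A (line v)"
      note t = idx_ssum_line_tower[OF Suc.prems(1-4) v(1) vA]
      note A = ssum_line_between[OF Suc.prems(1-3) v(1)]
      have "V \<in> ?V \<and> D \<in> cosets A V \<longleftrightarrow> V \<in> kbetween ?A C \<and> idx ?A V = q ^ e" for V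
      proof -
        have "idx A V = q * idx ?A V" if "V \<in> kbetween A C" "v \<in> V"
          using that idx_ssum_line_tower(1)[of A V v] kbetween_idx[OF Suc.prems(1,2,4)] Suc.prems vA
          by (auto simp: kbetween_def)
        moreover have "V \<in> kbetween A C \<and> D \<in> cosets A V \<longleftrightarrow> V \<in> kbetween ?A C"
          using DV[of V] ssum_line_subset_iff[OF Suc.prems(1), of V v] by (auto simp: kbetween_def)
        moreover have "D \<in> cosets A V \<longleftrightarrow> v \<in> V" if "V \<in> kbetween A C" 
          using DV[of V] that by (auto simp: kbetween_def)
        ultimately show ?thesis using q_ge_2 by auto
      qed
      then have "{V \<in> ?V. D \<in> cosets A V} = {V \<in> kbetween ?A C. idx ?A V = q ^ e}" by blast
      moreover have "idx ?A C = q ^ d'" using t Suc Suc.prems q_ge_2 by auto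
      ultimately show ?thesis using Suc.IH[OF A(1) Suc.prems(2) A(2) t(2)] by simp
    qed
    then have "rat_of_nat (\<Sum>D\<in>cosets A C - {A}. card {V \<in> ?V. D \<in> cosets A V})
        = of_nat (card (cosets A C - {A})) * qbinom (of_nat q) (int d') (int e)" by simp
    also have "card (cosets A C - {A}) = q ^ Suc d' - 1"
      using cosA[OF sub(2)] Suc.prems Suc by (simp add: idx_def)
    finally have "rat_of_nat (card ?V * (q ^ Suc e - 1)) =
        of_nat (q ^ Suc d' - 1) * qbinom (of_nat q) (int d') (int e)"
      unfolding eq[unfolded l] .
    moreover have "q ^ Suc d' \<ge> 1" using q_ge_2 by simp
    ultimately have "rat_of_nat (card ?V) * (of_nat q ^ Suc e - 1) =
        (of_nat q ^ Suc d' - 1) * qbinom (of_nat q) (int d') (int e)"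
      using q_pow by (simp add: of_nat_diff)
    also have "\<dots> = qbinom (of_nat q) (int d) (int (Suc e)) * (of_nat q ^ Suc e - 1)"
      using qbinom_absorb[of d' e] Suc by simp
    finally show ?thesis using Q_power_neq_1[of "Suc e"] by simp
  qed
qed

end

section \<open>Constants and monomials among Dirichlet series\<close>

lemma dir_nth_monom: "dir_nth (dir_monom c k) j = (if j = k \<and> 0 < j then c else 0)"
  by (simp add: dir_monom_def Abs_dirichlet_inverse)

lemma dir_nth_monom_times:
  fixes c :: "'a::comm_ring_1"
  assumes "k > 0" "j > 0"
  shows "dir_nth (dir_monom c k * f) j = (if k dvd j then c * dir_nth f (j div k) else 0)"
proof -
  have "dir_nth (dir_monom c k * f) j = (\<Sum>p | fst p * snd p = j. dir_nth (dir_monom c k) (fst p) * dir_nth f (snd p))"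
    using assms by (simp add: dir_nth_times case_prod_unfold)
  also have "\<dots> = (\<Sum>p\<in>{p. fst p * snd p = j \<and> fst p = k}. c * dir_nth f (snd p))"
  proof (rule sum.mono_neutral_cong_right)
    show "finite {p. fst p * snd p = j}"
      using finite_factor_pairs[OF assms(2)] by (simp add: case_prod_unfold)
  qed (use assms in \<open>auto simp: dir_nth_monom\<close>)
  also have "{p. fst p * snd p = j \<and> fst p = k} = (if k dvd j then {(k, j div k)} else {})"
    using assms by (auto simp: prod_eq_iff)
  finally show ?thesis by simp
qed

lemma dir_monom_mult:
  "j > 0 \<Longrightarrow> k > 0 \<Longrightarrow> dir_monom a j * dir_monom b k = dir_monom (a * b :: 'a::comm_ring_1) (j * k)"
  by (rule dirichlet_eqI) (auto simp: dir_nth_monom_times dir_nth_monom)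

lemma dir_monom_add: "dir_monom (a + b :: 'a::comm_ring_1) k = dir_monom a k + dir_monom b k"
  by (rule dirichlet_eqI) (auto simp: plus_dirichlet.rep_eq dir_nth_monom)

lemma dir_monom_0 [simp]: "dir_monom (0 :: 'a::comm_ring_1) k = 0"
  by (rule dirichlet_eqI) (auto simp: zero_dirichlet.rep_eq dir_nth_monom)

lemma dir_monom_1_1: "dir_monom (1 :: 'a::comm_ring_1) 1 = 1"
  by (rule dirichlet_eqI) (auto simp: one_dirichlet.rep_eq dir_nth_monom)

abbreviation dconst :: "'a::comm_ring_1 \<Rightarrow> 'a dirichlet" where
  "dconst c \<equiv> dir_monom c (Suc 0)"

lemma dconst_1 [simp]: "dconst 1 = (1 :: 'a::comm_ring_1 dirichlet)"
  using dir_monom_1_1 by simp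

lemma dconst_mult: "dconst (a * b :: 'a::comm_ring_1) = dconst a * dconst b"
  by (simp add: dir_monom_mult)

lemma dconst_of_nat: "dconst (of_nat n :: 'a::comm_ring_1) = of_nat n"
  by (induction n) (simp_all add: dir_monom_add)

lemma dconst_sum: "dconst (sum f A :: 'a::comm_ring_1) = (\<Sum>x\<in>A. dconst (f x))"
  by (induction A rule: infinite_finite_induct) (simp_all add: dir_monom_add)

lemma dir_monom_power: "k > 0 \<Longrightarrow> dir_monom (1 :: 'a::comm_ring_1) (k ^ n) = dir_monom 1 k ^ n"
proof (induction n)
  case (Suc n)
  then show ?case using dir_monom_mult[of k "k ^ n" "1 :: 'a" 1] by simp
qed simp

lemma dir_nth_sum: "dir_nth (sum f A) k = (\<Sum>x\<in>A. dir_nth (f x :: 'a::comm_ring_1 dirichlet) k)"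
  by (induction A rule: infinite_finite_induct)
    (simp_all add: zero_dirichlet.rep_eq plus_dirichlet.rep_eq)

section \<open>Counting lattices\<close>

text \<open>The expected sum over lattices \<open>L\<close> with \<open>L + \<xi> P = V\<close>, as
  a function of the dimension \<open>a\<close> of \<open>V/\<xi>P\<close> inside the
  \<open>N\<close>-dimensional space \<open>P/\<xi>P\<close>. The power of \<open>t\<close> records
  \<open>(P : V)\<close>, the binomial counts the spaces \<open>V'\<close> of dimension
  \<open>b\<close> above \<open>V\<close>, and the power of \<open>Q\<close> is the fibre size
  \<open>(P : V')^a\<close>.\<close>

primrec lat_poly :: "'a::field \<Rightarrow> 'a dirichlet \<Rightarrow> nat \<Rightarrow> nat \<Rightarrow> nat \<Rightarrow> 'a dirichlet" where
  "lat_poly Q t N 0 a = (if a = N then 1 else 0)"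
| "lat_poly Q t N (Suc m) a = t ^ (N - a) *
     (\<Sum>b\<in>{a..N}. dconst (qbinom Q (int (N - a)) (int (b - a)) * Q ^ (a * (N - b))) * lat_poly Q t N m b)"

text \<open>Here \<open>f\<close> is a mere parametrisation, not a homomorphism: it will send a lift
  of a vector to the lattice that it generates.\<close>

lemma card_image_cosets:
  assumes A: "add_subgrp A" and ker: "\<And>x y. x \<in> U \<Longrightarrow> y \<in> U \<Longrightarrow> f x = f y \<longleftrightarrow> x - y \<in> A"
  shows "card (f ` U) = idx A U"
proof -
  define g where "g y = (+) (inv_into U f y) ` A" for y
  have g: "g (f x) = (+) x ` A" if "x \<in> U" for x
    unfolding g_def coset_eq_iff[OF A]
    using ker[of "inv_into U f (f x)" x] that by (simp add: inv_into_into f_inv_into_f)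
  have "bij_betw g (f ` U) (cosets A U)"
    unfolding bij_betw_def
  proof
    show "inj_on g (f ` U)" using ker by (auto intro!: inj_onI simp: g coset_eq_iff[OF A])
    show "g ` f ` U = cosets A U" unfolding cosets_def image_image by (rule image_cong) (simp_all add: g)
  qed
  then show ?thesis by (simp add: idx_def bij_betw_same_card)
qed

text \<open>\<open>\<xi>\<close> abstracts multiplication by a variable. The locale is used twice:
  for \<open>S^n\<close> over the base field with \<open>N = 2n\<close>, and for vectors over a
  power series ring and its own coefficient field with \<open>N = n\<close>.\<close>

locale lattice_count = finite_scalars scale K
  for scale :: "'b::field \<Rightarrow> 'v::ab_group_add \<Rightarrow> 'v" and K +
  fixes P :: "'v set" and \<xi> :: "'v \<Rightarrow> 'v" and N :: nat
  assumes ksub_P: "ksub P" and X_diff: "\<xi> (x - y) = \<xi> x - \<xi> y"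
    and X_scale: "\<xi> (scale c x) = scale c (\<xi> x)"
    and X_P: "x \<in> P \<Longrightarrow> \<xi> x \<in> P" and inj_X: "inj_on \<xi> P"
    and finite_XP: "finite (cosets (\<xi> ` P) P)" and idx_XP: "idx (\<xi> ` P) P = q ^ N"
begin

abbreviation "XP \<equiv> \<xi> ` P"

definition xsub :: "'v set \<Rightarrow> bool" where
  "xsub L \<longleftrightarrow> ksub L \<and> L \<subseteq> P \<and> \<xi> ` L \<subseteq> L"

definition lat :: "nat \<Rightarrow> 'v set set" where
  "lat m = {L. xsub L \<and> (\<xi> ^^ m) ` P \<subseteq> L}"

lemma X_0: "\<xi> 0 = 0" using X_diff[of 0 0] by simp

lemma X_add: "\<xi> (x + y) = \<xi> x + \<xi> y"
  using X_diff[of x "- y"] X_diff[of 0 y] by (simp add: X_0)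

lemma ksub_image_X: "ksub L \<Longrightarrow> ksub (\<xi> ` L)"
proof -
  assume L: "ksub L"
  have "add_subgrp (\<xi> ` L)"
  proof (rule add_subgrpI)
    show "0 \<in> \<xi> ` L" using add_subgrp_0[OF ksub_add_subgrp[OF L]] X_0 by force
    fix x y assume "x \<in> \<xi> ` L" "y \<in> \<xi> ` L"
    then obtain a b where "a \<in> L" "b \<in> L" "x = \<xi> a" "y = \<xi> b" by auto
    then show "x - y \<in> \<xi> ` L"
      using add_subgrp_diff[OF ksub_add_subgrp[OF L], of a b] by (auto simp: X_diff[symmetric])
  qed
  then show ?thesis using L unfolding ksub_def by (auto simp: X_scale[symmetric])
qed

lemma ksub_XP: "ksub XP" by (rule ksub_image_X[OF ksub_P])

lemma XP_subset: "XP \<subseteq> P" using X_P by auto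

lemma X_image_mem_iff: "x \<in> P \<Longrightarrow> L \<subseteq> P \<Longrightarrow> \<xi> x \<in> \<xi> ` L \<longleftrightarrow> x \<in> L"
  by (rule inj_on_image_mem_iff[OF inj_X])

lemma finite_idx_X_image:
  assumes "ksub L" "L \<subseteq> P"
  shows "idx (\<xi> ` L) XP = idx L P" "finite (cosets (\<xi> ` L) XP) \<longleftrightarrow> finite (cosets L P)"
  using cosets_inj_image[OF ksub_add_subgrp[OF assms(1)] ksub_add_subgrp[OF ksub_P] assms(2) X_diff inj_X]
  by auto

lemma ksub_X_power: "ksub ((\<xi> ^^ m) ` P)" and X_power_P: "(\<xi> ^^ m) ` P \<subseteq> P"
  and finite_X_power: "finite (cosets ((\<xi> ^^ m) ` P) P)"
proof (induction m)
  case 0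
  case 1 then show ?case using ksub_P by simp
  case 2 then show ?case by simp
  case 3 then show ?case using finite_cosets_self[OF ksub_add_subgrp[OF ksub_P]] by simp
next
  case (Suc m)
  have *: "(\<xi> ^^ Suc m) ` P = \<xi> ` ((\<xi> ^^ m) ` P)" by (auto simp: image_comp)
  case 1 show ?case unfolding * using ksub_image_X Suc by auto
  case 2 show ?case unfolding * using Suc X_P by auto
  have "\<xi> ` ((\<xi> ^^ m) ` P) \<subseteq> XP" using Suc by auto
  then have "finite (cosets (\<xi> ` ((\<xi> ^^ m) ` P)) P)"
    using cosets_tower(1)[of "\<xi> ` ((\<xi> ^^ m) ` P)" XP P] ksub_image_X[OF Suc(1)] ksub_XP ksub_P XP_subset
      finite_idx_X_image[OF Suc(1,2)] Suc(3) finite_XP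
    by (auto simp: ksub_add_subgrp)
  case 3 show ?case unfolding * by fact
qed

lemma lat_kbetween: "L \<in> lat m \<Longrightarrow> L \<in> kbetween ((\<xi> ^^ m) ` P) P"
  by (auto simp: lat_def xsub_def kbetween_def)

lemma finite_lat: "finite (lat m)"
  by (rule finite_subset[OF _ finite_kbetween[OF ksub_X_power ksub_P finite_X_power]])
    (use lat_kbetween in blast)

lemma finite_cosets_lat: "L \<in> lat m \<Longrightarrow> finite (cosets L P)"
  by (rule kbetween_idx(2)[OF ksub_X_power ksub_P finite_X_power lat_kbetween])

text \<open>The fibre of \<open>L \<mapsto> (L + \<xi> P, \<xi>\<^sup>-\<^sup>1 (L \<inter> \<xi> P))\<close> over \<open>(V, L')\<close>, on which the recursion
  in \<open>m\<close> rests.\<close>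

definition fib :: "'v set \<Rightarrow> 'v set \<Rightarrow> 'v set set" where
  "fib V L' = {L. xsub L \<and> ssum L XP = V \<and> L \<inter> XP = \<xi> ` L'}"

lemma fib_subset:
  assumes "L \<in> fib V L'" "L' \<subseteq> P" shows "L \<subseteq> L'"
proof
  fix x assume x: "x \<in> L"
  have L: "L \<subseteq> P" "\<xi> ` L \<subseteq> L" "L \<inter> XP = \<xi> ` L'" using assms unfolding fib_def xsub_def by blast+
  then have "\<xi> x \<in> \<xi> ` L'" using x by blast
  then show "x \<in> L'" using X_image_mem_iff[OF _ assms(2)] x L by blast
qed

text \<open>As \<open>\<xi>\<close> is injective, \<open>(\<xi>P : \<xi>L') = (P : L')\<close>.
  Splitting the left side at \<open>L' \<inter> \<xi>P\<close> and the right side at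
  \<open>L' + \<xi>P\<close>, the second isomorphism theorem cancels
  \<open>(\<xi>P : L' \<inter> \<xi>P)\<close> against \<open>(L' + \<xi>P : L')\<close>.\<close>

lemma idx_X_image_Int:
  assumes L': "xsub L'" "finite (cosets L' P)"
  shows "idx (\<xi> ` L') (L' \<inter> XP) = idx (ssum L' XP) P"
proof -
  have L: "ksub L'" "L' \<subseteq> P" "\<xi> ` L' \<subseteq> L'" using L' by (auto simp: xsub_def)
  note sub = ksub_add_subgrp[OF ksub_image_X[OF L(1)]] ksub_add_subgrp[OF ksub_Int[OF L(1) ksub_XP]]
    ksub_add_subgrp[OF ksub_XP] ksub_add_subgrp[OF L(1)] ksub_add_subgrp[OF ksub_P]
    ksub_add_subgrp[OF ksub_ssum[OF L(1) ksub_XP]]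
  have f: "finite (cosets (\<xi> ` L') XP)" using finite_idx_X_image[OF L(1,2)] L' by simp
  have "idx (\<xi> ` L') XP = idx (\<xi> ` L') (L' \<inter> XP) * idx (L' \<inter> XP) XP"
    using cosets_tower(2)[of "\<xi> ` L'" "L' \<inter> XP" XP] sub L f by auto
  moreover have le: "L' \<subseteq> ssum L' XP" "ssum L' XP \<subseteq> P"
    using ssum_upper1[OF sub(3)] ssum_least[OF sub(5) L(2) XP_subset] by auto
  note t = cosets_tower[OF sub(4,6,5) le]
  moreover have "idx L' P = idx L' (ssum L' XP) * idx (ssum L' XP) P"
    "finite (cosets L' (ssum L' XP))"
    using t L' by auto
  moreover have "idx (L' \<inter> XP) XP = idx L' (ssum L' XP)"
    by (rule cosets_second_iso(1)[OF sub(4,3)])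
  ultimately show ?thesis
    using finite_idx_X_image(1)[OF L(1,2)] idx_pos[OF sub(6), of L'] by auto
qed

text \<open>A lattice over \<open>V\<close> that extends \<open>L0\<close> is \<open>L0\<close> plus
  the line of one vector outside \<open>V0\<close>. The vector must lie in \<open>L'\<close>, by
  \<open>fib_subset\<close>, so it may be taken as \<open>v0 + u\<close> with \<open>u\<close> in
  \<open>L' \<inter> \<xi>P\<close>, and changing \<open>u\<close> by an element of
  \<open>\<xi>L'\<close> does not change the lattice.\<close>

lemma card_fib_hyperplane:
  assumes L': "xsub L'" "finite (cosets L' P)"
    and V: "V \<in> kbetween XP P" "V \<subseteq> ssum L' XP"
    and V0: "V0 \<in> kbetween XP V" "idx V0 V = q" and L0: "L0 \<in> fib V0 L'"
  shows "card {L \<in> fib V L'. L \<inter> V0 = L0} = idx (ssum L' XP) P"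
proof -
  have kL': "ksub L'" "L' \<subseteq> P" "\<xi> ` L' \<subseteq> L'" using L' by (auto simp: xsub_def)
  have kL0: "ksub L0" "L0 \<subseteq> P" "\<xi> ` L0 \<subseteq> L0" "ssum L0 XP = V0" "L0 \<inter> XP = \<xi> ` L'"
    using L0 by (auto simp: fib_def xsub_def)
  have kV: "ksub V" "XP \<subseteq> V" "V \<subseteq> P" "ksub V0" "XP \<subseteq> V0" "V0 \<subseteq> V"
    using V V0 by (auto simp: kbetween_def)
  note sub = ksub_add_subgrp
  have L0V0: "L0 \<subseteq> V0" using kL0(4) ssum_upper1[OF sub[OF ksub_XP]] by auto
  have "V0 \<noteq> V" using V0 idx_self[OF sub[OF kV(1)]] q_ge_2 by auto
  then obtain v where v: "v \<in> V" "v \<notin> V0" using kV by auto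
  \<comment> \<open>The assumption \<open>V \<subseteq> L' + \<xi>P\<close> allows replacing
    \<open>v\<close> by a vector \<open>v0\<close> of \<open>L'\<close> in the same class modulo
    \<open>\<xi>P\<close>.\<close>
  have "v \<in> ssum L' XP" using v(1) V(2) by blast
  then obtain v0 z where v0: "v0 \<in> L'" "z \<in> XP" "v = v0 + z" by (rule ssum_memE)
  have z: "z \<in> V0" "z \<in> V" using v0(2) kV by blast+
  have v0V: "v0 \<in> V" "v0 \<notin> V0"
    using add_subgrp_diff[OF sub[OF kV(1)] v(1) z(2)] add_subgrp_add[OF sub[OF kV(4)] _ z(1), of v0]
      v(2) v0(3) by auto
  let ?U = "L' \<inter> XP"
  define F where "F u = ssum L0 (line (v0 + u))" for u
  have uV: "v0 + u \<in> V" "v0 + u \<notin> V0" "v0 + u \<in> L'" "v0 + u \<in> P" if "u \<in> ?U" for u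
  proof -
    have u: "u \<in> V0" "u \<in> V" "u \<in> L'" using that kV by blast+
    show "v0 + u \<in> V" "v0 + u \<in> L'"
      using add_subgrp_add[OF sub[OF kV(1)] v0V(1) u(2)] add_subgrp_add[OF sub[OF kL'(1)] v0(1) u(3)]
      by auto
    then show "v0 + u \<in> P" using kV by blast
    show "v0 + u \<notin> V0" using v0V(2) u(1) add_subgrp_diff[OF sub[OF kV(4)], of "v0 + u" u] by auto
  qed
  have span: "ssum V0 (line (v0 + u)) = V" if u: "u \<in> ?U" for u
  proof -
    note b = ssum_line_between[OF kV(4) kV(1) kV(6) uV(1)[OF u]]
    have f: "finite (cosets V0 V)" using V0(2) q_ge_2 by (metis card.infinite idx_def not_numeral_le_zero)
    have "idx (ssum V0 (line (v0 + u))) V = 1"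
      using idx_ssum_line_tower[OF kV(4) kV(1) kV(6) f uV(1,2)[OF u]] V0(2) q_ge_2 by auto
    then show ?thesis using idx_eq_1_iff[OF sub[OF b(1)] sub[OF kV(1)] b(2)] by simp
  qed
  have inter: "F u \<inter> V0 = L0" if u: "u \<in> ?U" for u
  proof
    show "L0 \<subseteq> F u \<inter> V0" using L0V0 ssum_upper1[OF sub[OF ksub_line]] by (auto simp: F_def)
    show "F u \<inter> V0 \<subseteq> L0"
    proof
      fix y assume y: "y \<in> F u \<inter> V0"
      then obtain l c where l: "l \<in> L0" "c \<in> K" "y = l + scale c (v0 + u)"
        by (auto simp: F_def line_def elim!: ssum_memE)
      have "scale c (v0 + u) = y - l" using l by simp
      then have c: "scale c (v0 + u) \<in> V0" using y l L0V0 add_subgrp_diff[OF sub[OF kV(4)], of y l] by auto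
      have "c = 0"
      proof (rule ccontr)
        assume "c \<noteq> 0"
        then have "scale (inverse c) (scale c (v0 + u)) = v0 + u" by simp
        then show False using ksub_scale[OF kV(4) inverse_K[OF l(2)] c] uV[OF u] by simp
      qed
      then show "y \<in> L0" using l by simp
    qed
  qed
  have kF: "ksub (F u)" for u unfolding F_def by (intro ksub_ssum kL0 ksub_line)
  have F_in: "F u \<in> fib V L'" if u: "u \<in> ?U" for u
  proof -
    have "F u \<subseteq> P" unfolding F_def
      using ssum_line_subset_iff[OF kL0(1) ksub_P] kL0 uV[OF u] by auto
    \<comment> \<open>Stability is automatic: \<open>v0 + u\<close> lies in \<open>L'\<close>, so
      \<open>\<xi>\<close> sends it to \<open>\<xi>L' = L0 \<inter> \<xi>P\<close>, which is already
      in \<open>L0\<close>.\<close>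
    moreover have "\<xi> ` F u \<subseteq> F u"
    proof
      fix y assume "y \<in> \<xi> ` F u"
      then obtain l c where l: "l \<in> L0" "c \<in> K" "y = \<xi> l + scale c (\<xi> (v0 + u))"
        by (auto simp: F_def line_def X_add X_scale elim!: ssum_memE)
      have "\<xi> (v0 + u) \<in> L0" using uV(3)[OF u] kL0(5) by blast
      then have "scale c (\<xi> (v0 + u)) \<in> L0" using ksub_scale[OF kL0(1) l(2)] by auto
      moreover have "\<xi> l \<in> L0" using l(1) kL0(3) by blast
      ultimately have "y \<in> L0" using l(3) add_subgrp_add[OF sub[OF kL0(1)]] by auto
      then show "y \<in> F u" using ssum_upper1[OF sub[OF ksub_line]] by (auto simp: F_def)
    qed
    moreover have "ssum (F u) XP = V"
    proof
      have "F u \<subseteq> V" unfolding F_def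
        using ssum_line_subset_iff[OF kL0(1) kV(1)] L0V0 kV uV[OF u] by auto
      then show "ssum (F u) XP \<subseteq> V" using kV ssum_least[OF sub[OF kV(1)]] by auto
      have k: "ksub (ssum (F u) XP)" by (intro ksub_ssum kF ksub_XP)
      have "L0 \<subseteq> F u" "line (v0 + u) \<subseteq> F u"
        unfolding F_def using ssum_upper1[OF sub[OF ksub_line]] ssum_upper2[OF sub[OF kL0(1)]] by auto
      then have "V0 \<subseteq> ssum (F u) XP" "line (v0 + u) \<subseteq> ssum (F u) XP"
        using kL0(4) ssum_mono[of L0 "F u" XP XP] ssum_upper1[OF sub[OF ksub_XP], of "F u"] by auto
      then show "V \<subseteq> ssum (F u) XP" using span[OF u] ssum_least[OF sub[OF k]] by blast
    qed
    moreover have "F u \<inter> XP = (F u \<inter> V0) \<inter> XP" using kV(5) by blast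
    then have "F u \<inter> XP = \<xi> ` L'" using inter[OF u] kL0(5) by simp
    ultimately show ?thesis using kF[of u] unfolding fib_def xsub_def by blast
  qed
  have image: "{L \<in> fib V L'. L \<inter> V0 = L0} = F ` ?U"
  proof
    show "F ` ?U \<subseteq> {L \<in> fib V L'. L \<inter> V0 = L0}" using F_in inter by blast
    show "{L \<in> fib V L'. L \<inter> V0 = L0} \<subseteq> F ` ?U"
    proof
      fix L assume L: "L \<in> {L \<in> fib V L'. L \<inter> V0 = L0}"
      then have kL: "ksub L" "ssum L XP = V" "L \<inter> V0 = L0" "L \<subseteq> L'"
        using fib_subset[OF _ kL'(2), of L V] unfolding fib_def xsub_def by blast+
      \<comment> \<open>Since \<open>L + \<xi>P = V\<close>, some \<open>l\<close> in
        \<open>L\<close> is congruent to \<open>v0\<close> modulo \<open>\<xi>P\<close>. It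
        generates \<open>L\<close> over \<open>L0\<close>, and the wanted \<open>u\<close> is the
        difference.\<close>
      have "v0 \<in> ssum L XP" using v0V(1) kL(2) by simp
      then obtain l z where l: "l \<in> L" "z \<in> XP" "v0 = l + z" by (rule ssum_memE)
      define u where "u = l - v0"
      have "u = - z" using l by (simp add: u_def)
      then have "u \<in> XP" using add_subgrp_minus[OF sub[OF ksub_XP] l(2)] by simp
      moreover have "u \<in> L'"
        using add_subgrp_diff[OF sub[OF kL'(1)] subsetD[OF kL(4) l(1)] v0(1)] by (simp add: u_def)
      ultimately have u: "u \<in> ?U" by simp
      have lu: "v0 + u = l" by (simp add: u_def)
      have "F u \<subseteq> L" unfolding F_def lu using ssum_line_subset_iff[OF kL0(1) kL(1)] kL(3) l(1) by blast
      moreover have "L \<subseteq> F u"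
      proof
        fix y assume y: "y \<in> L"
        then have "y \<in> ssum V0 (line l)"
          using kL(2) ssum_upper1[OF sub[OF ksub_XP]] span[OF u] unfolding lu by blast
        then obtain z c where z: "z \<in> V0" "c \<in> K" "y = z + scale c l"
          by (auto simp: line_def elim!: ssum_memE)
        then have "z = y - scale c l" by simp
        then have "z \<in> L"
          using add_subgrp_diff[OF sub[OF kL(1)] y ksub_scale[OF kL(1) z(2) l(1)]] by simp
        then have "z \<in> L0" using z kL by blast
        then show "y \<in> F u" unfolding F_def lu using z by (auto simp: line_def intro!: ssum_memI)
      qed
      ultimately have "L = F u" by auto
      then show "L \<in> F ` ?U" using u by auto
    qed
  qed
  have ker: "F u = F u' \<longleftrightarrow> u - u' \<in> \<xi> ` L'" if u: "u \<in> ?U" "u' \<in> ?U" for u u'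
  proof
    have m: "v0 + u \<in> F u" for u
      unfolding F_def using ssum_upper2[OF sub[OF kL0(1)]] mem_line by auto
    assume "F u = F u'"
    then have "(v0 + u) - (v0 + u') \<in> F u"
      using m[of u] m[of u'] add_subgrp_diff[OF sub[OF kF[of u]], of "v0 + u" "v0 + u'"] by simp
    then have "u - u' \<in> F u \<inter> XP" using u add_subgrp_diff[OF sub[OF ksub_XP], of u u'] by simp
    then show "u - u' \<in> \<xi> ` L'" using F_in[OF u(1)] unfolding fib_def by blast
  next
    have le: "F u \<subseteq> F u'" if "u \<in> ?U" "u' \<in> ?U" "u - u' \<in> \<xi> ` L'" for u u'
    proof -
      have "u - u' \<in> L0" using that(3) kL0(5) by blast
      moreover have "v0 + u = (u - u') + (v0 + u')" by simp
      ultimately have "v0 + u \<in> F u'" unfolding F_def using mem_line ssum_memI by metis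
      moreover have "L0 \<subseteq> F u'" unfolding F_def using ssum_upper1[OF sub[OF ksub_line]] by auto
      ultimately show ?thesis
        unfolding F_def[of u] using ssum_line_subset_iff[OF kL0(1) kF] by blast
    qed
    assume d: "u - u' \<in> \<xi> ` L'"
    then have "u' - u \<in> \<xi> ` L'"
      using add_subgrp_diff_commute[OF sub[OF ksub_image_X[OF kL'(1)]], of u u'] by blast
    then show "F u = F u'" using d le u by blast
  qed
  show ?thesis
    unfolding image idx_X_image_Int[OF L', symmetric]
    by (rule card_image_cosets[OF sub[OF ksub_image_X[OF kL'(1)]] ker])
qed

lemma finite_fib:
  assumes L: "xsub L'" "finite (cosets L' P)"
  shows "finite (fib V L')"
proof -
  have L': "ksub L'" "L' \<subseteq> P" using L by (auto simp: xsub_def)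
  note k = ksub_image_X[OF L'(1)]
  have f: "finite (cosets (\<xi> ` L') P)"
    using cosets_tower(1)[OF ksub_add_subgrp[OF k] ksub_add_subgrp[OF ksub_XP] ksub_add_subgrp[OF ksub_P]
        image_mono[OF L'(2)] XP_subset] finite_idx_X_image(2)[OF L'] finite_XP L(2) by blast
  have "fib V L' \<subseteq> kbetween (\<xi> ` L') P" unfolding fib_def kbetween_def xsub_def by blast
  then show ?thesis by (rule finite_subset[OF _ finite_kbetween[OF k ksub_P f]])
qed

text \<open>Induction over a flag from \<open>\<xi>P\<close> up to \<open>V\<close>. Intersecting
  with a hyperplane \<open>V0\<close> maps the fibre over \<open>V\<close> to the fibre over
  \<open>V0\<close>, and each \<open>L0\<close> there has the same number of extensions, one factor
  per dimension. Over \<open>V = \<xi>P\<close> only \<open>\<xi>L'\<close> is left.\<close>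

lemma card_fib:
  assumes L': "xsub L'" "finite (cosets L' P)"
    and V: "V \<in> kbetween XP P" "V \<subseteq> ssum L' XP" and a: "idx XP V = q ^ a"
  shows "card (fib V L') = idx (ssum L' XP) P ^ a"
  using V a
proof (induction a arbitrary: V)
  case 0
  have kL': "ksub L'" "L' \<subseteq> P" "\<xi> ` L' \<subseteq> L'" using L' by (auto simp: xsub_def)
  have VX: "V = XP"
    using 0 idx_eq_1_iff[OF ksub_add_subgrp[OF ksub_XP], of V] by (auto simp: kbetween_def ksub_add_subgrp)
  have "fib V L' = {\<xi> ` L'}"
  proof -
    have "L = \<xi> ` L'" if "L \<in> fib V L'" for L
      using that ssum_upper1[OF ksub_add_subgrp[OF ksub_XP], of L] by (auto simp: fib_def VX)
    moreover have "\<xi> ` L' \<in> fib V L'"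
    proof -
      have "\<xi> ` L' \<subseteq> XP" using kL' by auto
      then have "ssum (\<xi> ` L') XP = XP"
        using ssum_absorb[of XP "\<xi> ` L'"] ksub_XP ksub_image_X[OF kL'(1)]
        by (simp add: ksub_add_subgrp ssum_commute)
      moreover have "\<xi> ` L' \<subseteq> P" "\<xi> ` \<xi> ` L' \<subseteq> \<xi> ` L'" "\<xi> ` L' \<inter> XP = \<xi> ` L'" using kL' by auto
      ultimately show ?thesis using ksub_image_X[OF kL'(1)] by (simp add: fib_def xsub_def VX)
    qed
    ultimately show ?thesis by blast
  qed
  then show ?case by simp
next
  case (Suc a)
  have kV: "ksub V" "XP \<subseteq> V" "V \<subseteq> P" using Suc.prems(1) unfolding kbetween_def by blast+
  have "finite (cosets XP V)" by (rule kbetween_idx(1)[OF ksub_XP ksub_P finite_XP Suc.prems(1)])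
  then obtain V0 where V0: "ksub V0" "XP \<subseteq> V0" "V0 \<subseteq> V" "idx XP V0 = q ^ a" "idx V0 V = q"
    using exists_hyperplane[OF ksub_XP kV(1,2)] Suc by blast
  have V0': "V0 \<in> kbetween XP P" "V0 \<subseteq> ssum L' XP" "V0 \<in> kbetween XP V"
    using V0 kV Suc.prems(2) unfolding kbetween_def by blast+
  have "L \<inter> V0 \<in> fib V0 L'" if L: "L \<in> fib V L'" for L
  proof -
    have kL: "ksub L" "\<xi> ` L \<subseteq> L" "L \<subseteq> P" "ssum L XP = V" "L \<inter> XP = \<xi> ` L'"
      using L unfolding fib_def xsub_def by blast+
    have "ssum (L \<inter> V0) XP = V0"
    proof
      show "ssum (L \<inter> V0) XP \<subseteq> V0" by (rule ssum_least[OF ksub_add_subgrp[OF V0(1)] _ V0(2)]) simp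
      show "V0 \<subseteq> ssum (L \<inter> V0) XP"
      proof
        fix y assume y: "y \<in> V0"
        then have "y \<in> ssum L XP" using V0(3) kL(4) by blast
        then obtain l z where l: "l \<in> L" "z \<in> XP" "y = l + z" by (rule ssum_memE)
        then have "l = y - z" by simp
        then have "l \<in> V0"
          using add_subgrp_diff[OF ksub_add_subgrp[OF V0(1)] y subsetD[OF V0(2) l(2)]] by simp
        then show "y \<in> ssum (L \<inter> V0) XP" using l ssum_memI[of l "L \<inter> V0" z XP] by simp
      qed
    qed
    moreover have "\<xi> ` (L \<inter> V0) \<subseteq> L \<inter> V0" using kL(2,3) V0(2) by blast
    moreover have "L \<inter> V0 \<inter> XP = \<xi> ` L'" using kL(5) V0(2) by blast
    moreover have "L \<inter> V0 \<subseteq> P" using kL(3) by blast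
    ultimately show ?thesis using ksub_Int[OF kL(1) V0(1)] unfolding fib_def xsub_def by blast
  qed
  then have "fib V L' = (\<Union>L0\<in>fib V0 L'. {L \<in> fib V L'. L \<inter> V0 = L0})" by blast
  then have "card (fib V L') = card (\<Union>L0\<in>fib V0 L'. {L \<in> fib V L'. L \<inter> V0 = L0})" by simp
  also have "\<dots> = (\<Sum>L0\<in>fib V0 L'. card {L \<in> fib V L'. L \<inter> V0 = L0})"
    using finite_fib[OF L'] by (intro card_UN_disjoint) auto
  also have "\<dots> = (\<Sum>L0\<in>fib V0 L'. idx (ssum L' XP) P)"
    using card_fib_hyperplane[OF L' Suc.prems(1,2) V0'(3) V0(5)] by (intro sum.cong) auto
  finally show ?case using Suc.IH[OF V0'(1,2) V0(4)] by simp
qed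

end

section \<open>Summation of \<open>G\<close> over tuples\<close>

text \<open>The finite box outside which the terms with \<open>Gq\<close> vanish, as
  \<open>Gend_nonzero\<close> shows.\<close>

definition int_lists :: "nat \<Rightarrow> nat \<Rightarrow> int list set" where
  "int_lists N m = {s. set s \<subseteq> int ` {..N} \<and> length s = m}"

lemma finite_int_lists: "finite (int_lists N m)"
  unfolding int_lists_def by (rule finite_lists_length_eq) simp

text \<open>The last entry is split off, not the first, because the exceptional upper entry and the
  boundary value 0 both sit at the end of the tuple.\<close>

lemma sum_int_lists_Suc:
  "(\<Sum>s\<in>int_lists N (Suc m). f s) = (\<Sum>b\<le>N. \<Sum>s\<in>int_lists N m. f (s @ [int b]))"
proof -
  have "(\<Sum>b\<le>N. \<Sum>s\<in>int_lists N m. f (s @ [int b])) = (\<Sum>(b, s)\<in>{..N} \<times> int_lists N m. f (s @ [int b]))"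
    by (simp add: sum.cartesian_product)
  also have "\<dots> = (\<Sum>s\<in>int_lists N (Suc m). f s)"
  proof (rule sum.reindex_bij_witness[of _ "\<lambda>s. (nat (last s), butlast s)" "\<lambda>(b, s). s @ [int b]"])
    fix s assume s: "s \<in> int_lists N (Suc m)"
    then have "s \<noteq> []" by (auto simp: int_lists_def)
    have "last s \<in> int ` {..N}" using last_in_set[OF \<open>s \<noteq> []\<close>] s unfolding int_lists_def by blast
    then obtain b where b: "last s = int b" "b \<le> N" by auto
    have "set (butlast s) \<subseteq> int ` {..N}" using s in_set_butlastD[of _ s] unfolding int_lists_def by blast
    then show "(nat (last s), butlast s) \<in> {..N} \<times> int_lists N m"
      using s b by (simp add: int_lists_def)
    show "(case (nat (last s), butlast s) of (b, s) \<Rightarrow> s @ [int b]) = s"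
      using append_butlast_last_id[OF \<open>s \<noteq> []\<close>] b by simp
  qed (auto simp: int_lists_def)
  finally show ?thesis by simp
qed

section \<open>Factoring \<open>G\<close> along its tuple, and the \<open>q\<close>-binomial
  theorem\<close>

context q_not_root_of_unity
begin

lemma q_not_root_of_unity_inverse: "q_not_root_of_unity (1 / Q)"
  using Q_nonzero Q_power_neq_1 by unfold_locales (auto simp: power_one_over)

text \<open>Both bases satisfy the absorption identity; clearing the negative powers of
  \<open>Q\<close> in the one for \<open>1/Q\<close> makes an induction on \<open>k\<close> go
  through.\<close>

lemma qbinom_inverse:
  "k \<le> n \<Longrightarrow> qbinom (1 / Q) (int n) (int k) * Q ^ (k * (n - k)) = qbinom Q (int n) (int k)"
proof (induction k arbitrary: n)
  interpret inv: q_not_root_of_unity "1 / Q" by (rule q_not_root_of_unity_inverse)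
  case 0
  then show ?case using qbinom_0_right inv.qbinom_0_right by simp
next
  interpret inv: q_not_root_of_unity "1 / Q" by (rule q_not_root_of_unity_inverse)
  case (Suc k)
  then obtain d where n: "n = Suc (k + d)" by (metis Suc_le_D Suc_le_mono le_iff_add)
  let ?Y = "qbinom (1 / Q) (int n) (int (Suc k))"
  let ?Z = "qbinom (1 / Q) (int (k + d)) (int k)"
  have inv_minus: "((1 / Q) ^ j - 1) * Q ^ j = - (Q ^ j - 1)" for j
    using Q_nonzero by (simp add: power_one_over field_simps)
  have "?Y * ((1 / Q) ^ Suc k - 1) = ((1 / Q) ^ n - 1) * ?Z"
    using inv.qbinom_absorb[of "k + d" k] unfolding n .
  then have "?Y * (((1 / Q) ^ Suc k - 1) * Q ^ Suc k) * Q ^ n = (((1 / Q) ^ n - 1) * Q ^ n) * ?Z * Q ^ Suc k"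
    by (simp only: mult.assoc mult.commute mult.left_commute)
  then have 1: "?Y * (Q ^ Suc k - 1) * Q ^ n = (Q ^ n - 1) * ?Z * Q ^ Suc k"
    unfolding inv_minus by (simp only: mult_minus_left mult_minus_right neg_equal_iff_equal)
  have exps: "Q ^ (Suc k * d) * Q ^ Suc k = Q ^ (k * d) * Q ^ n"
    by (simp add: n algebra_simps flip: power_add)
  have "(?Y * Q ^ (Suc k * d)) * (Q ^ Suc k - 1) * Q ^ n = (Q ^ n - 1) * ?Z * (Q ^ (Suc k * d) * Q ^ Suc k)"
    using arg_cong[OF 1, of "\<lambda>z. z * Q ^ (Suc k * d)"] by (simp only: mult_ac)
  also have "\<dots> = (Q ^ n - 1) * (?Z * Q ^ (k * d)) * Q ^ n"
    unfolding exps by simp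
  also have "?Z * Q ^ (k * d) = qbinom Q (int (k + d)) (int k)"
    using Suc.IH[of "k + d"] by simp
  also have "(Q ^ n - 1) * qbinom Q (int (k + d)) (int k) = qbinom Q (int n) (int (Suc k)) * (Q ^ Suc k - 1)"
    using qbinom_absorb[of "k + d" k] unfolding n by simp
  finally have "(?Y * Q ^ (Suc k * d)) * (Q ^ Suc k - 1) = qbinom Q (int n) (int (Suc k)) * (Q ^ Suc k - 1)"
    using Q_nonzero by simp
  then have "?Y * Q ^ (Suc k * d) = qbinom Q (int n) (int (Suc k))"
    using Q_power_neq_1[of "Suc k"] by (simp del: power_Suc)
  then show ?case by (simp add: n)
qed

text \<open>One factor of \<^const>\<open>Gq\<close>, with the entry following \<open>b\<close> as a parameter \<open>a\<close>.\<close>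

definition Gfactor :: "int \<Rightarrow> int \<Rightarrow> int \<Rightarrow> 'a" where
  "Gfactor r b a = Q powi (b * (r - b)) * qbinom (1 / Q) (r - a) (r - b)"

text \<open>The boundary value after the last entry becomes a parameter \<open>a\<close>, because
  dropping the last entry \<open>b\<close> of \<open>s\<close> leaves an expression of the same kind
  with boundary value \<open>b\<close>.\<close>

definition Gend :: "int list \<Rightarrow> int list \<Rightarrow> int \<Rightarrow> 'a" where
  "Gend r s a = (\<Prod>i<length r. Gfactor (r ! i) (s ! i) ((s @ [a]) ! (i + 1)))"

lemma Gq_eq_Gend: "Gq r s Q = Gend r s 0"
proof -
  have "Q powi (\<Sum>i<k. f i) = (\<Prod>i<k. Q powi (f i))" for f and k :: nat
    using Q_nonzero by (induction k) (simp_all add: power_int_add)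
  then show ?thesis by (simp add: Gq_def Gend_def Gfactor_def prod.distrib)
qed

lemma Gend_snoc:
  assumes "length s = length r"
  shows "Gend (r @ [\<rho>]) (s @ [b]) a = Gfactor \<rho> b a * Gend r s b"
proof -
  have "(s @ [b, a]) ! Suc i = (s @ [b]) ! Suc i" if "i < length r" for i
    using that assms by (cases "Suc i = length s") (auto simp: nth_append)
  then have "(\<Prod>i<length r. Gfactor ((r @ [\<rho>]) ! i) ((s @ [b]) ! i) ((s @ [b, a]) ! Suc i)) =
      (\<Prod>i<length r. Gfactor (r ! i) (s ! i) ((s @ [b]) ! Suc i))"
    using assms by (intro prod.cong) (simp_all add: nth_append[of r] nth_append[of s "[b]" i for i])
  moreover have "(s @ [b, a]) ! Suc (length r) = a" "(s @ [b]) ! length r = b"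
    using assms by (simp_all add: nth_append)
  ultimately show ?thesis by (simp add: Gend_def)
qed

lemma Gfactor_eq_0: "\<not> (a \<le> b \<and> b \<le> r) \<Longrightarrow> Gfactor r b a = 0"
  by (auto simp: Gfactor_def qbinom_def)

text \<open>With \<open>d = b - a\<close> and \<open>e = r - b\<close>, the exponent
  \<open>b(r - b)\<close> is \<open>d e + a e\<close>. The part \<open>d e\<close> turns the base
  \<open>1/Q\<close> of the binomial into \<open>Q\<close>; what remains is the coefficient in
  \<open>lat_poly\<close>.\<close>

lemma Gfactor_eq:
  assumes "a \<le> b" "b \<le> r"
  shows "Gfactor (int r) (int b) (int a) = qbinom Q (int (r - a)) (int (b - a)) * Q ^ (a * (r - b))"
proof -
  obtain d e where *: "b = a + d" "r = a + d + e" using assms by (metis le_iff_add)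
  have 1: "qbinom (1 / Q) (int r - int a) (int r - int b) = qbinom (1 / Q) (int (d + e)) (int d)"
    using qbinom_sym[of "1 / Q" "int (d + e)" "int d"] by (simp add: * algebra_simps)
  have 2: "Q powi (int b * (int r - int b)) = Q ^ (d * e) * Q ^ (a * e)"
    using Q_nonzero by (simp add: * algebra_simps power_add power_int_add flip: of_nat_mult)
  have "Gfactor (int r) (int b) (int a) = (qbinom (1 / Q) (int (d + e)) (int d) * Q ^ (d * e)) * Q ^ (a * e)"
    unfolding Gfactor_def 1 2 by (simp only: mult_ac)
  also have "qbinom (1 / Q) (int (d + e)) (int d) * Q ^ (d * e) = qbinom Q (int (d + e)) (int d)"
    using qbinom_inverse[of d "d + e"] by simp
  finally show ?thesis by (simp add: *)
qed

text \<open>Nonzero factors force the entries of \<open>s\<close> to decrease weakly down to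
  \<open>a\<close> and to stay below the entries of \<open>r\<close>.\<close>

lemma Gend_nonzero:
  assumes "Gend r s a \<noteq> 0" "length s = length r" "\<And>x. x \<in> set r \<Longrightarrow> x \<le> u"
  shows "set s \<subseteq> {a..u}"
  using assms
proof (induction r arbitrary: s a rule: rev_induct)
  case (snoc \<rho> r)
  then obtain s' b where s: "s = s' @ [b]" by (metis append_is_Nil_conv length_0_conv rev_exhaust snoc_eq_iff_butlast)
  have "Gfactor \<rho> b a \<noteq> 0" "Gend r s' b \<noteq> 0" using snoc.prems Gend_snoc[of s' r] s by auto
  then have "a \<le> b" "b \<le> \<rho>" "set s' \<subseteq> {b..u}"
    using Gfactor_eq_0[of a b \<rho>] snoc s by auto
  then show ?case using s snoc.prems(3)[of \<rho>] by auto
qed simp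

text \<open>Read from its end, \<open>s\<close> lists the dimensions of an increasing chain of
  spaces, and each factor of \<open>Gend\<close> is one step of the recursion of
  \<open>lat_poly\<close>.\<close>

lemma sum_Gend:
  assumes "a \<le> N"
  shows "(\<Sum>s\<in>int_lists N m. dconst (Gend (replicate m (int N)) s (int a)) * t ^ nat (int m * int N - sum_list s)) =
    (\<Sum>b\<in>{a..N}. dconst (qbinom Q (int (N - a)) (int (b - a)) * Q ^ (a * (N - b))) * lat_poly Q t N m b)"
  using assms
proof (induction m arbitrary: a)
  case 0
  have "int_lists N 0 = {[]}" by (auto simp: int_lists_def)
  moreover have "(\<Sum>b\<in>{a..N}. dconst (qbinom Q (int (N - a)) (int (b - a)) * Q ^ (a * (N - b))) * lat_poly Q t N 0 b)
      = (\<Sum>b\<in>{a..N}. if b = N then dconst (qbinom Q (int (N - a)) (int (b - a)) * Q ^ (a * (N - b))) else 0)"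
    by (intro sum.cong) auto
  ultimately show ?case using 0 qbinom_self[of "N - a"] by (simp add: Gend_def)
next
  case (Suc m)
  have sum_le: "sum_list s \<le> int m * int N" if "s \<in> int_lists N m" for s
  proof -
    have "sum_list s \<le> sum_list (replicate (length s) (int N))"
      using that by (intro sum_list_mono2) (auto simp: int_lists_def dest!: nth_mem)
    then show ?thesis using that by (simp add: int_lists_def sum_list_replicate)
  qed
  have "(\<Sum>s\<in>int_lists N (Suc m). dconst (Gend (replicate (Suc m) (int N)) s (int a)) * t ^ nat (int (Suc m) * int N - sum_list s)) =
      (\<Sum>b\<le>N. \<Sum>s\<in>int_lists N m. dconst (Gend (replicate (Suc m) (int N)) (s @ [int b]) (int a))
        * t ^ nat (int (Suc m) * int N - sum_list (s @ [int b])))"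
    by (rule sum_int_lists_Suc)
  also have "\<dots> = (\<Sum>b\<le>N. dconst (Gfactor (int N) (int b) (int a)) * t ^ (N - b) *
      (\<Sum>s\<in>int_lists N m. dconst (Gend (replicate m (int N)) s (int b)) * t ^ nat (int m * int N - sum_list s)))"
    unfolding sum_distrib_left
  proof (intro sum.cong refl)
    fix b s assume b: "b \<in> {..N}" and s: "s \<in> int_lists N m"
    have "Gend (replicate (Suc m) (int N)) (s @ [int b]) (int a) =
        Gfactor (int N) (int b) (int a) * Gend (replicate m (int N)) s (int b)"
      unfolding replicate_Suc replicate_append_same[symmetric]
      using s by (intro Gend_snoc) (simp add: int_lists_def)
    moreover have "nat (int (Suc m) * int N - sum_list (s @ [int b])) = (N - b) + nat (int m * int N - sum_list s)"
      using sum_le[OF s] b by (simp add: algebra_simps nat_diff_distrib nat_add_distrib)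
    ultimately show "dconst (Gend (replicate (Suc m) (int N)) (s @ [int b]) (int a))
        * t ^ nat (int (Suc m) * int N - sum_list (s @ [int b])) =
      dconst (Gfactor (int N) (int b) (int a)) * t ^ (N - b) *
        (dconst (Gend (replicate m (int N)) s (int b)) * t ^ nat (int m * int N - sum_list s))"
      by (simp add: dconst_mult power_add mult_ac)
  qed
  also have "\<dots> = (\<Sum>b\<le>N. dconst (Gfactor (int N) (int b) (int a)) * lat_poly Q t N (Suc m) b)"
    using Suc.IH by (intro sum.cong) (simp_all add: mult.assoc)
  also have "\<dots> = (\<Sum>b\<in>{a..N}. dconst (Gfactor (int N) (int b) (int a)) * lat_poly Q t N (Suc m) b)"
    by (rule sum.mono_neutral_right) (auto simp: Gfactor_eq_0)
  also have "\<dots> = (\<Sum>b\<in>{a..N}. dconst (qbinom Q (int (N - a)) (int (b - a)) * Q ^ (a * (N - b))) * lat_poly Q t N (Suc m) b)"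
    by (intro sum.cong refl) (simp add: Gfactor_eq del: lat_poly.simps)
  finally show ?case .
qed

text \<open>Only the last factor has \<open>c\<close> in place of \<open>N\<close>. With boundary
  value 0 no power of \<open>Q\<close> remains, and its binomial counts subspaces of dimension
  \<open>a\<close> in dimension \<open>c\<close>; the exponent of \<open>t\<close> still refers to
  \<open>N\<close>, as indices are taken in \<open>P\<close>.\<close>

theorem sum_Gq:
  assumes c: "c \<le> N" and m: "m \<ge> 1"
  shows "(\<Sum>s\<in>int_lists N m. dconst (Gq (replicate (m - 1) (int N) @ [int c]) s Q) * t ^ nat (int m * int N - sum_list s)) =
    (\<Sum>a\<le>c. dconst (qbinom Q (int c) (int a)) * lat_poly Q t N m a)"
proof -
  obtain m' where m': "m = Suc m'" using m by (cases m) auto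
  have sum_le: "sum_list s \<le> int m' * int N" if "s \<in> int_lists N m'" for s
  proof -
    have "sum_list s \<le> sum_list (replicate (length s) (int N))"
      using that by (intro sum_list_mono2) (auto simp: int_lists_def dest!: nth_mem)
    then show ?thesis using that by (simp add: int_lists_def sum_list_replicate)
  qed
  have "(\<Sum>s\<in>int_lists N m. dconst (Gq (replicate (m - 1) (int N) @ [int c]) s Q) * t ^ nat (int m * int N - sum_list s)) =
      (\<Sum>b\<le>N. \<Sum>s\<in>int_lists N m'. dconst (Gend (replicate m' (int N) @ [int c]) (s @ [int b]) 0)
        * t ^ nat (int m * int N - sum_list (s @ [int b])))"
    unfolding m' Gq_eq_Gend by (simp only: sum_int_lists_Suc diff_Suc_1)
  also have "\<dots> = (\<Sum>b\<le>N. dconst (Gfactor (int c) (int b) 0) * t ^ (N - b) *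
      (\<Sum>s\<in>int_lists N m'. dconst (Gend (replicate m' (int N)) s (int b)) * t ^ nat (int m' * int N - sum_list s)))"
    unfolding sum_distrib_left
  proof (intro sum.cong refl)
    fix b s assume b: "b \<in> {..N}" and s: "s \<in> int_lists N m'"
    have "Gend (replicate m' (int N) @ [int c]) (s @ [int b]) 0 =
        Gfactor (int c) (int b) 0 * Gend (replicate m' (int N)) s (int b)"
      using s by (intro Gend_snoc) (simp add: int_lists_def)
    moreover have "nat (int m * int N - sum_list (s @ [int b])) = (N - b) + nat (int m' * int N - sum_list s)"
      using sum_le[OF s] b by (simp add: m' algebra_simps nat_diff_distrib nat_add_distrib)
    ultimately show "dconst (Gend (replicate m' (int N) @ [int c]) (s @ [int b]) 0)
        * t ^ nat (int m * int N - sum_list (s @ [int b])) =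
      dconst (Gfactor (int c) (int b) 0) * t ^ (N - b) *
        (dconst (Gend (replicate m' (int N)) s (int b)) * t ^ nat (int m' * int N - sum_list s))"
      by (simp add: dconst_mult power_add mult_ac)
  qed
  also have "\<dots> = (\<Sum>b\<le>N. dconst (Gfactor (int c) (int b) 0) * lat_poly Q t N m b)"
    using sum_Gend[where m = m' and N = N and t = t] by (intro sum.cong) (simp_all add: m' mult.assoc)
  also have "\<dots> = (\<Sum>b\<le>c. dconst (Gfactor (int c) (int b) 0) * lat_poly Q t N m b)"
    using c by (intro sum.mono_neutral_right) (auto simp: Gfactor_eq_0)
  also have "\<dots> = (\<Sum>a\<le>c. dconst (qbinom Q (int c) (int a)) * lat_poly Q t N m a)"
    using Gfactor_eq[of 0 _ c] by (intro sum.cong) auto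
  finally show ?thesis .
qed

text \<open>Pascal's rule gives this form of the \<open>q\<close>-binomial theorem by induction. Two
  choices of \<open>\<iota>\<close> matter: \<open>dconst\<close> yields Pochhammer symbols of
  Dirichlet series, and the identity with \<open>x = 1\<close> yields the vanishing of Moebius
  sums.\<close>

lemma qpoch_expand:
  fixes x :: "'b::comm_ring_1" and \<iota> :: "'a \<Rightarrow> 'b"
  assumes \<iota>: "\<And>a b. \<iota> (a + b) = \<iota> a + \<iota> b" "\<And>a b. \<iota> (a * b) = \<iota> a * \<iota> b" "\<iota> 0 = 0" "\<iota> 1 = 1"
  shows "qpoch x (\<iota> Q) n =
    (\<Sum>r\<le>n. \<iota> (qbinom Q (int n) (int r) * (-1) ^ r * Q ^ (r * (r - 1) div 2)) * x ^ r)"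
proof (induction n)
  case 0
  then show ?case using qbinom_self[of 0] by (simp add: qpoch_0 \<iota>)
next
  case (Suc n)
  define c where "c r = (-1 :: 'a) ^ r * Q ^ (r * (r - 1) div 2)" for r
  have c_Suc: "c (Suc r) = - (Q ^ r) * c r" for r
  proof -
    have "Suc r * (Suc r - 1) div 2 = r + r * (r - 1) div 2"
      by (cases r) (simp_all add: algebra_simps)
    then show ?thesis by (simp add: c_def power_add)
  qed
  have c_0: "c 0 = 1" by (simp add: c_def)
  have \<iota>p: "\<iota> (Q ^ k) = \<iota> Q ^ k" for k by (induction k) (simp_all add: \<iota>)
  have \<iota>m: "\<iota> (- a) = - \<iota> a" for a using \<iota>(1)[of a "- a"] by (simp add: \<iota> eq_neg_iff_add_eq_0 add.commute)
  let ?b = "\<lambda>n r. qbinom Q (int n) (int r)"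
  have "qpoch x (\<iota> Q) (Suc n) = (\<Sum>r\<le>n. \<iota> (?b n r * c r) * x ^ r) * (1 - x * \<iota> (Q ^ n))"
    unfolding qpoch_Suc Suc.IH by (simp add: c_def mult.assoc \<iota>p)
  also have "\<dots> = (\<Sum>r\<le>n. \<iota> (?b n r * c r) * x ^ r) + (\<Sum>r\<le>n. \<iota> (- (Q ^ n) * (?b n r * c r)) * x ^ Suc r)"
    unfolding sum_distrib_right sum.distrib[symmetric]
    by (intro sum.cong refl) (simp add: \<iota> \<iota>m algebra_simps)
  also have "(\<Sum>r\<le>n. \<iota> (?b n r * c r) * x ^ r) = (\<Sum>r\<le>Suc n. \<iota> (?b n r * c r) * x ^ r)"
  proof -
    have "?b n (Suc n) = 0" by (simp add: qbinom_def)
    then show ?thesis unfolding sum.atMost_Suc by (simp only: mult_zero_left \<iota>(3) add_0_right)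
  qed
  also have "\<dots> = 1 + (\<Sum>r\<le>n. \<iota> (?b n (Suc r) * c (Suc r)) * x ^ Suc r)"
    unfolding sum.atMost_Suc_shift using qbinom_0_right[of n] c_0 by (simp add: \<iota>)
  also have "\<dots> + (\<Sum>r\<le>n. \<iota> (- (Q ^ n) * (?b n r * c r)) * x ^ Suc r) =
      1 + (\<Sum>r\<le>n. \<iota> (?b (Suc n) (Suc r) * c (Suc r)) * x ^ Suc r)"
    unfolding add.assoc sum.distrib[symmetric]
  proof (intro arg_cong2[of _ _ _ _ "(+)"] sum.cong refl)
    fix r assume "r \<in> {..n}"
    then have "Q ^ n = Q ^ (n - r) * Q ^ r" by (simp flip: power_add)
    then have "?b n (Suc r) * c (Suc r) + - (Q ^ n) * (?b n r * c r) = ?b (Suc n) (Suc r) * c (Suc r)"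
      unfolding qbinom_Suc_Suc c_Suc by (simp add: algebra_simps)
    then show "\<iota> (?b n (Suc r) * c (Suc r)) * x ^ Suc r + \<iota> (- (Q ^ n) * (?b n r * c r)) * x ^ Suc r =
        \<iota> (?b (Suc n) (Suc r) * c (Suc r)) * x ^ Suc r"
      by (simp flip: distrib_right \<iota>(1))
  qed
  also have "\<dots> = (\<Sum>r\<le>Suc n. \<iota> (?b (Suc n) r * c r) * x ^ r)"
    unfolding sum.atMost_Suc_shift using qbinom_0_right[of "Suc n"] c_0 by (simp add: \<iota>)
  finally show ?case by (simp add: c_def mult.assoc)
qed

end

section \<open>Sums over intermediate spaces, sorted by dimension\<close>

context finite_scalars
begin

abbreviation Q :: rat where "Q \<equiv> of_nat q"

lemma q_not_root: "q_not_root_of_unity Q"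
  by (rule q_not_root_of_unity_of_nat[OF q_ge_2])

lemma q_power_inject: "q ^ a = q ^ b \<longleftrightarrow> a = b"
  using q_ge_2 by simp

lemma idx_between_power:
  assumes "ksub A" "ksub C" "finite (cosets A C)" "idx A C = q ^ d" "V \<in> kbetween A C"
  obtains e where "e \<le> d" "idx A V = q ^ e" "idx V C = q ^ (d - e)"
proof -
  note k = kbetween_idx[OF assms(1-3,5)]
  obtain e where e: "idx A V = q ^ e"
    using idx_eq_power[of A V] assms k by (auto simp: kbetween_def)
  obtain e' where e': "idx V C = q ^ e'"
    using idx_eq_power[of V C] assms k by (auto simp: kbetween_def)
  have "q ^ d = q ^ (e + e')" using k(3) assms(4) e e' by (simp add: power_add)
  then have "d = e + e'" by (simp only: q_power_inject)
  then show ?thesis using e e' that[of e] by simp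
qed

lemma sum_kbetween:
  fixes f :: "'v set \<Rightarrow> rat dirichlet"
  assumes A: "ksub A" "ksub C" "A \<subseteq> C" "finite (cosets A C)" "idx A C = q ^ d"
    and f: "\<And>V e. V \<in> kbetween A C \<Longrightarrow> e \<le> d \<Longrightarrow> idx A V = q ^ e \<Longrightarrow> f V = g e"
  shows "(\<Sum>V\<in>kbetween A C. f V) = (\<Sum>e\<le>d. dconst (qbinom Q (int d) (int e)) * g e)"
proof -
  let ?V = "\<lambda>e. {V \<in> kbetween A C. idx A V = q ^ e}"
  have "kbetween A C = (\<Union>e\<le>d. ?V e)"
    using idx_between_power[OF A(1,2,4,5)] by blast
  then have "(\<Sum>V\<in>kbetween A C. f V) = (\<Sum>V\<in>(\<Union>e\<le>d. ?V e). f V)" by simp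
  also have "\<dots> = (\<Sum>e\<le>d. \<Sum>V\<in>?V e. f V)"
    using finite_kbetween[OF A(1,2,4)] q_power_inject by (intro sum.UNION_disjoint) auto
  also have "\<dots> = (\<Sum>e\<le>d. dconst (qbinom Q (int d) (int e)) * g e)"
  proof (rule sum.cong[OF refl])
    fix e assume e: "e \<in> {..d}"
    have "(\<Sum>V\<in>?V e. f V) = (\<Sum>V\<in>?V e. g e)" using f e by (intro sum.cong) auto
    also have "\<dots> = dconst (rat_of_nat (card (?V e))) * g e" by (simp add: dconst_of_nat)
    finally show "(\<Sum>V\<in>?V e. f V) = dconst (qbinom Q (int d) (int e)) * g e"
      using card_kbetween_idx[OF A, of e] by simp
  qed
  finally show ?thesis .
qed

end

section \<open>The recursion for lattice sums and its solution\<close>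

context lattice_count
begin

abbreviation t :: "rat dirichlet" where "t \<equiv> dir_monom 1 q"

definition lat_sum :: "nat \<Rightarrow> 'v set \<Rightarrow> rat dirichlet" where
  "lat_sum m V = (\<Sum>L | L \<in> lat m \<and> ssum L XP = V. dir_monom 1 (idx L P))"

lemma ssum_XP_kbetween:
  assumes "L \<in> lat m" shows "ssum L XP \<in> kbetween XP P"
proof -
  have L: "ksub L" "L \<subseteq> P" using assms unfolding lat_def xsub_def by blast+
  show ?thesis
    using ksub_ssum[OF L(1) ksub_XP] ssum_upper2[OF ksub_add_subgrp[OF L(1)], of XP]
      ssum_least[OF ksub_add_subgrp[OF ksub_P] L(2) XP_subset]
    by (simp add: kbetween_def)
qed

text \<open>The last claim rests on \<open>L\<close> being contained in its own preimage under
  \<open>\<xi>\<close>, that is on stability. It is the compatibility of \<open>V\<close> with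
  \<open>L'\<close> that \<open>card_fib\<close> requires.\<close>

lemma lat_Suc_preimage:
  assumes L: "L \<in> lat (Suc m)"
  shows "{p \<in> P. \<xi> p \<in> L} \<in> lat m" "L \<in> fib (ssum L XP) {p \<in> P. \<xi> p \<in> L}"
    "ssum L XP \<subseteq> ssum {p \<in> P. \<xi> p \<in> L} XP"
proof -
  let ?L = "{p \<in> P. \<xi> p \<in> L}"
  have kL: "ksub L" "L \<subseteq> P" "\<xi> ` L \<subseteq> L" "(\<xi> ^^ Suc m) ` P \<subseteq> L" using L unfolding lat_def xsub_def by blast+
  have "add_subgrp ?L"
    using ksub_add_subgrp[OF kL(1)] ksub_add_subgrp[OF ksub_P] X_0
    by (intro add_subgrpI) (auto simp: X_diff add_subgrp_0 add_subgrp_diff)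
  then have "ksub ?L" using ksub_scale[OF kL(1)] ksub_scale[OF ksub_P] by (auto simp: ksub_def X_scale)
  moreover have "\<xi> ` ?L \<subseteq> ?L" using kL by blast
  moreover have "(\<xi> ^^ m) ` P \<subseteq> ?L"
    using X_power_P[of m] kL(4) by auto
  ultimately show "?L \<in> lat m" unfolding lat_def xsub_def by blast
  have "L \<inter> XP = \<xi> ` ?L" by blast
  then show "L \<in> fib (ssum L XP) ?L" using kL unfolding fib_def xsub_def by blast
  show "ssum L XP \<subseteq> ssum ?L XP" using kL by (intro ssum_mono) auto
qed

text \<open>The index splits at \<open>V\<close>, and \<open>(V : L) = (\<xi>P : L \<inter> \<xi>P)
  = (\<xi>P : \<xi>L') = (P : L')\<close>.\<close>

lemma fib_idx:
  assumes L: "L \<in> fib V L'" and L': "L' \<in> lat m"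
  shows "L \<in> lat (Suc m)" "idx L P = idx V P * idx L' P"
proof -
  have kL: "ksub L" "L \<subseteq> P" "\<xi> ` L \<subseteq> L" "ssum L XP = V" "L \<inter> XP = \<xi> ` L'"
    using L unfolding fib_def xsub_def by blast+
  have kL': "ksub L'" "L' \<subseteq> P" "(\<xi> ^^ m) ` P \<subseteq> L'" using L' unfolding lat_def xsub_def by blast+
  have "(\<xi> ^^ Suc m) ` P = \<xi> ` ((\<xi> ^^ m) ` P)" by (auto simp: image_comp)
  then have "(\<xi> ^^ Suc m) ` P \<subseteq> L" using kL(5) kL'(3) by blast
  then show lat: "L \<in> lat (Suc m)" using kL unfolding lat_def xsub_def by blast
  have V: "L \<subseteq> V" "V \<subseteq> P" "ksub V"
    using kL(4) ssum_upper1[OF ksub_add_subgrp[OF ksub_XP]] ssum_XP_kbetween[OF lat]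
    unfolding kbetween_def by blast+
  have "idx L P = idx L V * idx V P"
    by (rule cosets_tower(2)[OF ksub_add_subgrp[OF kL(1)] ksub_add_subgrp[OF V(3)]
        ksub_add_subgrp[OF ksub_P] V(1,2) finite_cosets_lat[OF lat]])
  also have "idx L V = idx (L \<inter> XP) XP"
    using cosets_second_iso(1)[OF ksub_add_subgrp[OF kL(1)] ksub_add_subgrp[OF ksub_XP]] kL(4) by simp
  also have "\<dots> = idx L' P" unfolding kL(5) by (rule finite_idx_X_image(1)[OF kL'(1,2)])
  finally show "idx L P = idx V P * idx L' P" by simp
qed

lemma lat_sum_0: "lat_sum 0 V = (if V = P then 1 else 0)"
proof -
  have "lat 0 = {P}" using ksub_P X_P by (auto simp: lat_def xsub_def)
  moreover have "ssum P XP = P"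
    by (rule ssum_absorb) (auto simp: ksub_add_subgrp ksub_P ksub_XP intro: X_P)
  ultimately have "{L. L \<in> lat 0 \<and> ssum L XP = V} = (if V = P then {P} else {})" by auto
  then show ?thesis using idx_self[OF ksub_add_subgrp[OF ksub_P]] by (simp add: lat_sum_def)
qed

text \<open>Lattices are sorted by \<open>L'\<close> first. The fibre size depends on
  \<open>L'\<close> only through \<open>V' = L' + \<xi>P\<close>, so sorting the \<open>L'\<close>
  by \<open>V'\<close> brings back \<open>lat_sum m\<close>.\<close>

lemma lat_sum_Suc:
  assumes V: "V \<in> kbetween XP P" and a: "idx XP V = q ^ a"
  shows "lat_sum (Suc m) V =
    dir_monom 1 (idx V P) * (\<Sum>V'\<in>kbetween V P. of_nat (idx V' P) ^ a * lat_sum m V')"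
proof -
  let ?M = "{L' \<in> lat m. V \<subseteq> ssum L' XP}"
  have kV: "ksub V" "XP \<subseteq> V" "V \<subseteq> P" using V unfolding kbetween_def by blast+
  have fV: "finite (cosets V P)" by (rule kbetween_idx(2)[OF ksub_XP ksub_P finite_XP V])
  have Lat: "xsub L'" "finite (cosets L' P)" if "L' \<in> ?M" for L'
    using that finite_cosets_lat by (auto simp: lat_def)
  have un: "{L. L \<in> lat (Suc m) \<and> ssum L XP = V} = (\<Union>L'\<in>?M. fib V L')"
  proof
    show "{L. L \<in> lat (Suc m) \<and> ssum L XP = V} \<subseteq> (\<Union>L'\<in>?M. fib V L')"
    proof
      fix L assume "L \<in> {L. L \<in> lat (Suc m) \<and> ssum L XP = V}"
      then have L: "L \<in> lat (Suc m)" "ssum L XP = V" by auto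
      show "L \<in> (\<Union>L'\<in>?M. fib V L')"
        using lat_Suc_preimage[OF L(1)] unfolding L(2) by blast
    qed
    show "(\<Union>L'\<in>?M. fib V L') \<subseteq> {L. L \<in> lat (Suc m) \<and> ssum L XP = V}"
    proof
      fix L assume "L \<in> (\<Union>L'\<in>?M. fib V L')"
      then obtain L' where "L' \<in> lat m" "L \<in> fib V L'" by blast
      then show "L \<in> {L. L \<in> lat (Suc m) \<and> ssum L XP = V}"
        using fib_idx(1)[of L V L' m] unfolding fib_def by blast
    qed
  qed
  have disj: "fib V L1 \<inter> fib V L2 = {}" if "L1 \<in> ?M" "L2 \<in> ?M" "L1 \<noteq> L2" for L1 L2
  proof (rule ccontr)
    assume "fib V L1 \<inter> fib V L2 \<noteq> {}"
    then have "\<xi> ` L1 = \<xi> ` L2" unfolding fib_def by blast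
    moreover have "L1 \<subseteq> P" "L2 \<subseteq> P" using that by (auto simp: lat_def xsub_def)
    ultimately show False using inj_on_image_eq_iff[OF inj_X] that(3) by blast
  qed
  have "lat_sum (Suc m) V = (\<Sum>L'\<in>?M. \<Sum>L\<in>fib V L'. dir_monom 1 (idx L P))"
    unfolding lat_sum_def un using finite_lat[of m] finite_fib[OF Lat] disj
    by (intro sum.UNION_disjoint) auto
  also have "\<dots> = (\<Sum>L'\<in>?M. dir_monom 1 (idx V P) * (of_nat (idx (ssum L' XP) P) ^ a * dir_monom 1 (idx L' P)))"
  proof (rule sum.cong[OF refl])
    fix L' assume L': "L' \<in> ?M"
    have "(\<Sum>L\<in>fib V L'. dir_monom (1::rat) (idx L P)) = (\<Sum>L\<in>fib V L'. dir_monom 1 (idx V P * idx L' P))"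
      using fib_idx(2) L' by (intro sum.cong) auto
    also have "\<dots> = of_nat (card (fib V L')) * dir_monom 1 (idx V P * idx L' P)" by simp
    also have "card (fib V L') = idx (ssum L' XP) P ^ a"
      using card_fib[OF Lat[OF L'] V _ a] L' by simp
    also have "dir_monom (1::rat) (idx V P * idx L' P) = dir_monom 1 (idx V P) * dir_monom 1 (idx L' P)"
      using idx_pos[OF ksub_add_subgrp[OF ksub_P]] fV Lat[OF L'] by (simp add: dir_monom_mult)
    finally show "(\<Sum>L\<in>fib V L'. dir_monom (1::rat) (idx L P)) =
      dir_monom 1 (idx V P) * (of_nat (idx (ssum L' XP) P) ^ a * dir_monom 1 (idx L' P))"
      by (simp add: mult_ac)
  qed
  also have "\<dots> = dir_monom 1 (idx V P) * (\<Sum>L'\<in>?M. of_nat (idx (ssum L' XP) P) ^ a * dir_monom 1 (idx L' P))"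
    by (simp only: sum_distrib_left)
  also have "(\<Sum>L'\<in>?M. of_nat (idx (ssum L' XP) P) ^ a * dir_monom (1::rat) (idx L' P)) =
      (\<Sum>V'\<in>kbetween V P. \<Sum>L' | L' \<in> ?M \<and> ssum L' XP = V'. of_nat (idx (ssum L' XP) P) ^ a * dir_monom 1 (idx L' P))"
  proof (rule sum.group[symmetric])
    show "finite ?M" using finite_lat by simp
    show "finite (kbetween V P)" by (rule finite_kbetween[OF kV(1) ksub_P fV])
    show "(\<lambda>L'. ssum L' XP) ` ?M \<subseteq> kbetween V P"
      using ssum_XP_kbetween unfolding kbetween_def by blast
  qed
  also have "\<dots> = (\<Sum>V'\<in>kbetween V P. of_nat (idx V' P) ^ a * lat_sum m V')"
  proof (rule sum.cong[OF refl])
    fix V' assume "V' \<in> kbetween V P"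
    then have "{L'. L' \<in> ?M \<and> ssum L' XP = V'} = {L'. L' \<in> lat m \<and> ssum L' XP = V'}"
      unfolding kbetween_def by blast
    then show "(\<Sum>L' | L' \<in> ?M \<and> ssum L' XP = V'. of_nat (idx (ssum L' XP) P) ^ a * dir_monom 1 (idx L' P)) =
        of_nat (idx V' P) ^ a * lat_sum m V'"
      unfolding lat_sum_def sum_distrib_left by (intro sum.cong) auto
  qed
  finally show ?thesis .
qed

lemma lat_sum_eq:
  assumes "V \<in> kbetween XP P" "idx XP V = q ^ a"
  shows "lat_sum m V = lat_poly Q t N m a"
  using assms
proof (induction m arbitrary: V a)
  case 0
  have kV: "ksub V" "XP \<subseteq> V" "V \<subseteq> P" using 0 unfolding kbetween_def by blast+
  obtain e where e: "e \<le> N" "idx XP V = q ^ e" "idx V P = q ^ (N - e)"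
    using idx_between_power[OF ksub_XP ksub_P finite_XP idx_XP 0(1)] .
  then have ea: "e = a" using 0(2) q_power_inject by simp
  have "V = P \<longleftrightarrow> q ^ (N - a) = q ^ 0"
    using idx_eq_1_iff[OF ksub_add_subgrp[OF kV(1)] ksub_add_subgrp[OF ksub_P] kV(3)] e ea by simp
  also have "\<dots> \<longleftrightarrow> a = N" unfolding q_power_inject using e ea by auto
  finally show ?case by (simp add: lat_sum_0)
next
  case (Suc m)
  note V = Suc.prems
  have kV: "ksub V" "XP \<subseteq> V" "V \<subseteq> P" using V unfolding kbetween_def by blast+
  obtain e where e: "e \<le> N" "idx XP V = q ^ e" "idx V P = q ^ (N - e)"
    using idx_between_power[OF ksub_XP ksub_P finite_XP idx_XP V(1)] .
  then have ea: "e = a" using V(2) q_power_inject by simp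
  have fV: "finite (cosets V P)" by (rule kbetween_idx(2)[OF ksub_XP ksub_P finite_XP V(1)])
  have "(\<Sum>V'\<in>kbetween V P. of_nat (idx V' P) ^ a * lat_sum m V') =
    (\<Sum>i\<le>N - a. dconst (qbinom Q (int (N - a)) (int i)) * (dconst (Q ^ (a * (N - (a + i)))) * lat_poly Q t N m (a + i)))"
  proof (rule sum_kbetween[OF kV(1) ksub_P kV(3) fV])
    show "idx V P = q ^ (N - a)" using e ea by simp
    fix V' i assume V': "V' \<in> kbetween V P" "i \<le> N - a" "idx V V' = q ^ i"
    have kV': "ksub V'" "V \<subseteq> V'" "V' \<subseteq> P" using V' unfolding kbetween_def by blast+
    have V'X: "V' \<in> kbetween XP P" using kV' kV unfolding kbetween_def by blast
    have "idx XP V' = idx XP V * idx V V'"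
      by (rule cosets_tower(2)[OF ksub_add_subgrp[OF ksub_XP] ksub_add_subgrp[OF kV(1)]
            ksub_add_subgrp[OF kV'(1)] kV(2) kV'(2) kbetween_idx(1)[OF ksub_XP ksub_P finite_XP V'X]])
    then have i: "idx XP V' = q ^ (a + i)" using V(2) V' by (simp add: power_add)
    obtain e' where e': "idx XP V' = q ^ e'" "idx V' P = q ^ (N - e')"
      using idx_between_power[OF ksub_XP ksub_P finite_XP idx_XP V'X] .
    then have e'': "e' = a + i" using i q_power_inject by simp
    have "of_nat (idx V' P) ^ a = dconst (Q ^ (a * (N - (a + i))))"
      unfolding e'(2) e'' by (simp add: dconst_of_nat mult.commute flip: of_nat_power power_mult)
    then show "of_nat (idx V' P) ^ a * lat_sum m V' =
        dconst (Q ^ (a * (N - (a + i)))) * lat_poly Q t N m (a + i)"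
      using Suc.IH[OF V'X i] by simp
  qed
  also have "\<dots> = (\<Sum>b\<in>{a..N}. dconst (qbinom Q (int (N - a)) (int (b - a)) * Q ^ (a * (N - b))) * lat_poly Q t N m b)"
    using e ea by (intro sum.reindex_bij_witness[of _ "\<lambda>b. b - a" "\<lambda>i. a + i"])
      (auto simp: dconst_mult mult.assoc)
  finally show ?case
    unfolding lat_sum_Suc[OF V] e(3) ea using q_ge_2 by (simp add: dir_monom_power)
qed

text \<open>As \<open>\<xi>P \<subseteq> M\<close>, whether \<open>L \<subseteq> M\<close> is
  decided by \<open>V = L + \<xi>P\<close>, which then runs through the subspaces of
  \<open>M/\<xi>P\<close>. This is the origin of the exceptional last entry
  \<open>c\<close>.\<close>

theorem sum_lat_below:
  assumes M: "M \<in> kbetween XP P" "idx XP M = q ^ c" and m: "m \<ge> 1"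
  shows "(\<Sum>L | L \<in> lat m \<and> L \<subseteq> M. dir_monom 1 (idx L P)) =
    (\<Sum>s\<in>int_lists N m.
       dconst (Gq (replicate (m - 1) (int N) @ [int c]) s Q) * t ^ nat (int m * int N - sum_list s))"
proof -
  interpret Q: q_not_root_of_unity Q by (rule q_not_root)
  have kM: "ksub M" "XP \<subseteq> M" "M \<subseteq> P" using M unfolding kbetween_def by blast+
  obtain e where e: "e \<le> N" "idx XP M = q ^ e"
    using idx_between_power[OF ksub_XP ksub_P finite_XP idx_XP M(1)] .
  then have cN: "c \<le> N" using M(2) q_power_inject by simp
  have f: "finite (cosets XP M)" by (rule kbetween_idx(1)[OF ksub_XP ksub_P finite_XP M(1)])
  have "(\<Sum>L | L \<in> lat m \<and> L \<subseteq> M. dir_monom (1::rat) (idx L P)) =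
      (\<Sum>V\<in>kbetween XP M. \<Sum>L | L \<in> {L. L \<in> lat m \<and> L \<subseteq> M} \<and> ssum L XP = V. dir_monom 1 (idx L P))"
  proof (rule sum.group[symmetric])
    show "finite {L. L \<in> lat m \<and> L \<subseteq> M}" using finite_lat by simp
    show "finite (kbetween XP M)" by (rule finite_kbetween[OF ksub_XP kM(1) f])
    show "(\<lambda>L. ssum L XP) ` {L. L \<in> lat m \<and> L \<subseteq> M} \<subseteq> kbetween XP M"
      using ssum_XP_kbetween ssum_least[OF ksub_add_subgrp[OF kM(1)] _ kM(2)] unfolding kbetween_def by blast
  qed
  also have "\<dots> = (\<Sum>V\<in>kbetween XP M. lat_sum m V)"
  proof (rule sum.cong[OF refl])
    fix V assume "V \<in> kbetween XP M"
    then have "{L. L \<in> {L. L \<in> lat m \<and> L \<subseteq> M} \<and> ssum L XP = V} = {L. L \<in> lat m \<and> ssum L XP = V}"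
      using ssum_upper1[OF ksub_add_subgrp[OF ksub_XP]] unfolding kbetween_def by blast
    then show "(\<Sum>L | L \<in> {L. L \<in> lat m \<and> L \<subseteq> M} \<and> ssum L XP = V. dir_monom 1 (idx L P)) = lat_sum m V"
      unfolding lat_sum_def by simp
  qed
  also have "\<dots> = (\<Sum>a\<le>c. dconst (qbinom Q (int c) (int a)) * lat_poly Q t N m a)"
  proof (rule sum_kbetween[OF ksub_XP kM(1,2) f M(2)])
    fix V e assume "V \<in> kbetween XP M" "idx XP V = q ^ e"
    moreover from this have "V \<in> kbetween XP P" using kM(3) unfolding kbetween_def by blast
    ultimately show "lat_sum m V = lat_poly Q t N m e" by (intro lat_sum_eq)
  qed
  finally show ?thesis unfolding Q.sum_Gq[OF cN m] .
qed

section \<open>Moebius inversion\<close>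

lemma X_power_diff: "(\<xi> ^^ k) (x - y) = (\<xi> ^^ k) x - (\<xi> ^^ k) y"
  by (induction k) (simp_all add: X_diff)

text \<open>Two of the vectors \<open>p, \<xi> p, \<dots>, \<xi>\<^sup>k p\<close> are congruent modulo a subgroup of index \<open>k\<close>.\<close>

lemma X_power_subset_of_finite_index:
  assumes L: "add_subgrp L" "finite (cosets L P)"
    and unit: "\<And>p e. p \<in> P \<Longrightarrow> e > 0 \<Longrightarrow> p - (\<xi> ^^ e) p \<in> L \<Longrightarrow> p \<in> L"
    and X_L: "\<And>p. p \<in> L \<Longrightarrow> \<xi> p \<in> L"
  shows "(\<xi> ^^ idx L P) ` P \<subseteq> L"
proof safe
  fix p assume p: "p \<in> P"
  let ?k = "idx L P"
  have P: "(\<xi> ^^ i) p \<in> P" for i using X_power_P[of i] p by blast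
  have "\<not> inj_on (\<lambda>i. (+) ((\<xi> ^^ i) p) ` L) {..?k}"
  proof
    assume "inj_on (\<lambda>i. (+) ((\<xi> ^^ i) p) ` L) {..?k}"
    then have "card {..?k} \<le> card (cosets L P)"
      by (rule card_inj_on_le) (use P L in \<open>auto simp: cosets_def\<close>)
    then show False by (simp add: idx_def)
  qed
  then obtain i j where ij: "i < j" "j \<le> ?k" "(+) ((\<xi> ^^ i) p) ` L = (+) ((\<xi> ^^ j) p) ` L"
    unfolding inj_on_def by (metis atMost_iff linorder_neqE_nat)
  have "(\<xi> ^^ i) p - (\<xi> ^^ (j - i)) ((\<xi> ^^ i) p) = (\<xi> ^^ i) p - (\<xi> ^^ j) p"
    using ij by (simp flip: funpow_add[unfolded comp_def, THEN fun_cong])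
  also have "\<dots> \<in> L" using ij coset_eq_iff[OF L(1)] by simp
  finally have "(\<xi> ^^ i) p \<in> L" using unit[of "(\<xi> ^^ i) p" "j - i"] P ij by simp
  moreover have "(\<xi> ^^ l) x \<in> L" if "x \<in> L" for l x
    using that X_L by (induction l) auto
  ultimately have "(\<xi> ^^ (?k - i)) ((\<xi> ^^ i) p) \<in> L" by blast
  then show "(\<xi> ^^ ?k) p \<in> L"
    using ij by (simp flip: funpow_add[unfolded comp_def, THEN fun_cong])
qed

text \<open>Iterating \<open>cover\<close> gives \<open>P = L + \<xi>^k P\<close> for every
  \<open>k\<close>, and for \<open>k = (P : L)\<close> the second summand already lies in
  \<open>L\<close>. The hypothesis \<open>unit\<close> stands for invertibility of
  \<open>1 - \<xi>^e\<close>.\<close>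

lemma nakayama:
  assumes L: "add_subgrp L" "finite (cosets L P)"
    and unit: "\<And>p e. p \<in> P \<Longrightarrow> e > 0 \<Longrightarrow> p - (\<xi> ^^ e) p \<in> L \<Longrightarrow> p \<in> L"
    and X_L: "\<And>p. p \<in> L \<Longrightarrow> \<xi> p \<in> L"
    and cover: "\<And>p. p \<in> P \<Longrightarrow> \<exists>l\<in>L. \<exists>r\<in>P. p = l + \<xi> r"
  shows "P \<subseteq> L"
proof -
  have "\<exists>l\<in>L. \<exists>r\<in>P. p = l + (\<xi> ^^ k) r" if p: "p \<in> P" for p k
  proof (induction k)
    case 0
    then show ?case using p add_subgrp_0[OF L(1)] by (intro bexI[of _ 0] bexI[of _ p]) auto
  next
    case (Suc k)
    then obtain l r where lr: "l \<in> L" "r \<in> P" "p = l + (\<xi> ^^ k) r" by blast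
    obtain l' r' where lr': "l' \<in> L" "r' \<in> P" "r = l' + \<xi> r'" using cover[OF lr(2)] by blast
    have pow: "(\<xi> ^^ k) x \<in> L" if "x \<in> L" for x using that X_L by (induction k) auto
    have "r - \<xi> r' = l'" using lr' by simp
    then have "(\<xi> ^^ k) r - (\<xi> ^^ k) (\<xi> r') = (\<xi> ^^ k) l'" by (simp flip: X_power_diff)
    then have "p = (l + (\<xi> ^^ k) l') + (\<xi> ^^ Suc k) r'"
      using lr by (simp add: funpow_swap1 algebra_simps)
    moreover have "l + (\<xi> ^^ k) l' \<in> L" using lr lr' pow add_subgrp_add[OF L(1)] by blast
    ultimately show ?case using lr' by blast
  qed
  note cover_power = this
  show ?thesis
  proof
    fix p assume p: "p \<in> P"
    obtain l r where lr: "l \<in> L" "r \<in> P" "p = l + (\<xi> ^^ idx L P) r"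
      using cover_power[OF p, of "idx L P"] by blast
    have "(\<xi> ^^ idx L P) ` P \<subseteq> L" by (rule X_power_subset_of_finite_index[OF L unit X_L])
    then have "(\<xi> ^^ idx L P) r \<in> L" using lr(2) by blast
    then show "p \<in> L" using lr add_subgrp_add[OF L(1)] by simp
  qed
qed

text \<open>Coefficient by coefficient, both sides are the sum of \<open>\<mu> i\<close> over pairs
  of an \<open>i\<close> and a module \<open>L \<subseteq> M i\<close>. For the left side, transport
  along \<open>\<phi> i\<close> counts the \<open>L\<close>; for the right side, summing over
  \<open>i\<close> first removes every \<open>L\<close> that does not contain
  \<open>\<xi>^m P\<close>.\<close>

theorem zeta_identity:
  fixes rsub :: "'v set \<Rightarrow> bool" and M :: "'i \<Rightarrow> 'v set" and \<mu> :: "'i \<Rightarrow> rat"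
    and \<phi> :: "'i \<Rightarrow> 'v \<Rightarrow> 'v" and d :: "'i \<Rightarrow> nat" and Z :: "rat dirichlet"
  assumes rsub: "\<And>L. rsub L \<Longrightarrow> xsub L" "\<And>L. L \<in> lat m \<Longrightarrow> rsub L"
    and unit: "\<And>L p e. rsub L \<Longrightarrow> p \<in> P \<Longrightarrow> e > 0 \<Longrightarrow> p - (\<xi> ^^ e) p \<in> L \<Longrightarrow> p \<in> L"
    and I: "finite I"
    and M: "\<And>i. i \<in> I \<Longrightarrow> M i \<in> kbetween XP P" "\<And>i. i \<in> I \<Longrightarrow> idx (M i) P = q ^ d i"
    and \<phi>: "\<And>i x y. i \<in> I \<Longrightarrow> \<phi> i (x - y) = \<phi> i x - \<phi> i y" "\<And>i. i \<in> I \<Longrightarrow> inj_on (\<phi> i) P"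
      "\<And>i. i \<in> I \<Longrightarrow> \<phi> i ` P = M i" "\<And>i L. i \<in> I \<Longrightarrow> L \<subseteq> P \<Longrightarrow> rsub (\<phi> i ` L) \<longleftrightarrow> rsub L"
    and moebius: "\<And>L. rsub L \<Longrightarrow> finite (cosets L P) \<Longrightarrow> \<not> (\<xi> ^^ m) ` P \<subseteq> L \<Longrightarrow>
      (\<Sum>i | i \<in> I \<and> L \<subseteq> M i. \<mu> i) = 0"
    and m: "m \<ge> 1"
    and Z: "\<And>k. k > 0 \<Longrightarrow> dir_nth Z k = of_nat (card {L. rsub L \<and> finite (cosets L P) \<and> idx L P = k})"
  shows "finite {L. rsub L \<and> finite (cosets L P) \<and> idx L P = k}"
    and "(\<Sum>i\<in>I. dconst (\<mu> i) * t ^ d i) * Z =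
      (\<Sum>i\<in>I. dconst (\<mu> i) * (\<Sum>s\<in>int_lists N m.
        dconst (Gq (replicate (m - 1) (int N) @ [int (N - d i)]) s Q) * t ^ nat (int m * int N - sum_list s)))"
proof -
  define A where "A k = {L. rsub L \<and> finite (cosets L P) \<and> idx L P = k}" for k
  have kP: "add_subgrp P" by (rule ksub_add_subgrp[OF ksub_P])
  have rs: "add_subgrp L" "L \<subseteq> P" "ksub L" "\<And>p. p \<in> L \<Longrightarrow> \<xi> p \<in> L" if "rsub L" for L
    using rsub(1)[OF that] ksub_add_subgrp unfolding xsub_def by blast+
  have "A k \<subseteq> kbetween ((\<xi> ^^ k) ` P) P" for k
  proof
    fix L assume L: "L \<in> A k"
    then have r: "rsub L" "finite (cosets L P)" "idx L P = k" by (auto simp: A_def)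
    have "(\<xi> ^^ idx L P) ` P \<subseteq> L"
      by (rule X_power_subset_of_finite_index[OF rs(1)[OF r(1)] r(2) unit[OF r(1)] rs(4)[OF r(1)]])
    then show "L \<in> kbetween ((\<xi> ^^ k) ` P) P" using rs[OF r(1)] r(3) by (simp add: kbetween_def)
  qed
  then have finA: "finite (A k)" for k
    using finite_kbetween[OF ksub_X_power ksub_P finite_X_power] finite_subset by blast
  then show "finite {L. rsub L \<and> finite (cosets L P) \<and> idx L P = k}" by (simp add: A_def)
  show "(\<Sum>i\<in>I. dconst (\<mu> i) * t ^ d i) * Z =
      (\<Sum>i\<in>I. dconst (\<mu> i) * (\<Sum>s\<in>int_lists N m.
        dconst (Gq (replicate (m - 1) (int N) @ [int (N - d i)]) s Q) * t ^ nat (int m * int N - sum_list s)))"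
    (is "?lhs = ?rhs")
  proof (rule dirichlet_eqI)
    fix k :: nat assume k: "k > 0"
    \<comment> \<open>The isomorphism \<open>\<phi> i\<close> from \<open>P\<close> to
      \<open>M i\<close> multiplies every index in \<open>P\<close> by \<open>q ^ d i\<close>, which
      is the shift that \<open>t ^ d i\<close> performs on coefficients.\<close>
    have count: "dir_nth (t ^ d i * Z) k = of_nat (card {L \<in> A k. L \<subseteq> M i})" if i: "i \<in> I" for i
    proof -
      have kM: "ksub (M i)" "M i \<subseteq> P" "finite (cosets (M i) P)"
        using M(1)[OF i] kbetween_idx(2)[OF ksub_XP ksub_P finite_XP M(1)[OF i]] unfolding kbetween_def by blast+
      have aM: "add_subgrp (M i)" by (rule ksub_add_subgrp[OF kM(1)])
      have td: "t ^ d i = dir_monom 1 (q ^ d i)" using q_ge_2 by (simp add: dir_monom_power)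
      have inj: "inj_on ((`) (\<phi> i)) {L. L \<subseteq> P}"
        using inj_on_image_eq_iff[OF \<phi>(2)[OF i]] by (auto intro!: inj_onI)
      have trans: "finite (cosets (\<phi> i ` L) P) \<longleftrightarrow> finite (cosets L P)"
        "finite (cosets L P) \<Longrightarrow> idx (\<phi> i ` L) P = q ^ d i * idx L P" if L: "rsub L" for L
      proof -
        note c = cosets_inj_image[OF rs(1)[OF L] kP rs(2)[OF L] \<phi>(1)[OF i] \<phi>(2)[OF i]]
        have le: "\<phi> i ` L \<subseteq> M i" using \<phi>(3)[OF i] rs(2)[OF L] by blast
        note tow = cosets_tower[OF c(3) aM kP le kM(2)]
        show "finite (cosets (\<phi> i ` L) P) \<longleftrightarrow> finite (cosets L P)"
          using tow(1) c(2) kM(3) unfolding \<phi>(3)[OF i] by blast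
        then show "finite (cosets L P) \<Longrightarrow> idx (\<phi> i ` L) P = q ^ d i * idx L P"
          using tow(2) c(1) M(2)[OF i] unfolding \<phi>(3)[OF i] by simp
      qed
      show ?thesis
      proof (cases "q ^ d i dvd k")
        case True
        then obtain j where j: "k = q ^ d i * j" by blast
        then have j0: "j > 0" using k by (cases j) auto
        have q0: "q ^ d i > 0" using q_ge_2 by simp
        have "{L \<in> A k. L \<subseteq> M i} = (`) (\<phi> i) ` A j"
        proof
          show "(`) (\<phi> i) ` A j \<subseteq> {L \<in> A k. L \<subseteq> M i}"
          proof
            fix L' assume "L' \<in> (`) (\<phi> i) ` A j"
            then obtain L where L: "rsub L" "finite (cosets L P)" "idx L P = j" "L' = \<phi> i ` L"
              by (auto simp: A_def)
            have "L' \<subseteq> M i" using L(4) \<phi>(3)[OF i] rs(2)[OF L(1)] by blast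
            then show "L' \<in> {L \<in> A k. L \<subseteq> M i}"
              using L trans[OF L(1)] \<phi>(4)[OF i rs(2)[OF L(1)]] by (simp add: A_def j)
          qed
          show "{L \<in> A k. L \<subseteq> M i} \<subseteq> (`) (\<phi> i) ` A j"
          proof
            fix L' assume L': "L' \<in> {L \<in> A k. L \<subseteq> M i}"
            define L where "L = {p \<in> P. \<phi> i p \<in> L'}"
            have L'M: "L' \<subseteq> M i" "rsub L'" "finite (cosets L' P)" "idx L' P = k" using L' by (auto simp: A_def)
            have im: "L' = \<phi> i ` L"
            proof
              show "L' \<subseteq> \<phi> i ` L"
              proof
                fix x assume x: "x \<in> L'"
                then have "x \<in> \<phi> i ` P" using L'M(1) unfolding \<phi>(3)[OF i] by (rule subsetD[rotated])
                then show "x \<in> \<phi> i ` L" using x by (auto simp: L_def)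
              qed
            qed (auto simp: L_def)
            have "L \<subseteq> P" by (auto simp: L_def)
            then have L: "rsub L" using \<phi>(4)[OF i, of L] L'M(2) im by simp
            have "finite (cosets L P)" using trans(1)[OF L] L'M(3) im by simp
            moreover from this have "idx L P = j"
              using trans(2)[OF L] L'M(4) q_ge_2 im j by auto
            ultimately show "L' \<in> (`) (\<phi> i) ` A j" using im L by (auto simp: A_def)
          qed
        qed
        moreover have "inj_on ((`) (\<phi> i)) (A j)"
          by (rule inj_on_subset[OF inj]) (use rs(2) in \<open>auto simp: A_def\<close>)
        ultimately have "card {L \<in> A k. L \<subseteq> M i} = card (A j)" by (simp add: card_image)
        moreover have "dir_nth (t ^ d i * Z) k = of_nat (card (A j))"
          unfolding td using k q0 j j0 Z[OF j0] by (simp add: dir_nth_monom_times A_def)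
        ultimately show ?thesis by simp
      next
        case False
        have "{L \<in> A k. L \<subseteq> M i} = {}"
        proof (rule ccontr)
          assume "{L \<in> A k. L \<subseteq> M i} \<noteq> {}"
          then obtain L where L: "rsub L" "finite (cosets L P)" "idx L P = k" "L \<subseteq> M i" by (auto simp: A_def)
          have "idx L P = idx L (M i) * idx (M i) P"
            by (rule cosets_tower(2)[OF rs(1)[OF L(1)] aM kP L(4) kM(2) L(2)])
          then show False using False L M(2)[OF i] by simp
        qed
        then have "card {L \<in> A k. L \<subseteq> M i} = 0" by (simp only: card.empty)
        then show ?thesis unfolding td using False k q_ge_2 by (simp add: dir_nth_monom_times)
      qed
    qed
    have dc: "dir_nth (dconst a * f) k = a * dir_nth f k" for a and f :: "rat dirichlet"
      using k by (simp add: dir_nth_monom_times)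
    have "dir_nth ?lhs k = (\<Sum>i\<in>I. \<mu> i * dir_nth (t ^ d i * Z) k)"
      by (simp add: sum_distrib_right dir_nth_sum mult.assoc dc)
    also have "\<dots> = (\<Sum>i\<in>I. \<Sum>L\<in>A k. if L \<subseteq> M i then \<mu> i else 0)"
      using finA[of k] by (intro sum.cong refl) (simp add: count sum.If_cases Int_def)
    also have "\<dots> = (\<Sum>L\<in>A k. \<Sum>i\<in>I. if L \<subseteq> M i then \<mu> i else 0)" by (rule sum.swap)
    \<comment> \<open>Moebius cancellation: the inner sum is 0 unless \<open>L\<close> contains
      \<open>\<xi>^m P\<close>. For the surviving \<open>L\<close>, the conditions
      \<open>rsub\<close> and \<open>xsub\<close> agree, which leaves \<open>lat m\<close>.\<close>
    also have "\<dots> = (\<Sum>L\<in>{L \<in> A k. (\<xi> ^^ m) ` P \<subseteq> L}. \<Sum>i\<in>I. if L \<subseteq> M i then \<mu> i else 0)"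
    proof (rule sum.mono_neutral_right[OF finA])
      show "\<forall>L\<in>A k - {L \<in> A k. (\<xi> ^^ m) ` P \<subseteq> L}. (\<Sum>i\<in>I. if L \<subseteq> M i then \<mu> i else 0) = 0"
        using moebius I by (auto simp: A_def sum.If_cases Int_def)
    qed auto
    also have "{L \<in> A k. (\<xi> ^^ m) ` P \<subseteq> L} = {L \<in> lat m. idx L P = k}"
    proof (rule Set.set_eqI)
      fix L
      have "L \<in> lat m \<longleftrightarrow> rsub L \<and> (\<xi> ^^ m) ` P \<subseteq> L"
        using rsub(1)[of L] rsub(2)[of L] unfolding lat_def by blast
      then show "L \<in> {L \<in> A k. (\<xi> ^^ m) ` P \<subseteq> L} \<longleftrightarrow> L \<in> {L \<in> lat m. idx L P = k}"
        using finite_cosets_lat[of L m] unfolding A_def by blast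
    qed
    also have "(\<Sum>L\<in>{L \<in> lat m. idx L P = k}. \<Sum>i\<in>I. if L \<subseteq> M i then \<mu> i else 0) =
        (\<Sum>i\<in>I. \<Sum>L\<in>{L \<in> lat m. idx L P = k}. if L \<subseteq> M i then \<mu> i else 0)" by (rule sum.swap)
    also have "\<dots> = (\<Sum>i\<in>I. \<mu> i * dir_nth (\<Sum>L | L \<in> lat m \<and> L \<subseteq> M i. dir_monom 1 (idx L P)) k)"
    proof (rule sum.cong[OF refl])
      fix i assume "i \<in> I"
      have "dir_nth (\<Sum>L | L \<in> lat m \<and> L \<subseteq> M i. dir_monom (1::rat) (idx L P)) k =
          (\<Sum>L | L \<in> lat m \<and> L \<subseteq> M i. if idx L P = k then 1 else 0)"
        using k by (auto simp: dir_nth_sum dir_nth_monom intro!: sum.cong)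
      also have "\<dots> = of_nat (card {L. L \<in> lat m \<and> L \<subseteq> M i \<and> idx L P = k})"
        using finite_lat[of m] by (simp add: sum.If_cases Int_def conj_ac)
      finally show "(\<Sum>L\<in>{L \<in> lat m. idx L P = k}. if L \<subseteq> M i then \<mu> i else 0) =
          \<mu> i * dir_nth (\<Sum>L | L \<in> lat m \<and> L \<subseteq> M i. dir_monom 1 (idx L P)) k"
        using finite_lat[of m] by (simp add: sum.If_cases Int_def conj_ac)
    qed
    also have "\<dots> = dir_nth (\<Sum>i\<in>I. dconst (\<mu> i) * (\<Sum>L | L \<in> lat m \<and> L \<subseteq> M i. dir_monom 1 (idx L P))) k"
      by (simp only: dir_nth_sum[of _ I] dc)
    also have "(\<Sum>i\<in>I. dconst (\<mu> i) * (\<Sum>L | L \<in> lat m \<and> L \<subseteq> M i. dir_monom 1 (idx L P))) = ?rhs"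
    proof (rule sum.cong[OF refl])
      fix i assume i: "i \<in> I"
      obtain e where e: "e \<le> N" "idx XP (M i) = q ^ e" "idx (M i) P = q ^ (N - e)"
        using idx_between_power[OF ksub_XP ksub_P finite_XP idx_XP M(1)[OF i]] .
      then have "N - d i = e" using M(2)[OF i] q_power_inject by simp
      then show "dconst (\<mu> i) * (\<Sum>L | L \<in> lat m \<and> L \<subseteq> M i. dir_monom 1 (idx L P)) =
        dconst (\<mu> i) * (\<Sum>s\<in>int_lists N m.
          dconst (Gq (replicate (m - 1) (int N) @ [int (N - d i)]) s Q) * t ^ nat (int m * int N - sum_list s))"
        using sum_lat_below[OF M(1)[OF i] _ m, of e] e(2) by simp
    qed
    finally show "dir_nth ?lhs k = dir_nth ?rhs k" .
  qed
qed

end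

section \<open>Submodules of free modules over power series rings\<close>

text \<open>Vectors are functions that vanish from \<open>n\<close> on, so that for every
  \<open>n\<close> they form a subgroup of one pointwise abelian group.\<close>

definition vecs :: "nat \<Rightarrow> (nat \<Rightarrow> 'c::zero) set" where
  "vecs n = {f. \<forall>i\<ge>n. f i = 0}"

definition vmul :: "'c::comm_ring_1 \<Rightarrow> (nat \<Rightarrow> 'c) \<Rightarrow> nat \<Rightarrow> 'c" where
  "vmul r f = (\<lambda>i. r * f i)"

definition unit_vec :: "nat \<Rightarrow> nat \<Rightarrow> 'c::comm_ring_1" where
  "unit_vec i = (\<lambda>k. if k = i then 1 else 0)"

lemma add_subgrp_vecs: "add_subgrp (vecs n :: (nat \<Rightarrow> 'c::ab_group_add) set)"
  by (auto simp: add_subgrp_def vecs_def)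

lemma vmul_vecs: "f \<in> vecs n \<Longrightarrow> vmul r f \<in> vecs n"
  by (simp add: vecs_def vmul_def)

lemma vmul_simps:
  "vmul r (f + g) = vmul r f + vmul r g" "vmul r (f - g) = vmul r f - vmul r g"
  "vmul (r + s) f = vmul r f + vmul s f" "vmul (r - s) f = vmul r f - vmul s f"
  "vmul r (vmul s f) = vmul (r * s) f" "vmul 1 f = f" "vmul r 0 = 0" "vmul 0 f = 0"
  by (simp_all add: vmul_def fun_eq_iff algebra_simps)

lemma sum_vmul: "vmul (sum c A) f = (\<Sum>i\<in>A. vmul (c i) f)"
  by (induction A rule: infinite_finite_induct) (simp_all add: vmul_simps)

lemma sum_fun_apply: "(\<Sum>i\<in>A. f i) x = (\<Sum>i\<in>A. f i x :: 'c::comm_monoid_add)"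
  by (induction A rule: infinite_finite_induct) simp_all

lemma funpow_vmul: "(vmul x ^^ k) f = vmul (x ^ k) f"
  by (induction k) (simp_all add: vmul_simps)

lemma add_subgrp_sum: "add_subgrp A \<Longrightarrow> (\<And>i. i \<in> I \<Longrightarrow> f i \<in> A) \<Longrightarrow> sum f I \<in> A"
  by (induction I rule: infinite_finite_induct) (simp_all add: add_subgrp_0 add_subgrp_add)

lemma card_vecs_in:
  fixes E :: "'e::zero set"
  assumes "finite E" "0 \<in> E"
  shows "card {f \<in> vecs n. \<forall>i. f i \<in> E} = card E ^ n" "finite {f \<in> vecs n. \<forall>i. f i \<in> E}"
proof -
  have bij: "bij_betw (\<lambda>f. restrict f {..<n}) {f \<in> vecs n. \<forall>i. f i \<in> E} ({..<n} \<rightarrow>\<^sub>E E)"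
  proof (rule bij_betwI[where g = "\<lambda>f i. if i < n then f i else 0"])
    show "(\<lambda>f i. if i < n then f i else 0) \<in> ({..<n} \<rightarrow>\<^sub>E E) \<rightarrow> {f \<in> vecs n. \<forall>i. f i \<in> E}"
      using assms by (auto simp: vecs_def PiE_def)
  qed (auto simp: vecs_def restrict_def PiE_def extensional_def fun_eq_iff)
  show "card {f \<in> vecs n. \<forall>i. f i \<in> E} = card E ^ n"
    using bij_betw_same_card[OF bij] by (simp add: card_PiE)
  show "finite {f \<in> vecs n. \<forall>i. f i \<in> E}"
    using bij_betw_finite[OF bij] assms by (simp add: finite_PiE)
qed

text \<open>\<open>\<pi>\<close> acts as the residue map modulo \<open>x\<close>. Only its
  additivity is required, so the residue ring may be presented as a bare group of leading
  coefficients.\<close>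

lemma idx_vmul_vecs:
  fixes \<pi> :: "'c::comm_ring_1 \<Rightarrow> 'e::ab_group_add"
  assumes diff: "\<And>a b. \<pi> (a - b) = \<pi> a - \<pi> b" and fin: "finite (range \<pi>)"
    and ker: "\<And>a. \<pi> a = 0 \<longleftrightarrow> x dvd a"
  shows "idx (vmul x ` vecs n) (vecs n) = card (range \<pi>) ^ n" "finite (cosets (vmul x ` vecs n) (vecs n))"
proof -
  let ?E = "{g \<in> vecs n. \<forall>i. g i \<in> range \<pi>}"
  have \<pi>0: "\<pi> 0 = 0" using diff[of 0 0] by simp
  have 0: "add_subgrp {0 :: nat \<Rightarrow> 'e}" by (auto simp: add_subgrp_def)
  have 1: "add_subgrp (vmul x ` vecs n)"
  proof (rule add_subgrpI)
    show "0 \<in> vmul x ` vecs n" using add_subgrp_0[OF add_subgrp_vecs] by (force simp: vmul_simps)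
    fix f g assume "f \<in> vmul x ` vecs n" "g \<in> vmul x ` vecs n"
    then obtain f' g' where "f' \<in> vecs n" "g' \<in> vecs n" "f = vmul x f'" "g = vmul x g'" by auto
    then show "f - g \<in> vmul x ` vecs n"
      using add_subgrp_diff[OF add_subgrp_vecs, of f' n g'] by (auto simp flip: vmul_simps)
  qed
  have 2: "(\<lambda>i. \<pi> (f i)) \<in> {0} \<longleftrightarrow> f \<in> vmul x ` vecs n" if f: "f \<in> vecs n" for f
  proof
    assume "(\<lambda>i. \<pi> (f i)) \<in> {0}"
    then have "x dvd f i" for i using ker by (simp add: fun_eq_iff)
    then obtain g where g: "f i = x * g i" for i unfolding dvd_def by metis
    have "f = vmul x (\<lambda>i. if i < n then g i else 0)"
      using f g by (auto simp: vmul_def vecs_def fun_eq_iff)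
    moreover have "(\<lambda>i. if i < n then g i else 0) \<in> vecs n" by (simp add: vecs_def)
    ultimately show "f \<in> vmul x ` vecs n" by blast
  next
    assume "f \<in> vmul x ` vecs n"
    then obtain g where "f = vmul x g" by blast
    then have "\<pi> (f i) = 0" for i using ker[of "f i"] by (simp add: vmul_def)
    then show "(\<lambda>i. \<pi> (f i)) \<in> {0}" by (simp add: fun_eq_iff)
  qed
  have 3: "\<exists>f\<in>vecs n. g - (\<lambda>i. \<pi> (f i)) \<in> {0}" if "g \<in> ?E" for g
  proof -
    have "\<pi> (inv_into UNIV \<pi> (g i)) = g i" for i using that by (intro f_inv_into_f) simp
    then show ?thesis using that \<pi>0
      by (intro bexI[of _ "\<lambda>i. if i < n then inv_into UNIV \<pi> (g i) else 0"]) (auto simp: vecs_def fun_eq_iff)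
  qed
  have 4: "(\<lambda>i. \<pi> (f i)) \<in> ?E" if "f \<in> vecs n" for f using that \<pi>0 by (simp add: vecs_def)
  note c = cosets_bij[OF 1 add_subgrp_vecs 0, where f = "\<lambda>f i. \<pi> (f i)" and C' = ?E, OF _ 3 4 2]
  have E0: "0 \<in> range \<pi>" using \<pi>0 by (metis rangeI)
  have "cosets {0} ?E = (\<lambda>f. {f}) ` ?E" by (auto simp: cosets_def)
  then have "idx {0} ?E = card (range \<pi>) ^ n" "finite (cosets {0} ?E)"
    using card_vecs_in[OF fin E0, of n] by (simp_all add: idx_def card_image)
  then show "idx (vmul x ` vecs n) (vecs n) = card (range \<pi>) ^ n" "finite (cosets (vmul x ` vecs n) (vecs n))"
    using c by (auto simp: diff fun_eq_iff)
qed

lemma fps_split: "a = fps_const (a $ 0) + fps_X * Abs_fps (\<lambda>i. a $ Suc i)" for a :: "'a::comm_ring_1 fps"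
  by (rule fps_ext) (auto simp: fps_X_mult_nth)

lemma fps_X_dvd_iff: "fps_X dvd a \<longleftrightarrow> a $ 0 = (0 :: 'a::comm_ring_1)"
proof
  assume "a $ 0 = 0"
  then have "a = fps_X * Abs_fps (\<lambda>i. a $ Suc i)" using fps_split[of a] by simp
  then show "fps_X dvd a" by (metis dvd_triv_left)
qed auto

lemma fps_one_minus_X_power: "e > 0 \<Longrightarrow> inverse (1 - fps_X ^ e) * (1 - fps_X ^ e :: 'a::field fps) = 1"
  by (rule inverse_mult_eq_1) (simp add: fps_X_power_nth)

definition vsub :: "nat \<Rightarrow> (nat \<Rightarrow> 'c::comm_ring_1) set \<Rightarrow> bool" where
  "vsub n M \<longleftrightarrow> add_subgrp M \<and> M \<subseteq> vecs n \<and> (\<forall>r. \<forall>f\<in>M. vmul r f \<in> M)"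

text \<open>Containing all multiples of the variable, these modules amount to subspaces of an
  \<open>n\<close>-dimensional space over the coefficient field.\<close>

definition umods :: "nat \<Rightarrow> (nat \<Rightarrow> 'f::field fps) set set" where
  "umods n = {M. vsub n M \<and> vmul fps_X ` vecs n \<subseteq> M}"

definition codim :: "nat \<Rightarrow> (nat \<Rightarrow> 'f::{field,finite} fps) set \<Rightarrow> nat" where
  "codim n M = (THE r. idx M (vecs n) = CARD('f) ^ r)"

text \<open>The Moebius function of an interval of dimension \<open>r\<close> in the lattice of
  subspaces over a field with \<open>Q\<close> elements.\<close>

definition mu :: "'a::field \<Rightarrow> nat \<Rightarrow> 'a" where
  "mu Q r = (-1) ^ r * Q ^ (r * (r - 1) div 2)"

section \<open>Modules between \<open>X P\<close> and \<open>P\<close> over a power series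
  ring\<close>

context
  fixes n :: nat and ty :: "'f::{field,finite} itself"
begin

private abbreviation (input) "P \<equiv> (vecs n :: (nat \<Rightarrow> 'f fps) set)"

text \<open>The counting locale is reused with the whole coefficient field as scalars, so that
  \<open>umods\<close> becomes an interval \<open>kbetween\<close> and Gaussian binomials
  apply.\<close>

interpretation F: lattice_count "\<lambda>c::'f. vmul (fps_const c)" UNIV P "vmul fps_X" n
proof -
  interpret V: vector_space "\<lambda>c::'f. vmul (fps_const c)"
    by unfold_locales (simp_all add: vmul_simps flip: fps_const_add fps_const_mult)
  interpret S: finite_scalars "\<lambda>c::'f. vmul (fps_const c)" UNIV
    by unfold_locales (auto simp: add_subgrp_def)
  have k: "S.ksub P" by (auto simp: S.ksub_def add_subgrp_vecs vmul_vecs)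
  have "surj (\<lambda>a::'f fps. a $ 0)"
  proof (rule surjI)
    show "fps_const c $ 0 = c" for c :: 'f by simp
  qed
  then have i: "idx (vmul fps_X ` P) P = CARD('f) ^ n" "finite (cosets (vmul fps_X ` P) P)"
    using idx_vmul_vecs[of "\<lambda>a::'f fps. a $ 0" fps_X n] by (simp_all add: fps_X_dvd_iff)
  have inj: "inj_on (vmul fps_X) P" by (auto simp: inj_on_def vmul_def fun_eq_iff)
  show "lattice_count (\<lambda>c::'f. vmul (fps_const c)) UNIV P (vmul fps_X) n"
    using k i inj by unfold_locales (simp_all add: vmul_simps mult.commute vmul_vecs)
qed

text \<open>A scalar series is a constant plus a multiple of \<open>X\<close>, and multiples of
  \<open>X\<close> map \<open>P\<close> into \<open>M\<close> anyway; closure under constants is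
  enough.\<close>

lemma umods_eq: "umods n = F.kbetween F.XP P"
proof -
  have "(\<forall>r. \<forall>f\<in>M. vmul r f \<in> M) \<longleftrightarrow> (\<forall>c. \<forall>f\<in>M. vmul (fps_const c) f \<in> M)"
    if M: "add_subgrp M" "M \<subseteq> P" "F.XP \<subseteq> M" for M
  proof safe
    fix r f assume c: "\<forall>c. \<forall>f\<in>M. vmul (fps_const c) f \<in> M" and f: "f \<in> M"
    have "vmul r f = vmul (fps_const (r $ 0)) f + vmul fps_X (vmul (Abs_fps (\<lambda>i. r $ Suc i)) f)"
      by (subst fps_split[of r]) (simp only: vmul_simps)
    moreover have "vmul fps_X (vmul (Abs_fps (\<lambda>i. r $ Suc i)) f) \<in> M"
      using vmul_vecs[of f n] f M by blast
    ultimately show "vmul r f \<in> M" using c f add_subgrp_add[OF M(1)] by simp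
  qed auto
  note eq = this
  show ?thesis
  proof (rule Set.set_eqI)
    fix M show "M \<in> umods n \<longleftrightarrow> M \<in> F.kbetween F.XP P"
    proof (cases "add_subgrp M \<and> M \<subseteq> P \<and> F.XP \<subseteq> M")
      case True
      then show ?thesis using eq[of M] by (simp add: umods_def vsub_def F.kbetween_def F.ksub_def)
    next
      case False
      then show ?thesis by (simp add: umods_def vsub_def F.kbetween_def F.ksub_def) metis
    qed
  qed
qed

lemma aP: "add_subgrp P" by (rule add_subgrp_vecs)

lemma finite_umods: "finite (umods n :: (nat \<Rightarrow> 'f fps) set set)"
  unfolding umods_eq by (rule F.finite_kbetween[OF F.ksub_XP F.ksub_P F.finite_XP])

lemma codim_eqI: "idx M P = CARD('f) ^ r \<Longrightarrow> codim n M = r"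
  unfolding codim_def using F.q_power_inject by (intro the_equality) auto

lemma idx_umods:
  fixes M :: "(nat \<Rightarrow> 'f fps) set"
  assumes "M \<in> umods n"
  shows "idx M P = CARD('f) ^ codim n M" "codim n M \<le> n" "finite (cosets M P)"
proof -
  obtain e where e: "e \<le> n" "idx M P = CARD('f) ^ (n - e)"
    using F.idx_between_power[OF F.ksub_XP F.ksub_P F.finite_XP F.idx_XP] assms
    unfolding umods_eq by blast
  then show "idx M P = CARD('f) ^ codim n M" "codim n M \<le> n" using codim_eqI by simp_all
  show "finite (cosets M P)"
    using F.kbetween_idx(2)[OF F.ksub_XP F.ksub_P F.finite_XP] assms unfolding umods_eq by blast
qed

lemma sum_codim_between:
  fixes g :: "nat \<Rightarrow> rat dirichlet" and A :: "(nat \<Rightarrow> 'f fps) set"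
  assumes A: "A \<in> umods n"
  shows "(\<Sum>M\<in>{M\<in>umods n. A \<subseteq> M}. g (codim n M)) =
    (\<Sum>r\<le>codim n A. dconst (qbinom (of_nat CARD('f)) (int (codim n A)) (int r)) * g r)"
proof -
  interpret Q: q_not_root_of_unity "rat_of_nat CARD('f)" by (rule F.q_not_root)
  let ?d = "codim n A"
  have kA: "F.ksub A" "F.XP \<subseteq> A" "A \<subseteq> P" using A unfolding umods_eq F.kbetween_def by blast+
  have "{M\<in>umods n. A \<subseteq> M} = F.kbetween A P"
    unfolding umods_eq F.kbetween_def using kA(2) by blast
  then have "(\<Sum>M\<in>{M\<in>umods n. A \<subseteq> M}. g (codim n M)) = (\<Sum>M\<in>F.kbetween A P. g (codim n M))" by simp
  also have "\<dots> = (\<Sum>e\<le>?d. dconst (qbinom (of_nat F.q) (int ?d) (int e)) * g (?d - e))"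
  proof (rule F.sum_kbetween[OF kA(1) F.ksub_P kA(3) idx_umods(3)[OF A]])
    show i: "idx A P = F.q ^ ?d" using idx_umods(1)[OF A] by simp
    fix M e assume M: "M \<in> F.kbetween A P" "e \<le> ?d" "idx A M = F.q ^ e"
    obtain e' where e': "idx A M = F.q ^ e'" "idx M P = F.q ^ (?d - e')"
      using F.idx_between_power[OF kA(1) F.ksub_P idx_umods(3)[OF A] i M(1)] .
    then have "e' = e" using M(3) F.q_power_inject by simp
    then show "g (codim n M) = g (?d - e)" using codim_eqI e' by simp
  qed
  also have "\<dots> = (\<Sum>r\<le>?d. dconst (qbinom (of_nat CARD('f)) (int ?d) (int r)) * g r)"
    by (rule sum.reindex_bij_witness[of _ "\<lambda>r. ?d - r" "\<lambda>r. ?d - r"])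
      (auto simp: Q.qbinom_sym of_nat_diff)
  finally show ?thesis .
qed

lemma XP_umods: "F.XP \<in> umods n" "codim n F.XP = n"
proof -
  show "F.XP \<in> umods n" unfolding umods_eq F.kbetween_def using F.ksub_XP F.XP_subset by blast
  show "codim n F.XP = n" using codim_eqI F.idx_XP by simp
qed

lemma sum_umods:
  fixes g :: "nat \<Rightarrow> rat dirichlet"
  shows "(\<Sum>M\<in>umods n. g (codim n (M :: (nat \<Rightarrow> 'f fps) set))) =
    (\<Sum>r\<le>n. dconst (qbinom (of_nat CARD('f)) (int n) (int r)) * g r)"
proof -
  have "{M\<in>umods n. F.XP \<subseteq> M} = umods n" unfolding umods_def by blast
  then show ?thesis using sum_codim_between[OF XP_umods(1), of g] XP_umods(2) by simp
qed

text \<open>The modules above \<open>L\<close> form the interval above their intersection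
  \<open>A\<close>. Summed by codimension, the alternating terms give a Pochhammer symbol at
  1.\<close>

lemma umods_moebius:
  fixes M0 :: "(nat \<Rightarrow> 'f fps) set"
  assumes M0: "M0 \<in> umods n" "L \<subseteq> M0" "M0 \<noteq> P"
  shows "(\<Sum>M | M \<in> umods n \<and> L \<subseteq> M. mu (rat_of_nat CARD('f)) (codim n M)) = 0"
proof -
  interpret Q: q_not_root_of_unity "rat_of_nat CARD('f)" by (rule F.q_not_root)
  define A where "A = \<Inter>{M \<in> umods n. L \<subseteq> M}"
  have AM0: "A \<subseteq> M0" using M0 unfolding A_def by blast
  have A: "A \<in> umods n"
  proof -
    have "A \<subseteq> P" using AM0 M0 by (auto simp: umods_def vsub_def)
    moreover have "F.XP \<subseteq> A" unfolding A_def umods_def by blast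
    moreover have "add_subgrp A"
      by (rule add_subgrpI) (auto simp: A_def umods_def vsub_def add_subgrp_0 add_subgrp_diff)
    moreover have "vmul r f \<in> A" if "f \<in> A" for r f
      using that unfolding A_def umods_def vsub_def by blast
    ultimately show ?thesis by (simp add: umods_def vsub_def)
  qed
  have "A \<noteq> P" using AM0 M0 by (auto simp: umods_def vsub_def)
  have eq: "{M. M \<in> umods n \<and> L \<subseteq> M} = {M\<in>umods n. A \<subseteq> M}" unfolding A_def by blast
  let ?d = "codim n A"
  have "?d \<noteq> 0"
  proof
    assume "?d = 0"
    then have "idx A P = 1" using idx_umods(1)[OF A] by simp
    then show False
      using idx_eq_1_iff[of A P] A \<open>A \<noteq> P\<close> aP by (auto simp: umods_def vsub_def)
  qed
  have "dconst (\<Sum>M | M \<in> umods n \<and> L \<subseteq> M. mu (rat_of_nat CARD('f)) (codim n M)) =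
      dconst (\<Sum>r\<le>?d. qbinom (of_nat CARD('f)) (int ?d) (int r) * mu (of_nat CARD('f)) r)"
    unfolding eq dconst_sum
    using sum_codim_between[OF A, of "\<lambda>r. dconst (mu (rat_of_nat CARD('f)) r)"]
    by (simp add: dconst_mult)
  also have "(\<Sum>r\<le>?d. qbinom (of_nat CARD('f)) (int ?d) (int r) * mu (rat_of_nat CARD('f)) r) =
      qpoch 1 (of_nat CARD('f)) ?d"
    using Q.qpoch_expand[of "\<lambda>a. a" 1 ?d] by (simp add: mu_def mult.assoc)
  \<comment> \<open>The factor with index 0 is \<open>1 - 1\<close>; it is present because the
    codimension of \<open>A\<close> is positive.\<close>
  also have "\<dots> = 0" using \<open>?d \<noteq> 0\<close> by (auto simp: qpoch_def intro!: bexI[of _ 0])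
  finally have "dir_nth (dconst (\<Sum>M | M \<in> umods n \<and> L \<subseteq> M. mu (rat_of_nat CARD('f)) (codim n M))) 1 = 0"
    by (simp add: zero_dirichlet.rep_eq)
  then show ?thesis by (simp add: dir_nth_monom)
qed

text \<open>\<open>W + X P\<close> belongs to \<open>umods\<close> and contains \<open>L\<close>, so
  it is all of \<open>P\<close>, and Nakayama removes \<open>X P\<close>. The contrapositive is what
  gets used: a proper \<open>W\<close> yields a proper \<open>M\<close> above
  \<open>L\<close>.\<close>

lemma umods_nakayama:
  fixes W :: "(nat \<Rightarrow> 'f fps) set"
  assumes W: "vsub n W" "finite (cosets W P)" and LW: "L \<subseteq> W"
    and L: "\<And>M. M \<in> umods n \<Longrightarrow> L \<subseteq> M \<Longrightarrow> M = P"
  shows "W = P"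
proof -
  have aW: "add_subgrp W" "W \<subseteq> P" "\<And>r f. f \<in> W \<Longrightarrow> vmul r f \<in> W" using W by (auto simp: vsub_def)
  have kW: "F.ksub W" using aW by (auto simp: F.ksub_def)
  have "ssum W F.XP \<in> umods n"
    unfolding umods_eq F.kbetween_def
    using F.ksub_ssum[OF kW F.ksub_XP] ssum_upper2[OF aW(1), of F.XP]
      ssum_least[OF aP aW(2) F.XP_subset] by simp
  moreover have "L \<subseteq> ssum W F.XP"
    using LW ssum_upper1[OF F.ksub_add_subgrp[OF F.ksub_XP], of W] by blast
  ultimately have eq: "ssum W F.XP = P" by (rule L)
  have "P \<subseteq> W"
  proof (rule F.nakayama[OF aW(1) W(2)])
    fix p :: "nat \<Rightarrow> 'f fps" and e :: nat
    assume e: "e > 0" and pW: "p - (vmul fps_X ^^ e) p \<in> W"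
    have "p - (vmul fps_X ^^ e) p = vmul (1 - fps_X ^ e) p" by (simp add: funpow_vmul vmul_simps)
    then have "vmul (inverse (1 - fps_X ^ e)) (vmul (1 - fps_X ^ e) p) \<in> W"
      using aW(3)[OF pW] by simp
    then show "p \<in> W" using fps_one_minus_X_power[OF e, where ?'a = 'f] by (simp only: vmul_simps(5,6))
  next
    fix p assume "p \<in> P"
    then have "p \<in> ssum W F.XP" using eq by simp
    then show "\<exists>l\<in>W. \<exists>r\<in>P. p = l + vmul fps_X r" by (auto elim!: ssum_memE)
  qed (rule aW(3))
  then show ?thesis using aW(2) by blast
qed

text \<open>For a basis vector \<open>?e j \<notin> M\<close>, the hyperplane \<open>M\<close>
  consists of the \<open>f\<close> for which \<open>X\<close> divides \<open>f j + F f\<close>,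
  where \<open>F\<close> collects the classes of the other basis vectors. The map
  \<open>\<phi>\<close> changes only coordinate \<open>j\<close>, and it does so that
  \<open>\<phi> f j + F (\<phi> f)\<close> becomes \<open>X\<close> times
  \<open>f j\<close>.\<close>

lemma umods_hyperplane_image:
  fixes M :: "(nat \<Rightarrow> 'f fps) set"
  assumes M: "M \<in> umods n" "idx M P = CARD('f)"
  obtains \<phi> where "\<And>x y. \<phi> (x - y) = \<phi> x - \<phi> y" "\<And>r f. \<phi> (vmul r f) = vmul r (\<phi> f)"
    "inj_on \<phi> P" "\<phi> ` P = M"
proof -
  have aM: "add_subgrp M" "M \<subseteq> P" "\<And>r f. f \<in> M \<Longrightarrow> vmul r f \<in> M" "F.XP \<subseteq> M"
    using M by (auto simp: umods_def vsub_def)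
  have kM: "F.ksub M" using aM by (auto simp: F.ksub_def)
  let ?e = "unit_vec :: nat \<Rightarrow> nat \<Rightarrow> 'f fps"
  have expand: "f = (\<Sum>i<n. vmul (f i) (?e i))" if "f \<in> P" for f
  proof
    fix k
    have "(\<Sum>i<n. vmul (f i) (?e i)) k = (\<Sum>i<n. if i = k then f k else 0)"
      unfolding sum_fun_apply by (intro sum.cong) (auto simp: vmul_def unit_vec_def)
    then show "f k = (\<Sum>i<n. vmul (f i) (?e i)) k" using that by (simp add: vecs_def)
  qed
  have eP: "?e i \<in> P" if "i < n" for i using that by (auto simp: vecs_def unit_vec_def)
  \<comment> \<open>A proper \<open>M\<close> misses some basis vector, and a vector outside a
    hyperplane generates everything over it.\<close>
  have "\<exists>j<n. ?e j \<notin> M"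
  proof (rule ccontr)
    assume "\<not> ?thesis"
    then have "f \<in> M" if "f \<in> P" for f
      using aM(3) add_subgrp_sum[OF aM(1), of "{..<n}" "\<lambda>i. vmul (f i) (?e i)"] expand[OF that] by simp
    then have "M = P" using aM(2) by blast
    then show False using M(2) idx_self[OF aP] F.q_ge_2 by simp
  qed
  then obtain j where j: "j < n" "?e j \<notin> M" by blast
  have "idx (ssum M (F.line (?e j))) P = 1"
    using F.idx_ssum_line_tower(1)[OF kM F.ksub_P aM(2) idx_umods(3)[OF M(1)] eP[OF j(1)] j(2)] M(2) F.q_ge_2
    by simp
  then have span: "ssum M (F.line (?e j)) = P"
    using F.ssum_line_between[OF kM F.ksub_P aM(2) eP[OF j(1)]]
      idx_eq_1_iff[OF F.ksub_add_subgrp F.ksub_add_subgrp[OF F.ksub_P]] by blast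
  have "\<exists>c. ?e i - vmul (fps_const c) (?e j) \<in> M" if i: "i < n" for i
  proof -
    have "?e i \<in> ssum M (F.line (?e j))" using eP[OF i] span by simp
    then obtain l c where "l \<in> M" "?e i = l + vmul (fps_const c) (?e j)"
      by (auto simp: F.line_def elim!: ssum_memE)
    then show ?thesis by (intro exI[of _ c]) simp
  qed
  then obtain c where c: "\<And>i. i < n \<Longrightarrow> ?e i - vmul (fps_const (c i)) (?e j) \<in> M" by metis
  define F where "F f = (\<Sum>i\<in>{..<n} - {j}. fps_const (c i) * f i)" for f :: "nat \<Rightarrow> 'f fps"
  define \<phi> where "\<phi> f = f(j := fps_X * f j - F f)" for f
  have F_diff: "F (x - y) = F x - F y" for x y
    by (simp add: F_def right_diff_distrib sum_subtractf)
  have F_vmul: "F (vmul r f) = r * F f" for r f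
    by (simp add: F_def vmul_def sum_distrib_left mult_ac)
  have F_upd: "F (f(j := y)) = F f" for f y unfolding F_def by (intro sum.cong) auto
  \<comment> \<open>The differences of \<open>?e i\<close> and its multiple of \<open>?e j\<close>
    lie in \<open>M\<close>, so membership of \<open>f\<close> in \<open>M\<close> is decided by the
    remaining coefficient of \<open>?e j\<close>.\<close>
  have decomp: "f = (\<Sum>i\<in>{..<n} - {j}. vmul (f i) (?e i - vmul (fps_const (c i)) (?e j))) + vmul (f j + F f) (?e j)"
    if "f \<in> P" for f
  proof -
    have 1: "f = vmul (f j) (?e j) + (\<Sum>i\<in>{..<n} - {j}. vmul (f i) (?e i))"
      using expand[OF that] j(1) by (subst (asm) sum.remove[of _ j]) auto
    have 2: "(\<Sum>i\<in>{..<n} - {j}. vmul (f i) (?e i - vmul (fps_const (c i)) (?e j))) =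
        (\<Sum>i\<in>{..<n} - {j}. vmul (f i) (?e i)) - vmul (F f) (?e j)"
      unfolding F_def sum_vmul by (simp add: vmul_simps sum_subtractf mult.commute)
    show ?thesis unfolding 2 vmul_simps(3) using 1 by (simp add: add.commute)
  qed
  have in_M: "f \<in> M \<longleftrightarrow> vmul (f j + F f) (?e j) \<in> M" if "f \<in> P" for f
  proof -
    have S: "(\<Sum>i\<in>{..<n} - {j}. vmul (f i) (?e i - vmul (fps_const (c i)) (?e j))) \<in> M"
      using c aM(3) by (intro add_subgrp_sum[OF aM(1)]) auto
    show ?thesis
      using arg_cong[OF decomp[OF that], of "\<lambda>z. z \<in> M"] unfolding add_subgrp_add_iff[OF aM(1) S] .
  qed
  \<comment> \<open>A series not divisible by \<open>X\<close> is a unit and would bring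
    \<open>?e j\<close> into \<open>M\<close>.\<close>
  have dvd: "vmul g (?e j) \<in> M \<longleftrightarrow> fps_X dvd g" for g
  proof
    assume "fps_X dvd g"
    then obtain h where "vmul g (?e j) = vmul fps_X (vmul h (?e j))" by (auto simp: vmul_simps)
    moreover have "vmul h (?e j) \<in> P" by (rule vmul_vecs[OF eP[OF j(1)]])
    ultimately show "vmul g (?e j) \<in> M" using aM(4) by (metis image_subset_iff)
  next
    assume g: "vmul g (?e j) \<in> M"
    show "fps_X dvd g"
    proof (rule ccontr)
      assume "\<not> fps_X dvd g"
      then have "inverse g * g = 1" by (intro inverse_mult_eq_1) (simp add: fps_X_dvd_iff)
      then have "vmul (inverse g) (vmul g (?e j)) = ?e j" by (simp add: vmul_simps)
      then show False using aM(3)[OF g, of "inverse g"] j(2) by simp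
    qed
  qed
  have \<phi>P: "\<phi> f \<in> P" if "f \<in> P" for f using that j(1) by (auto simp: \<phi>_def vecs_def)
  have "\<phi> ` P = M"
  proof
    show "\<phi> ` P \<subseteq> M"
    proof
      fix g assume "g \<in> \<phi> ` P"
      then obtain f where f: "f \<in> P" "g = \<phi> f" by blast
      have "g j + F g = fps_X * f j" by (simp add: f(2) \<phi>_def F_upd)
      then show "g \<in> M" using in_M[OF \<phi>P[OF f(1)]] dvd f(2) by simp
    qed
    show "M \<subseteq> \<phi> ` P"
    proof
      fix g assume g: "g \<in> M"
      then have gP: "g \<in> P" using aM(2) by blast
      then obtain y where y: "g j + F g = fps_X * y" using in_M[OF gP] dvd g by blast
      have "\<phi> (g(j := y)) = g" by (rule ext) (simp add: \<phi>_def F_upd flip: y)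
      moreover have "g(j := y) \<in> P" using gP j(1) by (auto simp: vecs_def)
      ultimately show "g \<in> \<phi> ` P" by (intro image_eqI[of _ \<phi> "g(j := y)"]) simp_all
    qed
  qed
  moreover have "inj_on \<phi> P"
  proof (rule inj_onI)
    fix f g assume "f \<in> P" "g \<in> P" and eq: "\<phi> f = \<phi> g"
    have ne: "f i = g i" if "i \<noteq> j" for i using fun_cong[OF eq, of i] that by (simp add: \<phi>_def)
    then have "F f = F g" unfolding F_def by (intro sum.cong) auto
    then have "f j = g j" using fun_cong[OF eq, of j] by (simp add: \<phi>_def)
    then have "f i = g i" for i using ne by (cases "i = j") auto
    then show "f = g" by (rule ext)
  qed
  moreover have "\<phi> (x - y) = \<phi> x - \<phi> y" for x y
    by (rule ext) (simp add: \<phi>_def F_diff algebra_simps)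
  moreover have "\<phi> (vmul r f) = vmul r (\<phi> f)" for r f
  proof (rule ext)
    fix k show "\<phi> (vmul r f) k = vmul r (\<phi> f) k"
      unfolding \<phi>_def F_vmul unfolding vmul_def by (simp add: right_diff_distrib mult.left_commute)
  qed
  ultimately show ?thesis by (intro that)
qed

text \<open>Induction on the codimension: if \<open>M\<close> is a hyperplane in \<open>M'\<close>
  and \<open>\<phi>\<close> identifies \<open>P\<close> with \<open>M'\<close>, then the preimage
  \<open>M0\<close> of \<open>M\<close> is a hyperplane in \<open>P\<close>. It contains
  \<open>X P\<close> since \<open>\<phi>\<close> commutes with \<open>X\<close>, so the hyperplane
  case applies to it, and the two maps compose.\<close>

lemma umods_image:
  fixes M :: "(nat \<Rightarrow> 'f fps) set"
  assumes "M \<in> umods n"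
  shows "\<exists>\<phi>. (\<forall>x y. \<phi> (x - y) = \<phi> x - \<phi> y) \<and> (\<forall>r f. \<phi> (vmul r f) = vmul r (\<phi> f)) \<and>
    inj_on \<phi> P \<and> \<phi> ` P = M"
  using assms
proof (induction "codim n M" arbitrary: M)
  case 0
  then have "idx M P = 1" using idx_umods(1)[OF 0(2)] by simp
  then have "M = P"
    using idx_eq_1_iff[of M P] 0(2) aP by (auto simp: umods_def vsub_def)
  then show ?case by (intro exI[of _ "\<lambda>x. x"]) auto
next
  case (Suc d)
  have aM: "add_subgrp M" "M \<subseteq> P" "\<And>r f. f \<in> M \<Longrightarrow> vmul r f \<in> M" "F.XP \<subseteq> M"
    using Suc.prems by (auto simp: umods_def vsub_def)
  have kM: "F.ksub M" using aM by (auto simp: F.ksub_def)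
  have idxM: "idx M P = CARD('f) ^ Suc d" using idx_umods(1)[OF Suc.prems] Suc(2) by simp
  have "1 < CARD('f) ^ Suc d" using F.q_ge_2 by (intro one_less_power) auto
  then have "M \<noteq> P" using idxM idx_self[OF aP] by auto
  then obtain v where v: "v \<in> P" "v \<notin> M" using aM(2) by blast
  define M' where "M' = ssum M (F.line v)"
  note b = F.ssum_line_between[OF kM F.ksub_P aM(2) v(1), folded M'_def]
  note i = F.idx_ssum_line_tower[OF kM F.ksub_P aM(2) idx_umods(3)[OF Suc.prems] v, folded M'_def]
  note i' = F.idx_ssum_line[OF kM v(2), folded M'_def]
  have M': "M' \<in> umods n" unfolding umods_eq F.kbetween_def using b aM(4) by blast
  have "idx M' P = CARD('f) ^ d" using i(1) idxM F.q_ge_2 by simp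
  then have "d = codim n M'" using codim_eqI by simp
  from Suc.hyps(1)[OF this M'] obtain \<phi> where \<phi>: "\<And>x y. \<phi> (x - y) = \<phi> x - \<phi> y"
    "\<And>r f. \<phi> (vmul r f) = vmul r (\<phi> f)" "inj_on \<phi> P" "\<phi> ` P = M'" by blast
  define M0 where "M0 = {p \<in> P. \<phi> p \<in> M}"
  have \<phi>0: "\<phi> 0 = 0" using \<phi>(1)[of 0 0] by simp
  have aM0: "add_subgrp M0"
    using add_subgrp_0[OF aM(1)] add_subgrp_diff[OF aM(1)] add_subgrp_0[OF aP]
      add_subgrp_diff[OF aP]
    by (intro add_subgrpI) (auto simp: M0_def \<phi>0 \<phi>(1))
  have "M0 \<in> umods n"
  proof -
    have "vmul fps_X p \<in> M0" if "p \<in> P" for p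
    proof -
      have "\<phi> p \<in> P" using \<phi>(4) b(2) that by blast
      then have "\<phi> (vmul fps_X p) \<in> M" using aM(4) unfolding \<phi>(2) by blast
      then show ?thesis using vmul_vecs[OF that] by (simp add: M0_def)
    qed
    then show ?thesis using aM0 aM(3) vmul_vecs by (auto simp: umods_def vsub_def M0_def \<phi>(2))
  qed
  have im: "\<phi> ` M0 = M" 
  proof
    show "M \<subseteq> \<phi> ` M0"
    proof
      fix x assume x: "x \<in> M"
      then have "x \<in> \<phi> ` P" unfolding \<phi>(4) using b(3) by blast
      then show "x \<in> \<phi> ` M0" using x by (auto simp: M0_def)
    qed
  qed (auto simp: M0_def)
  have "M0 \<subseteq> P" by (auto simp: M0_def)
  then have "idx (\<phi> ` M0) (\<phi> ` P) = idx M0 P"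
    by (rule cosets_inj_image(1)[OF aM0 aP _ \<phi>(1) \<phi>(3)])
  then have "idx M0 P = CARD('f)" unfolding im \<phi>(4) using i'(1) by simp
  then obtain \<psi> where \<psi>: "\<And>x y. \<psi> (x - y) = \<psi> x - \<psi> y"
    "\<And>r f. \<psi> (vmul r f) = vmul r (\<psi> f)" "inj_on \<psi> P" "\<psi> ` P = M0"
    using umods_hyperplane_image[OF \<open>M0 \<in> umods n\<close>] by blast
  have "inj_on (\<phi> \<circ> \<psi>) P"
    using \<psi>(3,4) inj_on_subset[OF \<phi>(3) \<open>M0 \<subseteq> P\<close>] by (intro comp_inj_on) auto
  moreover have "(\<phi> \<circ> \<psi>) ` P = M" unfolding image_comp[symmetric] \<psi>(4) im ..
  ultimately show ?case using \<phi> \<psi> by (intro exI[of _ "\<phi> \<circ> \<psi>"]) auto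
qed

end

section \<open>Quadratic orders\<close>

definition coeffs_in :: "'b::zero set \<Rightarrow> 'b fps set" where
  "coeffs_in K = {a. \<forall>i. a $ i \<in> K}"

text \<open>An order \<open>B + x\<^sup>m S\<close> in a ring \<open>S\<close> that is free over \<open>B \<cong> K[[x]]\<close> with basis \<open>1, \<beta>\<close>.\<close>

locale quadratic_order =
  fixes \<iota> :: "'b::field fps \<Rightarrow> 'c::comm_ring_1" and K :: "'b set" and \<beta> :: 'c
    and u v :: "'b fps" and m :: nat
  assumes finite_K: "finite K" and add_subgrp_K: "add_subgrp K" and one_K: "1 \<in> K"
    and mult_K: "a \<in> K \<Longrightarrow> b \<in> K \<Longrightarrow> a * b \<in> K"
    and inverse_K: "a \<in> K \<Longrightarrow> inverse a \<in> K"
    and \<iota>_add: "\<iota> (f + g) = \<iota> f + \<iota> g" and \<iota>_mult: "\<iota> (f * g) = \<iota> f * \<iota> g" and \<iota>_1: "\<iota> 1 = 1"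
    and \<beta>_square: "\<beta> * \<beta> = \<iota> u * \<beta> + \<iota> v"
    and u_B: "u \<in> coeffs_in K" and v_B: "v \<in> coeffs_in K"
    and basis: "\<exists>f\<in>coeffs_in K. \<exists>g\<in>coeffs_in K. s = \<iota> f + \<iota> g * \<beta>"
    and independent: "f \<in> coeffs_in K \<Longrightarrow> g \<in> coeffs_in K \<Longrightarrow> \<iota> f + \<iota> g * \<beta> = 0 \<Longrightarrow> f = 0 \<and> g = 0"
    and m_pos: "m \<ge> 1"
begin

abbreviation "B \<equiv> coeffs_in K"

definition x :: 'c where "x = \<iota> fps_X"

text \<open>This is \<open>B + x^m S\<close>, since the part of \<open>x^m S\<close> along 1 already
  lies in \<open>B\<close>.\<close>

definition R0 :: "'c set" where "R0 = {\<iota> f + x ^ m * (\<iota> g * \<beta>) | f g. f \<in> B \<and> g \<in> B}"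

lemma add_subgrp_B: "add_subgrp B"
  using add_subgrp_0[OF add_subgrp_K] add_subgrp_diff[OF add_subgrp_K]
  by (intro add_subgrpI) (auto simp: coeffs_in_def)

lemma zero_K: "0 \<in> K" by (rule add_subgrp_0[OF add_subgrp_K])

lemma B_mult: "f \<in> B \<Longrightarrow> g \<in> B \<Longrightarrow> f * g \<in> B"
  using mult_K by (auto simp: coeffs_in_def fps_mult_nth intro!: add_subgrp_sum[OF add_subgrp_K])

lemma const_B: "c \<in> K \<Longrightarrow> fps_const c \<in> B"
  using zero_K by (auto simp: coeffs_in_def)

lemma X_power_B: "fps_X ^ k \<in> B"
  using zero_K one_K by (auto simp: coeffs_in_def fps_X_power_nth)

lemma \<iota>_0: "\<iota> 0 = 0" using \<iota>_add[of 0 0] by simp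

lemma \<iota>_diff: "\<iota> (f - g) = \<iota> f - \<iota> g"
  using \<iota>_add[of "f - g" g] by (simp add: algebra_simps)

lemma \<iota>_power: "\<iota> (f ^ k) = \<iota> f ^ k"
  by (induction k) (simp_all add: \<iota>_1 \<iota>_mult)

lemma \<iota>_sum: "\<iota> (sum f A) = (\<Sum>i\<in>A. \<iota> (f i))"
  by (induction A rule: infinite_finite_induct) (simp_all add: \<iota>_0 \<iota>_add)

lemma coords_unique:
  assumes "f \<in> B" "g \<in> B" "f' \<in> B" "g' \<in> B" "\<iota> f + \<iota> g * \<beta> = \<iota> f' + \<iota> g' * \<beta>"
  shows "f = f' \<and> g = g'"
proof -
  have "\<iota> (f - f') + \<iota> (g - g') * \<beta> = 0" using assms(5) by (simp add: \<iota>_diff algebra_simps)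
  then show ?thesis
    using independent[of "f - f'" "g - g'"] assms add_subgrp_diff[OF add_subgrp_B] by simp
qed

definition coord1 :: "'c \<Rightarrow> 'b fps" where
  "coord1 s = (SOME f. f \<in> B \<and> (\<exists>g\<in>B. s = \<iota> f + \<iota> g * \<beta>))"

definition coord2 :: "'c \<Rightarrow> 'b fps" where
  "coord2 s = (SOME g. g \<in> B \<and> s = \<iota> (coord1 s) + \<iota> g * \<beta>)"

lemma coords: "coord1 s \<in> B" "coord2 s \<in> B" "\<iota> (coord1 s) + \<iota> (coord2 s) * \<beta> = s"
proof -
  have 1: "coord1 s \<in> B \<and> (\<exists>g\<in>B. s = \<iota> (coord1 s) + \<iota> g * \<beta>)"
    unfolding coord1_def using basis[of s] by (intro someI_ex[of "\<lambda>f. f \<in> B \<and> (\<exists>g\<in>B. s = \<iota> f + \<iota> g * \<beta>)"]) blast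
  then have "\<exists>g. g \<in> B \<and> s = \<iota> (coord1 s) + \<iota> g * \<beta>" by blast
  then have "coord2 s \<in> B \<and> s = \<iota> (coord1 s) + \<iota> (coord2 s) * \<beta>"
    unfolding coord2_def by (rule someI_ex)
  then show "coord1 s \<in> B" "coord2 s \<in> B" "\<iota> (coord1 s) + \<iota> (coord2 s) * \<beta> = s" using 1 by auto
qed

lemma coords_eqI:
  assumes "f \<in> B" "g \<in> B"
  shows "coord1 (\<iota> f + \<iota> g * \<beta>) = f" "coord2 (\<iota> f + \<iota> g * \<beta>) = g"
  using coords_unique[OF coords(1,2) assms coords(3)] by auto

lemma coords_diff: "coord1 (s - t) = coord1 s - coord1 t" "coord2 (s - t) = coord2 s - coord2 t"
proof -
  have "s - t = \<iota> (coord1 s - coord1 t) + \<iota> (coord2 s - coord2 t) * \<beta>"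
    using coords(3)[of s] coords(3)[of t] by (simp add: \<iota>_diff algebra_simps)
  then show "coord1 (s - t) = coord1 s - coord1 t" "coord2 (s - t) = coord2 s - coord2 t"
    using coords_eqI[of "coord1 s - coord1 t" "coord2 s - coord2 t"] coords
      add_subgrp_diff[OF add_subgrp_B] by auto
qed

lemma coords_x_mult: "coord1 (x * s) = fps_X * coord1 s" "coord2 (x * s) = fps_X * coord2 s"
proof -
  have "x * s = \<iota> (fps_X * coord1 s) + \<iota> (fps_X * coord2 s) * \<beta>"
    by (subst coords(3)[of s, symmetric]) (simp add: x_def \<iota>_mult algebra_simps)
  then show "coord1 (x * s) = fps_X * coord1 s" "coord2 (x * s) = fps_X * coord2 s"
    using coords_eqI[of "fps_X * coord1 s" "fps_X * coord2 s"] coords(1,2)[of s] B_mult X_power_B[of 1]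
    by auto
qed

lemma x_nonzero_divisor: "x * s = x * t \<longleftrightarrow> s = t"
proof
  assume "x * s = x * t"
  then have "coord1 s = coord1 t" "coord2 s = coord2 t"
    using coords_x_mult[of s] coords_x_mult[of t] by auto
  then show "s = t" using coords(3)[of s] coords(3)[of t] by metis
qed simp

lemma \<iota>_in_R0: "f \<in> B \<Longrightarrow> \<iota> f \<in> R0"
  using add_subgrp_0[OF add_subgrp_B] unfolding R0_def by (force simp: \<iota>_0)

text \<open>The order contains the ideal \<open>x^m S\<close> of \<open>S\<close>. This makes
  \<open>x^m\<close> a common denominator for \<open>S\<close>, and it links modules over the order
  with modules over \<open>S\<close>.\<close>

lemma x_power_mult_in_R0: "x ^ m * s \<in> R0"
proof -
  have "x ^ m * s = \<iota> (fps_X ^ m * coord1 s) + x ^ m * (\<iota> (coord2 s) * \<beta>)"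
    by (subst coords(3)[of s, symmetric]) (simp add: x_def \<iota>_mult \<iota>_power algebra_simps)
  then show ?thesis unfolding R0_def using coords B_mult X_power_B by blast
qed

lemma fps_truncate: "f = (\<Sum>i<k. fps_const (f $ i) * fps_X ^ i) + fps_X ^ k * fps_shift k f"
  for f :: "'a::comm_ring_1 fps"
proof (rule fps_ext)
  fix j
  have "(\<Sum>i<k. fps_const (f $ i) * fps_X ^ i) $ j = (\<Sum>i<k. if i = j then f $ j else 0)"
    unfolding fps_sum_nth by (intro sum.cong) (auto simp: fps_X_power_nth)
  then show "f $ j = ((\<Sum>i<k. fps_const (f $ i) * fps_X ^ i) + fps_X ^ k * fps_shift k f) $ j"
    by (auto simp: fps_X_power_mult_nth)
qed

text \<open>Modulo \<open>x^m S\<close> only a polynomial in \<open>x\<close> over \<open>K\<close>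
  remains. Hence a group that contains \<open>x^m P\<close> is an \<open>R0\<close>-module as soon
  as it is stable under \<open>K\<close> and \<open>x\<close>.\<close>

lemma R0_decompose:
  assumes "r \<in> R0"
  shows "\<exists>c s. (\<forall>i. c i \<in> K) \<and> r = (\<Sum>i<m. \<iota> (fps_const (c i)) * x ^ i) + x ^ m * s"
proof -
  obtain f g where fg: "f \<in> B" "r = \<iota> f + x ^ m * (\<iota> g * \<beta>)" using assms by (auto simp: R0_def)
  have "\<iota> f = (\<Sum>i<m. \<iota> (fps_const (f $ i)) * x ^ i) + x ^ m * \<iota> (fps_shift m f)"
    by (subst fps_truncate[of f m]) (simp only: \<iota>_add \<iota>_mult \<iota>_sum \<iota>_power x_def)
  then have "r = (\<Sum>i<m. \<iota> (fps_const (f $ i)) * x ^ i) + x ^ m * (\<iota> (fps_shift m f) + \<iota> g * \<beta>)"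
    using fg by (simp add: algebra_simps)
  moreover have "\<forall>i. f $ i \<in> K" using fg by (simp add: coeffs_in_def)
  ultimately show ?thesis by blast
qed

text \<open>The geometric series in \<open>x^e\<close> has coefficients 0 and 1, so the inverse lies
  in the order and not merely in \<open>S\<close>; this matters because \<open>L\<close> is only an
  \<open>R0\<close>-module.\<close>

lemma one_minus_x_power_unit:
  assumes "e > 0" shows "\<exists>r\<in>R0. r * (1 - x ^ e) = 1"
proof -
  define g :: "'b fps" where "g = Abs_fps (\<lambda>i. if e dvd i then 1 else 0)"
  have "g * (1 - fps_X ^ e) = 1"
  proof (rule fps_ext)
    fix i
    have "(g * (1 - fps_X ^ e)) $ i = g $ i - (if i < e then 0 else g $ (i - e))"
      by (simp add: right_diff_distrib fps_X_power_mult_right_nth)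
    also have "\<dots> = 1 $ i"
    proof (cases "i < e")
      case True
      then show ?thesis using assms by (auto simp: g_def dest: dvd_imp_le)
    next
      case False
      then have "e dvd i \<longleftrightarrow> e dvd (i - e)" using dvd_minus_self by auto
      then show ?thesis using False assms by (simp add: g_def)
    qed
    finally show "(g * (1 - fps_X ^ e)) $ i = 1 $ i" .
  qed
  then have "\<iota> g * (1 - x ^ e) = 1" using \<iota>_1 by (metis \<iota>_mult \<iota>_diff \<iota>_power x_def)
  moreover have "g \<in> B" using zero_K one_K by (auto simp: coeffs_in_def g_def)
  ultimately show ?thesis using \<iota>_in_R0 by blast
qed

definition rsub :: "nat \<Rightarrow> (nat \<Rightarrow> 'c) set \<Rightarrow> bool" where
  "rsub n L \<longleftrightarrow> add_subgrp L \<and> L \<subseteq> vecs n \<and> (\<forall>r\<in>R0. \<forall>f\<in>L. vmul r f \<in> L)"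

lemma lattice: "lattice_count (\<lambda>c. vmul (\<iota> (fps_const c))) K (vecs n) (vmul x) (2 * n)"
proof -
  interpret V: vector_space "\<lambda>c. vmul (\<iota> (fps_const c))"
    by unfold_locales (simp_all add: vmul_simps \<iota>_1 \<iota>_add \<iota>_mult flip: fps_const_add fps_const_mult)
  interpret S: finite_scalars "\<lambda>c. vmul (\<iota> (fps_const c))" K
    using finite_K add_subgrp_K one_K mult_K inverse_K by unfold_locales auto
  \<comment> \<open>The residue of \<open>s\<close> modulo \<open>x\<close> is the pair of constant
    terms of its two coordinates, coded as a function on \<open>bool\<close>. There are
    \<open>card K ^ 2\<close> residues, whence the rank \<open>2 * n\<close>.\<close>
  define \<pi> :: "'c \<Rightarrow> bool \<Rightarrow> 'b" where "\<pi> s i = (if i then coord1 s $ 0 else coord2 s $ 0)" for s i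
  have diff: "\<pi> (s - t) = \<pi> s - \<pi> t" for s t by (simp add: \<pi>_def fun_eq_iff coords_diff)
  have "bij_betw (\<lambda>h. (h True, h False)) (range \<pi>) (K \<times> K)"
    unfolding bij_betw_def
  proof
    show "inj_on (\<lambda>h. (h True, h False)) (range \<pi>)"
      by (auto intro!: inj_onI simp: fun_eq_iff all_bool_eq)
    show "(\<lambda>h. (h True, h False)) ` range \<pi> = K \<times> K"
    proof
      show "(\<lambda>h. (h True, h False)) ` range \<pi> \<subseteq> K \<times> K"
        using coords(1,2) by (auto simp: \<pi>_def coeffs_in_def)
      show "K \<times> K \<subseteq> (\<lambda>h. (h True, h False)) ` range \<pi>"
      proof safe
        fix a b assume "a \<in> K" "b \<in> K"
        then have "\<pi> (\<iota> (fps_const a) + \<iota> (fps_const b) * \<beta>) = (\<lambda>i. if i then a else b)"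
          using coords_eqI[OF const_B const_B, of a b] by (simp add: \<pi>_def fun_eq_iff)
        then show "(a, b) \<in> (\<lambda>h. (h True, h False)) ` range \<pi>"
          by (intro image_eqI[of _ _ "\<lambda>i. if i then a else b"]) (auto intro: range_eqI[OF sym])
      qed
    qed
  qed
  then have card: "card (range \<pi>) = card K ^ 2" "finite (range \<pi>)"
    using finite_K by (auto simp: bij_betw_same_card card_cartesian_product power2_eq_square bij_betw_finite)
  have ker: "\<pi> s = 0 \<longleftrightarrow> x dvd s" for s
  proof
    assume "\<pi> s = 0"
    then have "\<pi> s True = 0" "\<pi> s False = 0" by simp_all
    then have "coord1 s $ 0 = 0" "coord2 s $ 0 = 0" by (simp_all add: \<pi>_def)
    then obtain f g where "coord1 s = fps_X * f" "coord2 s = fps_X * g"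
      unfolding fps_X_dvd_iff[symmetric] by blast
    then have "s = x * (\<iota> f + \<iota> g * \<beta>)"
      using coords(3)[of s] by (simp add: x_def \<iota>_mult algebra_simps)
    then show "x dvd s" by simp
  qed (auto simp: \<pi>_def fun_eq_iff coords_x_mult)
  have i: "idx (vmul x ` vecs n) (vecs n) = card K ^ (2 * n)" "finite (cosets (vmul x ` vecs n) (vecs n))"
    using idx_vmul_vecs[of \<pi> x n, OF diff card(2) ker] card(1) by (simp_all add: power_mult)
  have k: "S.ksub (vecs n)" by (auto simp: S.ksub_def add_subgrp_vecs vmul_vecs)
  have inj: "inj_on (vmul x) (vecs n)"
    by (auto simp: inj_on_def vmul_def fun_eq_iff x_nonzero_divisor)
  show ?thesis
    using k i inj by unfold_locales (simp_all add: vmul_simps mult.commute vmul_vecs)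
qed

lemma vmul_x_power_image: "(vmul x ^^ k) ` A = vmul (x ^ k) ` A"
  by (simp add: funpow_vmul)

text \<open>The Moebius hypothesis now speaks of modules \<open>W\<close> over all of
  \<open>S\<close>, the form that Nakayama over power series rings can deliver; the passage from
  \<open>L\<close> to such a \<open>W\<close> is made here.\<close>

lemma zeta_identity_order:
  fixes M :: "'i \<Rightarrow> (nat \<Rightarrow> 'c) set" and \<mu> :: "'i \<Rightarrow> rat"
    and \<phi> :: "'i \<Rightarrow> (nat \<Rightarrow> 'c) \<Rightarrow> nat \<Rightarrow> 'c" and d :: "'i \<Rightarrow> nat" and Z :: "rat dirichlet"
  assumes I: "finite I"
    and M: "\<And>i. i \<in> I \<Longrightarrow> vsub n (M i)" "\<And>i. i \<in> I \<Longrightarrow> vmul x ` vecs n \<subseteq> M i"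
      "\<And>i. i \<in> I \<Longrightarrow> idx (M i) (vecs n) = card K ^ d i"
    and \<phi>: "\<And>i f g. i \<in> I \<Longrightarrow> \<phi> i (f - g) = \<phi> i f - \<phi> i g"
      "\<And>i r f. i \<in> I \<Longrightarrow> \<phi> i (vmul r f) = vmul r (\<phi> i f)"
      "\<And>i. i \<in> I \<Longrightarrow> inj_on (\<phi> i) (vecs n)" "\<And>i. i \<in> I \<Longrightarrow> \<phi> i ` vecs n = M i"
    and moebius: "\<And>L W. vsub n W \<Longrightarrow> finite (cosets W (vecs n)) \<Longrightarrow> L \<subseteq> W \<Longrightarrow> W \<noteq> vecs n \<Longrightarrow>
      (\<Sum>i | i \<in> I \<and> L \<subseteq> M i. \<mu> i) = 0"
    and Z: "\<And>k. k > 0 \<Longrightarrow>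
      dir_nth Z k = of_nat (card {L. rsub n L \<and> finite (cosets L (vecs n)) \<and> idx L (vecs n) = k})"
  shows "finite {L. rsub n L \<and> finite (cosets L (vecs n)) \<and> idx L (vecs n) = k}"
    and "(\<Sum>i\<in>I. dconst (\<mu> i) * dir_monom 1 (card K) ^ d i) * Z =
      (\<Sum>i\<in>I. dconst (\<mu> i) * (\<Sum>s\<in>int_lists (2 * n) m.
        dconst (Gq (replicate (m - 1) (int (2 * n)) @ [int (2 * n - d i)]) s (of_nat (card K)))
          * dir_monom 1 (card K) ^ nat (int m * int (2 * n) - sum_list s)))"
proof -
  interpret L: lattice_count "\<lambda>c. vmul (\<iota> (fps_const c))" K "vecs n" "vmul x" "2 * n" by (rule lattice)
  have aP: "add_subgrp (vecs n :: (nat \<Rightarrow> 'c) set)" by (rule add_subgrp_vecs)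
  have \<epsilon>: "\<iota> (fps_const c) \<in> R0" if "c \<in> K" for c using \<iota>_in_R0 const_B that by blast
  have x: "x \<in> R0" using \<iota>_in_R0 X_power_B[of 1] by (simp add: x_def)
  have 1: "L.xsub L" if "rsub n L" for L
    using that \<epsilon> x by (auto simp: L.xsub_def L.ksub_def rsub_def)
  have 2: "rsub n L" if "L \<in> L.lat m" for L
  proof -
    have L: "add_subgrp L" "L \<subseteq> vecs n" "\<And>c f. c \<in> K \<Longrightarrow> f \<in> L \<Longrightarrow> vmul (\<iota> (fps_const c)) f \<in> L"
      "\<And>f. f \<in> L \<Longrightarrow> vmul x f \<in> L" "\<And>f. f \<in> vecs n \<Longrightarrow> vmul (x ^ m) f \<in> L"
      using that unfolding L.lat_def L.xsub_def L.ksub_def vmul_x_power_image by blast+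
    have xi: "vmul (x ^ i) f \<in> L" if "f \<in> L" for i f
      using that by (induction i) (simp_all add: vmul_simps L(4) flip: vmul_simps(5))
    have "vmul r f \<in> L" if r: "r \<in> R0" and f: "f \<in> L" for r f
    proof -
      obtain c s where c: "\<And>i. c i \<in> K" "r = (\<Sum>i<m. \<iota> (fps_const (c i)) * x ^ i) + x ^ m * s"
        using R0_decompose[OF r] by blast
      have "vmul r f = (\<Sum>i<m. vmul (\<iota> (fps_const (c i))) (vmul (x ^ i) f)) + vmul (x ^ m) (vmul s f)"
        unfolding c(2) vmul_simps(3) sum_vmul by (simp only: vmul_simps(5))
      moreover have "(\<Sum>i<m. vmul (\<iota> (fps_const (c i))) (vmul (x ^ i) f)) \<in> L"
        using L(3)[OF c(1)] xi[OF f] by (intro add_subgrp_sum[OF L(1)]) auto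
      moreover have "vmul (x ^ m) (vmul s f) \<in> L" using L(2,5) f vmul_vecs by blast
      ultimately show ?thesis using add_subgrp_add[OF L(1)] by simp
    qed
    then show ?thesis using L by (simp add: rsub_def)
  qed
  have 3: "p \<in> L" if L: "rsub n L" and e: "e > 0" and p: "p - (vmul x ^^ e) p \<in> L" for L p e
  proof -
    obtain r where r: "r \<in> R0" "r * (1 - x ^ e) = 1" using one_minus_x_power_unit[OF e] by blast
    have "p - (vmul x ^^ e) p = vmul (1 - x ^ e) p" by (simp add: funpow_vmul vmul_simps)
    then have "vmul r (vmul (1 - x ^ e) p) \<in> L" using L p r(1) by (auto simp: rsub_def)
    then show ?thesis using r(2) by (simp only: vmul_simps(5,6))
  qed
  have 4: "M i \<in> L.kbetween L.XP (vecs n)" if "i \<in> I" for i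
    using M(1,2)[OF that] by (auto simp: L.kbetween_def vsub_def L.ksub_def)
  have 5: "rsub n (\<phi> i ` L) \<longleftrightarrow> rsub n L" if i: "i \<in> I" and L: "L \<subseteq> vecs n" for i L
  proof -
    have mem: "\<phi> i f \<in> \<phi> i ` L \<longleftrightarrow> f \<in> L" if "f \<in> vecs n" for f
      by (rule inj_on_image_mem_iff[OF \<phi>(3)[OF i] that L])
    have \<phi>0: "\<phi> i 0 = 0" using \<phi>(1)[OF i, of 0 0] by simp
    have "\<phi> i ` L \<subseteq> vecs n" using M(1)[OF i] \<phi>(4)[OF i] L unfolding vsub_def by blast
    moreover have "add_subgrp (\<phi> i ` L) \<longleftrightarrow> add_subgrp L"
    proof
      assume "add_subgrp L"
      then show "add_subgrp (\<phi> i ` L)"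
        by (rule cosets_inj_image(3)[OF _ add_subgrp_vecs L \<phi>(1)[OF i] \<phi>(3)[OF i]])
    next
      assume a: "add_subgrp (\<phi> i ` L)"
      show "add_subgrp L"
      proof (rule add_subgrpI)
        show "0 \<in> L" using mem[of 0] add_subgrp_0[OF a] add_subgrp_0[OF aP] \<phi>0 by simp
        fix f g assume fg: "f \<in> L" "g \<in> L"
        then have "\<phi> i (f - g) \<in> \<phi> i ` L" unfolding \<phi>(1)[OF i] by (intro add_subgrp_diff[OF a]) auto
        moreover have "f - g \<in> vecs n" using fg L add_subgrp_diff[OF aP] by blast
        ultimately show "f - g \<in> L" using mem by blast
      qed
    qed
    moreover have "(\<forall>f\<in>\<phi> i ` L. vmul r f \<in> \<phi> i ` L) \<longleftrightarrow> (\<forall>f\<in>L. vmul r f \<in> L)" for r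
    proof -
      have "vmul r (\<phi> i f) \<in> \<phi> i ` L \<longleftrightarrow> vmul r f \<in> L" if "f \<in> L" for f
        using mem[of "vmul r f"] that L vmul_vecs[of f n r] by (auto simp: \<phi>(2)[OF i, symmetric])
      then show ?thesis by blast
    qed
    ultimately show ?thesis using L by (simp add: rsub_def)
  qed
  have 6: "(\<Sum>i | i \<in> I \<and> L \<subseteq> M i. \<mu> i) = 0"
    if L: "rsub n L" "finite (cosets L (vecs n))" and nle: "\<not> (vmul x ^^ m) ` vecs n \<subseteq> L" for L
  proof -
    have aL: "add_subgrp L" "L \<subseteq> vecs n" "\<And>r f. r \<in> R0 \<Longrightarrow> f \<in> L \<Longrightarrow> vmul r f \<in> L"
      using L by (auto simp: rsub_def)
    \<comment> \<open>The largest \<open>S\<close>-module with \<open>x^m W \<subseteq> L\<close>.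
      It contains \<open>L\<close> because \<open>x^m S\<close> lies in \<open>R0\<close>, and it is
      proper because \<open>x^m P\<close> is not contained in \<open>L\<close>.\<close>
    define W where "W = {p \<in> vecs n. \<forall>s. vmul (x ^ m * s) p \<in> L}"
    have "add_subgrp W"
      using add_subgrp_0[OF aL(1)] add_subgrp_diff[OF aL(1)] add_subgrp_0[OF aP] add_subgrp_diff[OF aP]
      by (intro add_subgrpI) (simp_all add: W_def vmul_simps)
    moreover have "vmul r f \<in> W" if "f \<in> W" for r f
      using that vmul_vecs by (auto simp: W_def vmul_simps mult.assoc)
    ultimately have W: "vsub n W" by (auto simp: vsub_def W_def)
    have LW: "L \<subseteq> W" using aL x_power_mult_in_R0 by (auto simp: W_def)
    have "finite (cosets W (vecs n))"
      using cosets_tower(1)[OF aL(1) _ aP LW] W L(2) by (auto simp: vsub_def)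
    moreover have "W \<noteq> vecs n"
    proof
      assume eq: "W = vecs n"
      have "vmul (x ^ m) p \<in> L" if "p \<in> vecs n" for p
      proof -
        have "p \<in> W" using that eq by simp
        then have "vmul (x ^ m * 1) p \<in> L" unfolding W_def by blast
        then show ?thesis by simp
      qed
      then show False using nle by (auto simp: funpow_vmul)
    qed
    ultimately show ?thesis using moebius[OF W _ LW] by blast
  qed
  show "finite {L. rsub n L \<and> finite (cosets L (vecs n)) \<and> idx L (vecs n) = k}"
    by (rule L.zeta_identity(1)[where rsub = "rsub n" and I = I and M = M and d = d and \<mu> = \<mu> and \<phi> = \<phi>
          and m = m and Z = Z, OF 1 2 3 I 4 M(3) \<phi>(1,3,4) 5 6 m_pos Z])
  show "(\<Sum>i\<in>I. dconst (\<mu> i) * dir_monom 1 (card K) ^ d i) * Z =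
      (\<Sum>i\<in>I. dconst (\<mu> i) * (\<Sum>s\<in>int_lists (2 * n) m.
        dconst (Gq (replicate (m - 1) (int (2 * n)) @ [int (2 * n - d i)]) s (of_nat (card K)))
          * dir_monom 1 (card K) ^ nat (int m * int (2 * n) - sum_list s)))"
    by (rule L.zeta_identity(2)[where rsub = "rsub n" and I = I and M = M and d = d and \<mu> = \<mu> and \<phi> = \<phi>
          and m = m and Z = Z, OF 1 2 3 I 4 M(3) \<phi>(1,3,4) 5 6 m_pos Z])
qed

end

section \<open>Orders and their normalization\<close>

definition non_zero_divisor :: "'c::comm_ring_1 \<Rightarrow> bool" where
  "non_zero_divisor w \<longleftrightarrow> (\<forall>s. s * w = 0 \<longrightarrow> s = 0)"

text \<open>\<open>heval [c\<^sub>d, \<dots>, c\<^sub>0] a w\<close> is \<open>w\<^sup>d\<^sup>+\<^sup>1\<close> times the value of the polynomial at \<open>a / w\<close>.\<close>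

fun heval :: "'c::comm_ring_1 list \<Rightarrow> 'c \<Rightarrow> 'c \<Rightarrow> 'c" where
  "heval [] a w = 0"
| "heval (c # cs) a w = c * a ^ length cs * w + w * heval cs a w"

text \<open>A fraction-free rendering: the vanishing of \<open>heval (1 # cs) a w\<close> says that
  \<open>a / w\<close> is a root of a monic polynomial, and \<open>w dvd a\<close> that the fraction
  is already in the ring.\<close>

definition integrally_closed_type :: "'c::comm_ring_1 itself \<Rightarrow> bool" where
  "integrally_closed_type _ \<longleftrightarrow>
    (\<forall>cs a w. non_zero_divisor (w :: 'c) \<longrightarrow> heval (1 # cs) a w = 0 \<longrightarrow> w dvd a)"

lemma non_zero_divisor_mult:
  "non_zero_divisor w \<Longrightarrow> non_zero_divisor w' \<Longrightarrow> non_zero_divisor (w * w')"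
  unfolding non_zero_divisor_def mult.assoc[symmetric] by blast

lemma non_zero_divisor_cancel:
  "non_zero_divisor w \<Longrightarrow> a * w = b * w \<longleftrightarrow> a = b"
proof
  assume w: "non_zero_divisor w" and eq: "a * w = b * w"
  have "(a - b) * w = 0" using eq by (simp add: left_diff_distrib)
  then have "a - b = 0" using w unfolding non_zero_divisor_def by blast
  then show "a = b" by simp
qed simp

text \<open>\<open>f\<close> identifies the given ring with \<open>R0\<close> inside the type that
  plays the role of \<open>S\<close>, so that computations with fractions become identities in a
  commutative ring type.\<close>

locale order_presentation = quadratic_order \<iota> K \<beta> u v m + cring R
  for \<iota> :: "'b::field fps \<Rightarrow> 'c::comm_ring_1" and K \<beta> u v m
    and R :: "('r, 'z) ring_scheme" (structure) +
  fixes f :: "'r \<Rightarrow> 'c"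
  assumes f_mult: "a \<in> carrier R \<Longrightarrow> b \<in> carrier R \<Longrightarrow> f (a \<otimes> b) = f a * f b"
    and f_add: "a \<in> carrier R \<Longrightarrow> b \<in> carrier R \<Longrightarrow> f (a \<oplus> b) = f a + f b"
    and f_one: "f \<one> = 1" and f_inj: "inj_on f (carrier R)" and f_image: "f ` carrier R = R0"
    and integrally_closed: "integrally_closed_type TYPE('c)"
begin

abbreviation "T \<equiv> total_fractions R"
abbreviation "nzd \<equiv> nonzerodivisors R"

lemma f_zero: "f \<zero> = 0"
  using f_add[of \<zero> \<zero>] by simp

lemma f_minus: "a \<in> carrier R \<Longrightarrow> f (\<ominus> a) = - f a"
proof -
  assume a: "a \<in> carrier R"
  then have "f a + f (\<ominus> a) = 0" using f_add[of a "\<ominus> a"] by (simp add: r_neg f_zero)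
  then show ?thesis by (rule Groups.minus_unique[symmetric])
qed

lemma f_power: "a \<in> carrier R \<Longrightarrow> f (a [^] (k :: nat)) = f a ^ k"
  by (induction k) (simp_all add: f_one f_mult mult.commute)

lemma f_eq_iff: "a \<in> carrier R \<Longrightarrow> b \<in> carrier R \<Longrightarrow> f a = f b \<longleftrightarrow> a = b"
  by (rule inj_on_eq_iff[OF f_inj])

lemma f_in_R0: "a \<in> carrier R \<Longrightarrow> f a \<in> R0"
  unfolding f_image[symmetric] by (rule imageI)

lemma R0_preimage: "r \<in> R0 \<Longrightarrow> \<exists>a\<in>carrier R. f a = r"
  unfolding f_image[symmetric] by blast

lemma x_power_cancel: "x ^ k * s = x ^ k * t \<longleftrightarrow> s = t"
  by (induction k) (simp_all add: mult.assoc x_nonzero_divisor)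

text \<open>An annihilator in \<open>S\<close> becomes one in the order after multiplication by
  \<open>x^m\<close>, which is injective.\<close>

lemma nzd_iff: "w \<in> nzd \<longleftrightarrow> w \<in> carrier R \<and> non_zero_divisor (f w)"
proof (cases "w \<in> carrier R")
  case w: True
  show ?thesis
  proof
    assume nz: "w \<in> nzd"
    have "s = 0" if s: "s * f w = 0" for s
    proof -
      obtain a where a: "a \<in> carrier R" "f a = x ^ m * s" using R0_preimage x_power_mult_in_R0 by blast
      have "f (a \<otimes> w) = f \<zero>" using a w s by (simp add: f_mult f_zero mult.assoc)
      then have "a \<otimes> w = \<zero>" using a w by (subst (asm) f_eq_iff) auto
      then have "a = \<zero>" using nz a(1) by (simp add: nonzerodivisors_def)
      then have "x ^ m * s = x ^ m * 0" using a(2) f_zero by simp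
      then show "s = 0" unfolding x_power_cancel .
    qed
    then show "w \<in> carrier R \<and> non_zero_divisor (f w)" using w unfolding non_zero_divisor_def by blast
  next
    assume nz: "w \<in> carrier R \<and> non_zero_divisor (f w)"
    have "a = \<zero>" if a: "a \<in> carrier R" "a \<otimes> w = \<zero>" for a
    proof -
      have "f a * f w = 0" using a w f_mult[of a w] f_zero by simp
      then have "f a = f \<zero>" using nz unfolding non_zero_divisor_def f_zero by blast
      then show "a = \<zero>" using a by (simp add: f_eq_iff)
    qed
    then show "w \<in> nzd" using w by (simp add: nonzerodivisors_def)
  qed
next
  case False
  then show ?thesis by (simp add: nonzerodivisors_def)
qed

lemma nzd_carrier: "w \<in> nzd \<Longrightarrow> w \<in> carrier R"
  by (simp add: nzd_iff)

lemma nzd_mult: "w \<in> nzd \<Longrightarrow> w' \<in> nzd \<Longrightarrow> w \<otimes> w' \<in> nzd"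
  by (simp add: nzd_iff f_mult non_zero_divisor_mult)

lemma nzd_one: "\<one> \<in> nzd"
  by (simp add: nzd_iff f_one non_zero_divisor_def)

lemma nzd_power: "w \<in> nzd \<Longrightarrow> w [^] (k :: nat) \<in> nzd"
  by (induction k) (simp_all add: nzd_one nzd_mult)

section \<open>Arithmetic in the total ring of fractions\<close>

lemma mem_fraction:
  assumes "a \<in> carrier R" "w \<in> nzd"
  shows "p \<in> fraction R a w \<longleftrightarrow> fst p \<in> carrier R \<and> snd p \<in> nzd \<and> f a * f (snd p) = f (fst p) * f w"
proof -
  have "a \<otimes> w' = b \<otimes> w \<longleftrightarrow> f a * f w' = f b * f w" if "b \<in> carrier R" "w' \<in> nzd" for b w'
    using that assms f_eq_iff[of "a \<otimes> w'" "b \<otimes> w"] by (simp add: nzd_carrier f_mult)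
  then show ?thesis by (cases p) (auto simp: fraction_def)
qed

lemma fraction_eq_iff:
  assumes "a \<in> carrier R" "w \<in> nzd" "b \<in> carrier R" "w' \<in> nzd"
  shows "fraction R a w = fraction R b w' \<longleftrightarrow> f a * f w' = f b * f w"
proof
  assume eq: "fraction R a w = fraction R b w'"
  have "(b, w') \<in> fraction R b w'" using assms by (simp add: mem_fraction)
  then have "(b, w') \<in> fraction R a w" using eq by simp
  then show "f a * f w' = f b * f w" using assms by (simp add: mem_fraction)
next
  assume eq: "f a * f w' = f b * f w"
  have nz: "non_zero_divisor (f w)" "non_zero_divisor (f w')" using assms by (auto simp: nzd_iff)
  have "f a * c = d * f w \<longleftrightarrow> f b * c = d * f w'" for c d
  proof -
    have "f a * c = d * f w \<longleftrightarrow> f a * c * f w' = d * f w * f w'"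
      by (simp add: non_zero_divisor_cancel nz)
    also have "\<dots> \<longleftrightarrow> (f a * f w') * c = d * f w * f w'" by (simp add: mult_ac)
    also have "\<dots> \<longleftrightarrow> (f b * c) * f w = (d * f w') * f w" unfolding eq by (simp add: mult_ac)
    also have "\<dots> \<longleftrightarrow> f b * c = d * f w'" by (simp add: non_zero_divisor_cancel nz)
    finally show ?thesis .
  qed
  then show "fraction R a w = fraction R b w'"
    by (intro Set.set_eqI) (simp add: mem_fraction assms)
qed

lemma fraction_representative:
  assumes "a \<in> carrier R" "w \<in> nzd" "(b, w') \<in> fraction R a w"
  shows "b \<in> carrier R" "w' \<in> nzd" "f a * f w' = f b * f w"
  using assms(3) mem_fraction[OF assms(1,2)] by auto

lemma fraction_self: "a \<in> carrier R \<Longrightarrow> w \<in> nzd \<Longrightarrow> (a, w) \<in> fraction R a w"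
  by (simp add: mem_fraction)

lemma union_constant:
  assumes const: "\<And>a w b w'. (a, w) \<in> P \<Longrightarrow> (b, w') \<in> P' \<Longrightarrow> F a w b w' = C"
    and ne: "p \<in> P" "p' \<in> P'"
  shows "(\<Union>(a, w)\<in>P. \<Union>(b, w')\<in>P'. F a w b w') = C"
proof (rule SUP_eq_const)
  show "P \<noteq> {}" using ne by blast
  fix p assume p: "p \<in> P"
  obtain a w where aw: "p = (a, w)" by (cases p)
  have "(\<Union>(b, w')\<in>P'. F a w b w') = C"
  proof (rule SUP_eq_const)
    show "P' \<noteq> {}" using ne by blast
    fix p' assume "p' \<in> P'"
    then show "(case p' of (b, w') \<Rightarrow> F a w b w') = C" using const p aw by (cases p') simp
  qed
  then show "(case p of (a, w) \<Rightarrow> \<Union>(b, w')\<in>P'. F a w b w') = C" using aw by simp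
qed

lemma T_mult:
  assumes "a \<in> carrier R" "w \<in> nzd" "b \<in> carrier R" "w' \<in> nzd"
  shows "fraction R a w \<otimes>\<^bsub>T\<^esub> fraction R b w' = fraction R (a \<otimes> b) (w \<otimes> w')"
proof -
  have "fraction R (a1 \<otimes> b1) (w1 \<otimes> w1') = fraction R (a \<otimes> b) (w \<otimes> w')"
    if "(a1, w1) \<in> fraction R a w" "(b1, w1') \<in> fraction R b w'" for a1 w1 b1 w1'
  proof -
    note 1 = fraction_representative[OF assms(1,2) that(1)]
    note 2 = fraction_representative[OF assms(3,4) that(2)]
    note car = assms 1(1,2) 2(1,2)
    have "f (a1 \<otimes> b1) * f (w \<otimes> w') = (f a1 * f w) * (f b1 * f w')"
      using car by (simp add: nzd_carrier f_mult mult_ac)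
    also have "\<dots> = (f a * f w1) * (f b * f w1')" using 1(3) 2(3) by simp
    also have "\<dots> = f (a \<otimes> b) * f (w1 \<otimes> w1')" using car by (simp add: nzd_carrier f_mult mult_ac)
    finally show ?thesis using car by (intro iffD2[OF fraction_eq_iff]) (simp_all add: nzd_mult)
  qed
  then show ?thesis
    unfolding total_fractions_def monoid.simps
    by (rule union_constant[OF _ fraction_self[OF assms(1,2)] fraction_self[OF assms(3,4)]])
qed

lemma T_add:
  assumes "a \<in> carrier R" "w \<in> nzd" "b \<in> carrier R" "w' \<in> nzd"
  shows "fraction R a w \<oplus>\<^bsub>T\<^esub> fraction R b w' = fraction R (a \<otimes> w' \<oplus> b \<otimes> w) (w \<otimes> w')"
proof -
  have "fraction R (a1 \<otimes> w1' \<oplus> b1 \<otimes> w1) (w1 \<otimes> w1') = fraction R (a \<otimes> w' \<oplus> b \<otimes> w) (w \<otimes> w')"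
    if "(a1, w1) \<in> fraction R a w" "(b1, w1') \<in> fraction R b w'" for a1 w1 b1 w1'
  proof -
    note 1 = fraction_representative[OF assms(1,2) that(1)]
    note 2 = fraction_representative[OF assms(3,4) that(2)]
    note car = assms 1(1,2) 2(1,2)
    have "f (a1 \<otimes> w1' \<oplus> b1 \<otimes> w1) * f (w \<otimes> w') =
        (f a1 * f w) * (f w1' * f w') + (f b1 * f w') * (f w1 * f w)"
      using car by (simp add: nzd_carrier f_mult f_add algebra_simps)
    also have "\<dots> = (f a * f w1) * (f w1' * f w') + (f b * f w1') * (f w1 * f w)" using 1(3) 2(3) by simp
    also have "\<dots> = f (a \<otimes> w' \<oplus> b \<otimes> w) * f (w1 \<otimes> w1')"
      using car by (simp add: nzd_carrier f_mult f_add algebra_simps)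
    finally show ?thesis using car by (intro iffD2[OF fraction_eq_iff]) (simp_all add: nzd_mult nzd_carrier)
  qed
  then show ?thesis
    unfolding total_fractions_def ring.simps
    by (rule union_constant[OF _ fraction_self[OF assms(1,2)] fraction_self[OF assms(3,4)]])
qed

lemma T_one: "\<one>\<^bsub>T\<^esub> = fraction R \<one> \<one>" and T_zero: "\<zero>\<^bsub>T\<^esub> = fraction R \<zero> \<one>"
  by (simp_all add: total_fractions_def)

lemma T_carrier: "carrier T = {fraction R a w | a w. a \<in> carrier R \<and> w \<in> nzd}"
  by (simp add: total_fractions_def)

lemma T_memI: "a \<in> carrier R \<Longrightarrow> w \<in> nzd \<Longrightarrow> fraction R a w \<in> carrier T"
  by (auto simp: T_carrier)

lemma T_memE:
  assumes "z \<in> carrier T" obtains a w where "a \<in> carrier R" "w \<in> nzd" "z = fraction R a w"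
  using assms by (auto simp: T_carrier)

lemmas T_simps = T_mult T_add T_one T_zero T_memI fraction_eq_iff nzd_mult nzd_one nzd_carrier
  f_mult f_add f_one f_zero f_minus

lemma T_cring: "cring T"
proof (rule cringI)
  show "abelian_group T"
  proof (rule abelian_groupI)
    fix y z assume "y \<in> carrier T" "z \<in> carrier T"
    then show "y \<oplus>\<^bsub>T\<^esub> z \<in> carrier T" by (elim T_memE) (simp add: T_simps)
  next
    show "\<zero>\<^bsub>T\<^esub> \<in> carrier T" by (simp add: T_simps)
  next
    fix y z y' assume "y \<in> carrier T" "z \<in> carrier T" "y' \<in> carrier T"
    then show "(y \<oplus>\<^bsub>T\<^esub> z) \<oplus>\<^bsub>T\<^esub> y' = y \<oplus>\<^bsub>T\<^esub> (z \<oplus>\<^bsub>T\<^esub> y')"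
      by (elim T_memE) (simp add: T_simps algebra_simps)
  next
    fix y z assume "y \<in> carrier T" "z \<in> carrier T"
    then show "y \<oplus>\<^bsub>T\<^esub> z = z \<oplus>\<^bsub>T\<^esub> y" by (elim T_memE) (simp add: T_simps algebra_simps)
  next
    fix y assume "y \<in> carrier T"
    then show "\<zero>\<^bsub>T\<^esub> \<oplus>\<^bsub>T\<^esub> y = y" by (elim T_memE) (simp add: T_simps)
  next
    fix y assume "y \<in> carrier T"
    then obtain a w where a: "a \<in> carrier R" "w \<in> nzd" "y = fraction R a w" by (rule T_memE)
    then have "fraction R (\<ominus> a) w \<oplus>\<^bsub>T\<^esub> y = \<zero>\<^bsub>T\<^esub>" by (simp add: T_simps)
    then show "\<exists>z\<in>carrier T. z \<oplus>\<^bsub>T\<^esub> y = \<zero>\<^bsub>T\<^esub>" using a T_memI[of "\<ominus> a" w] by auto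
  qed
  show "comm_monoid T"
  proof (rule comm_monoidI)
    fix y z assume "y \<in> carrier T" "z \<in> carrier T"
    then show "y \<otimes>\<^bsub>T\<^esub> z \<in> carrier T" by (elim T_memE) (simp add: T_simps)
  next
    show "\<one>\<^bsub>T\<^esub> \<in> carrier T" by (simp add: T_simps)
  next
    fix y z y' assume "y \<in> carrier T" "z \<in> carrier T" "y' \<in> carrier T"
    then show "(y \<otimes>\<^bsub>T\<^esub> z) \<otimes>\<^bsub>T\<^esub> y' = y \<otimes>\<^bsub>T\<^esub> (z \<otimes>\<^bsub>T\<^esub> y')"
      by (elim T_memE) (simp add: T_simps algebra_simps)
  next
    fix y assume "y \<in> carrier T"
    then show "\<one>\<^bsub>T\<^esub> \<otimes>\<^bsub>T\<^esub> y = y" by (elim T_memE) (simp add: T_simps)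
  next
    fix y z assume "y \<in> carrier T" "z \<in> carrier T"
    then show "y \<otimes>\<^bsub>T\<^esub> z = z \<otimes>\<^bsub>T\<^esub> y" by (elim T_memE) (simp add: T_simps algebra_simps)
  qed
  fix y z y' assume "y \<in> carrier T" "z \<in> carrier T" "y' \<in> carrier T"
  then show "(y \<oplus>\<^bsub>T\<^esub> z) \<otimes>\<^bsub>T\<^esub> y' = y \<otimes>\<^bsub>T\<^esub> y' \<oplus>\<^bsub>T\<^esub> z \<otimes>\<^bsub>T\<^esub> y'"
    by (elim T_memE) (simp add: T_simps algebra_simps)
qed

interpretation T: cring T
  by (rule T_cring)

lemma T_power:
  assumes "a \<in> carrier R" "w \<in> nzd"
  shows "fraction R a w [^]\<^bsub>T\<^esub> (k :: nat) = fraction R (a [^] k) (w [^] k)"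
proof (induction k)
  case 0
  then show ?case by (simp add: T_one)
next
  case (Suc k)
  then show ?case using assms by (simp add: T_mult nzd_power)
qed

text \<open>The denominator is \<open>w\<close> to the number of coefficients, one more than the
  degree, in accordance with the extra factor in \<open>heval\<close>.\<close>

lemma T_eval:
  assumes "a \<in> carrier R" "w \<in> nzd" "set rs \<subseteq> carrier R"
  shows "\<exists>b\<in>carrier R. ring.eval T (map (to_fraction R) rs) (fraction R a w) = fraction R b (w [^] length rs) \<and>
    f b = heval (map f rs) (f a) (f w)"
  using assms(3)
proof (induction rs)
  case Nil
  then show ?case by (intro bexI[of _ \<zero>]) (simp_all add: T.eval.simps T_zero f_zero)
next
  case (Cons r rs)
  then obtain b where b: "b \<in> carrier R" "T.eval (map (to_fraction R) rs) (fraction R a w) = fraction R b (w [^] length rs)"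
    "f b = heval (map f rs) (f a) (f w)" by auto
  let ?k = "length rs"
  define c where "c = r \<otimes> a [^] ?k \<otimes> w \<oplus> w \<otimes> b"
  have r: "r \<in> carrier R" using Cons.prems by simp
  note w = nzd_carrier[OF assms(2)]
  have c: "c \<in> carrier R" unfolding c_def using r b(1) assms(1) w by simp
  have "T.eval (map (to_fraction R) (r # rs)) (fraction R a w) =
      fraction R r \<one> \<otimes>\<^bsub>T\<^esub> fraction R a w [^]\<^bsub>T\<^esub> ?k \<oplus>\<^bsub>T\<^esub> fraction R b (w [^] ?k)"
    using b(2) by (simp add: T.eval.simps to_fraction_def)
  also have "\<dots> = fraction R (r \<otimes> a [^] ?k) (w [^] ?k) \<oplus>\<^bsub>T\<^esub> fraction R b (w [^] ?k)"
    using assms r by (simp add: T_power T_mult nzd_one nzd_power nzd_carrier)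
  also have "\<dots> = fraction R (r \<otimes> a [^] ?k \<otimes> w [^] ?k \<oplus> b \<otimes> w [^] ?k) (w [^] ?k \<otimes> w [^] ?k)"
    using assms r b(1) by (intro T_add) (simp_all add: nzd_power)
  also have "\<dots> = fraction R c (w [^] length (r # rs))"
    using assms r b(1) w c nzd_power[OF assms(2)]
    by (subst fraction_eq_iff) (simp_all add: nzd_mult f_mult f_add f_power c_def algebra_simps)
  finally have "T.eval (map (to_fraction R) (r # rs)) (fraction R a w) = fraction R c (w [^] length (r # rs))" .
  moreover have "f c = heval (map f (r # rs)) (f a) (f w)"
    unfolding c_def using assms r b(1) w b(3) by (simp add: f_mult f_add f_power)
  ultimately show ?case using c by blast
qed

text \<open>The embedding of \<open>S\<close> in the total ring of fractions: the class of all
  \<open>b / w\<close> that equal \<open>s\<close>.\<close>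

definition to_total :: "'c \<Rightarrow> ('r \<times> 'r) set" where
  "to_total s = {(b, w). b \<in> carrier R \<and> w \<in> nzd \<and> f b = s * f w}"

lemma fraction_eq_to_total:
  assumes "a \<in> carrier R" "w \<in> nzd" "f a = s * f w"
  shows "fraction R a w = to_total s"
proof (rule Set.set_eqI)
  fix p :: "'r \<times> 'r"
  have nz: "non_zero_divisor (f w)" using assms by (simp add: nzd_iff)
  have "s * f w * f (snd p) = f (fst p) * f w \<longleftrightarrow> (s * f (snd p)) * f w = f (fst p) * f w"
    by (simp add: mult_ac)
  also have "\<dots> \<longleftrightarrow> s * f (snd p) = f (fst p)" by (rule non_zero_divisor_cancel[OF nz])
  finally show "p \<in> fraction R a w \<longleftrightarrow> p \<in> to_total s"
    using mem_fraction[OF assms(1,2)] unfolding assms(3) by (cases p) (auto simp: to_total_def)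
qed

text \<open>Every \<open>s\<close> is \<open>x^m s\<close> divided by \<open>x^m\<close>, and both
  lie in the order.\<close>

lemma to_total_as_fraction:
  obtains a w where "a \<in> carrier R" "w \<in> nzd" "f a = s * f w" "to_total s = fraction R a w"
proof -
  obtain a where a: "a \<in> carrier R" "f a = x ^ m * s" using R0_preimage x_power_mult_in_R0 by blast
  obtain w where w: "w \<in> carrier R" "f w = x ^ m * 1" using R0_preimage x_power_mult_in_R0 by blast
  have "non_zero_divisor (x ^ m)"
    unfolding non_zero_divisor_def
  proof safe
    fix s assume "s * x ^ m = 0"
    then have "x ^ m * s = x ^ m * 0" by (simp add: mult.commute)
    then show "s = 0" unfolding x_power_cancel .
  qed
  then have w': "w \<in> nzd" using w by (simp add: nzd_iff)
  have "f a = s * f w" using a w by (simp add: mult.commute)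
  then show ?thesis using that[OF a(1) w'] fraction_eq_to_total[OF a(1) w'] by metis
qed

lemma to_total_inject: "to_total s = to_total t \<longleftrightarrow> s = t"
proof
  assume eq: "to_total s = to_total t"
  obtain a w where a: "a \<in> carrier R" "w \<in> nzd" "f a = s * f w" "to_total s = fraction R a w"
    by (rule to_total_as_fraction)
  then have "(a, w) \<in> to_total t" using fraction_self eq by simp
  then have "s * f w = t * f w" using a by (simp add: to_total_def)
  then show "s = t" using non_zero_divisor_cancel[of "f w" s t] a(2) by (simp add: nzd_iff)
qed simp

lemma to_total_add: "to_total s \<oplus>\<^bsub>T\<^esub> to_total t = to_total (s + t)"
proof -
  obtain a w where a: "a \<in> carrier R" "w \<in> nzd" "f a = s * f w" "to_total s = fraction R a w"
    by (rule to_total_as_fraction)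
  obtain b w' where b: "b \<in> carrier R" "w' \<in> nzd" "f b = t * f w'" "to_total t = fraction R b w'"
    by (rule to_total_as_fraction)
  show ?thesis
    unfolding a(4) b(4) T_add[OF a(1,2) b(1,2)] using a(1-3) b(1-3)
    by (intro fraction_eq_to_total) (simp_all add: nzd_mult nzd_carrier f_mult f_add algebra_simps)
qed

lemma to_fraction_mult: "r \<in> carrier R \<Longrightarrow> to_fraction R r \<otimes>\<^bsub>T\<^esub> to_total s = to_total (f r * s)"
proof -
  assume r: "r \<in> carrier R"
  obtain a w where a: "a \<in> carrier R" "w \<in> nzd" "f a = s * f w" "to_total s = fraction R a w"
    by (rule to_total_as_fraction)
  show ?thesis
    unfolding a(4) to_fraction_def T_mult[OF r nzd_one a(1,2)] using a(1-3) r
    by (intro fraction_eq_to_total) (simp_all add: nzd_mult nzd_one nzd_carrier f_mult f_one algebra_simps)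
qed

lemma to_total_0: "\<zero>\<^bsub>T\<^esub> = to_total 0"
  unfolding T_zero by (rule fraction_eq_to_total) (simp_all add: nzd_one f_zero)

text \<open>For \<open>s = a + b \<beta>\<close>, the trace is \<open>2 a + u b\<close> and the norm is \<open>a\<^sup>2 + u a b - v b\<^sup>2\<close>.\<close>

lemma monic_relation: "\<exists>c1\<in>R0. \<exists>c0\<in>R0. s * s + c1 * s + c0 = 0"
proof -
  define a b where "a = coord1 s" and "b = coord2 s"
  have ab: "a \<in> B" "b \<in> B" "s = \<iota> a + \<iota> b * \<beta>" using coords[of s] by (simp_all add: a_def b_def)
  let ?c1 = "\<iota> (0 - (a + a + u * b))" and ?c0 = "\<iota> (a * a + a * b * u - b * b * v)"
  have "s * s = \<iota> a * \<iota> a + 2 * \<iota> a * \<iota> b * \<beta> + \<iota> b * \<iota> b * (\<beta> * \<beta>)"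
    unfolding ab(3) by (simp add: algebra_simps)
  then have "s * s + ?c1 * s + ?c0 = 0"
    unfolding \<beta>_square ab(3) \<iota>_diff \<iota>_add \<iota>_mult \<iota>_0 by (simp add: algebra_simps)
  moreover have "0 - (a + a + u * b) \<in> B" "a * a + a * b * u - b * b * v \<in> B"
    using ab u_B v_B add_subgrp_diff[OF add_subgrp_B] add_subgrp_add[OF add_subgrp_B]
      add_subgrp_0[OF add_subgrp_B] B_mult by presburger+
  ultimately show ?thesis using \<iota>_in_R0 by blast
qed

text \<open>Elements of \<open>S\<close> satisfy monic quadratic equations over the order.
  Conversely, a fraction integral over the order is integral over \<open>S\<close>, and integral
  closedness turns it into an element of \<open>S\<close>.\<close>

lemma normalization_carrier: "carrier (normalization R) = range to_total"
proof -
  have zero_iff: "fraction R b w = \<zero>\<^bsub>T\<^esub> \<longleftrightarrow> f b = 0" if "b \<in> carrier R" "w \<in> nzd" for b w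
    unfolding T_zero using that by (subst fraction_eq_iff) (auto simp: nzd_one f_one f_zero)
  have "to_total s \<in> carrier (normalization R)" for s
  proof -
    obtain a w where a: "a \<in> carrier R" "w \<in> nzd" "f a = s * f w" "to_total s = fraction R a w"
      by (rule to_total_as_fraction)
    obtain c1 c0 where c: "c1 \<in> R0" "c0 \<in> R0" "s * s + c1 * s + c0 = 0" using monic_relation by blast
    obtain r1 r0 where r: "r1 \<in> carrier R" "f r1 = c1" "r0 \<in> carrier R" "f r0 = c0"
      using R0_preimage c by metis
    let ?rs = "[\<one>, r1, r0]"
    obtain b where b: "b \<in> carrier R" "T.eval (map (to_fraction R) ?rs) (fraction R a w) = fraction R b (w [^] length ?rs)"
      "f b = heval (map f ?rs) (f a) (f w)" using T_eval[OF a(1,2), of ?rs] r by auto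
    have "f b = f w * f w * f w * (s * s + c1 * s + c0)"
      unfolding b(3) by (simp add: f_one r a(3) algebra_simps power2_eq_square)
    then have "f b = 0" using c(3) by simp
    then have "T.eval (map (to_fraction R) ?rs) (to_total s) = \<zero>\<^bsub>T\<^esub>"
      unfolding a(4) b(2) by (rule iffD2[OF zero_iff[OF b(1) nzd_power[OF a(2)]]])
    moreover have "to_total s \<in> carrier T" unfolding a(4) by (rule T_memI[OF a(1,2)])
    moreover have "set (map (to_fraction R) ?rs) \<subseteq> to_fraction R ` carrier R" using r by auto
    moreover have "hd (map (to_fraction R) ?rs) = \<one>\<^bsub>T\<^esub>" by (simp add: to_fraction_def T_one)
    moreover have "map (to_fraction R) ?rs \<noteq> []" by simp
    ultimately have "to_total s \<in> integral_closure T (to_fraction R ` carrier R)"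
      unfolding integral_closure_def mem_Collect_eq by blast
    then show ?thesis by (simp add: normalization_def)
  qed
  moreover have "z \<in> range to_total" if "z \<in> carrier (normalization R)" for z
  proof -
    from that obtain p where p: "z \<in> carrier T" "p \<noteq> []" "set p \<subseteq> to_fraction R ` carrier R"
      "hd p = \<one>\<^bsub>T\<^esub>" "T.eval p z = \<zero>\<^bsub>T\<^esub>"
      by (auto simp: normalization_def integral_closure_def)
    obtain a w where a: "a \<in> carrier R" "w \<in> nzd" "z = fraction R a w" using p(1) by (rule T_memE)
    \<comment> \<open>The coefficients of \<open>p\<close> are fractions with denominator 1;
      \<open>g\<close> chooses their numerators.\<close>
    define g where "g y = (SOME r. to_fraction R r = y \<and> r \<in> carrier R)" for y
    have g: "to_fraction R (g y) = y \<and> g y \<in> carrier R" if "y \<in> set p" for y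
    proof -
      have "\<exists>r. to_fraction R r = y \<and> r \<in> carrier R" using p(3) that by blast
      then show ?thesis unfolding g_def by (rule someI_ex)
    qed
    define rs where "rs = map g p"
    have "map (to_fraction R) rs = p"
      unfolding rs_def map_map by (rule map_idI) (simp add: g)
    then have rs: "p = map (to_fraction R) rs" "set rs \<subseteq> carrier R"
      using g by (auto simp: rs_def)
    obtain r rs' where rs': "rs = r # rs'" using p(2) rs(1) by (cases rs) auto
    have "fraction R r \<one> = fraction R \<one> \<one>" using p(4) rs rs' by (simp add: to_fraction_def T_one)
    then have r1: "f r = 1" using rs rs' by (simp add: fraction_eq_iff nzd_one f_one)
    obtain b where b: "b \<in> carrier R" "T.eval p z = fraction R b (w [^] length rs)"
      "f b = heval (map f rs) (f a) (f w)" using T_eval[OF a(1,2) rs(2)] unfolding rs(1) a(3) by auto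
    have "fraction R b (w [^] length rs) = \<zero>\<^bsub>T\<^esub>" using b(2) p(5) by simp
    then have "f b = 0" by (rule iffD1[OF zero_iff[OF b(1) nzd_power[OF a(2)]]])
    then have "heval (1 # map f rs') (f a) (f w) = 0" using b(3) rs' r1 by simp
    then have "f w dvd f a"
      using integrally_closed a(2) unfolding integrally_closed_type_def nzd_iff by blast
    then obtain s where "f a = s * f w" by (auto simp: mult.commute elim!: dvdE)
    then have "z = to_total s" unfolding a(3) by (rule fraction_eq_to_total[OF a(1,2)])
    then show ?thesis by blast
  qed
  ultimately show ?thesis by blast
qed

section \<open>Powers of the normalization as vectors over \<open>S\<close>\<close>

abbreviation "N n \<equiv> normalization_power R n"

definition to_vec :: "nat \<Rightarrow> (nat \<Rightarrow> ('r \<times> 'r) set) \<Rightarrow> nat \<Rightarrow> 'c" where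
  "to_vec n F = (\<lambda>i. if i < n then inv_into UNIV to_total (F i) else 0)"

definition of_vec :: "nat \<Rightarrow> (nat \<Rightarrow> 'c) \<Rightarrow> nat \<Rightarrow> ('r \<times> 'r) set" where
  "of_vec n g = (\<lambda>i\<in>{..<n}. to_total (g i))"

lemma inv_to_total: "inv_into UNIV to_total (to_total s) = s"
  by (rule inv_into_f_f) (auto simp: inj_on_def to_total_inject)

lemma N_carrier: "carrier (N n) = {..<n} \<rightarrow>\<^sub>E range to_total"
  by (simp add: normalization_power_def normalization_carrier Let_def)

lemma of_vec_bij: "bij_betw (of_vec n) (vecs n) (carrier (N n))"
proof (rule bij_betwI[where g = "to_vec n"])
  show "of_vec n \<in> vecs n \<rightarrow> carrier (N n)" by (auto simp: of_vec_def N_carrier)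
  show "to_vec n \<in> carrier (N n) \<rightarrow> vecs n" by (auto simp: to_vec_def vecs_def)
  show "to_vec n (of_vec n g) = g" if "g \<in> vecs n" for g
    using that by (auto simp: to_vec_def of_vec_def vecs_def inv_to_total fun_eq_iff)
  show "of_vec n (to_vec n F) = F" if "F \<in> carrier (N n)" for F
  proof
    fix i show "of_vec n (to_vec n F) i = F i"
    proof (cases "i < n")
      case True
      then have "F i \<in> range to_total" using that unfolding N_carrier by (auto dest: PiE_mem)
      then obtain s where "F i = to_total s" by blast
      then show ?thesis using True by (simp add: of_vec_def to_vec_def inv_to_total)
    next
      case False
      have "F i = undefined" using that False unfolding N_carrier by (intro PiE_arb) auto
      then show ?thesis using False by (simp add: of_vec_def)
    qed
  qed
qed

lemma N_add: "of_vec n g \<oplus>\<^bsub>N n\<^esub> of_vec n h = of_vec n (g + h)"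
  by (auto simp: normalization_power_def Let_def normalization_def of_vec_def to_total_add intro!: restrict_ext)

lemma N_zero: "\<zero>\<^bsub>N n\<^esub> = of_vec n 0"
  by (auto simp: normalization_power_def Let_def normalization_def of_vec_def to_total_0 intro!: restrict_ext)

lemma N_smult: "r \<in> carrier R \<Longrightarrow> r \<odot>\<^bsub>N n\<^esub> of_vec n g = of_vec n (vmul (f r) g)"
  by (auto simp: normalization_power_def Let_def normalization_def of_vec_def to_fraction_mult vmul_def
      intro!: restrict_ext)

lemma of_vec_eq_iff: "g \<in> vecs n \<Longrightarrow> h \<in> vecs n \<Longrightarrow> of_vec n g = of_vec n h \<longleftrightarrow> g = h"
  by (rule inj_on_eq_iff[OF bij_betw_imp_inj_on[OF of_vec_bij]])

lemma of_vec_mem: "g \<in> vecs n \<Longrightarrow> of_vec n g \<in> carrier (N n)"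
  using bij_betw_imp_surj_on[OF of_vec_bij[of n]] by blast

lemma N_memE:
  assumes "F \<in> carrier (N n)" obtains g where "g \<in> vecs n" "F = of_vec n g"
  using assms bij_betw_imp_surj_on[OF of_vec_bij[of n]] by blast

text \<open>The additive inverse is a definite description, so besides existence its uniqueness is
  checked on vectors.\<close>

lemma N_inv:
  assumes g: "g \<in> vecs n"
  shows "inv\<^bsub>add_monoid (N n)\<^esub> of_vec n g = of_vec n (- g)"
proof -
  have aP: "add_subgrp (vecs n :: (nat \<Rightarrow> 'c) set)" by (rule add_subgrp_vecs)
  have mg: "- g \<in> vecs n" by (rule add_subgrp_minus[OF aP g])
  have "y = of_vec n (- g)" if y: "y \<in> carrier (N n)" "of_vec n g \<oplus>\<^bsub>N n\<^esub> y = \<zero>\<^bsub>N n\<^esub>" for y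
  proof -
    obtain h where h: "h \<in> vecs n" "y = of_vec n h" using y(1) by (rule N_memE)
    have "of_vec n (g + h) = of_vec n 0" using y(2) h(2) by (simp add: N_add N_zero)
    then have "g + h = 0" using of_vec_eq_iff[OF add_subgrp_add[OF aP g h(1)] add_subgrp_0[OF aP]] by simp
    then have "h = - g" by (simp add: eq_neg_iff_add_eq_0 add.commute)
    then show ?thesis using h by simp
  qed
  note unique = this
  show ?thesis
    unfolding m_inv_def
  proof (rule the_equality)
    show "of_vec n (- g) \<in> carrier (add_monoid (N n)) \<and>
      of_vec n g \<otimes>\<^bsub>add_monoid (N n)\<^esub> of_vec n (- g) = \<one>\<^bsub>add_monoid (N n)\<^esub> \<and>
      of_vec n (- g) \<otimes>\<^bsub>add_monoid (N n)\<^esub> of_vec n g = \<one>\<^bsub>add_monoid (N n)\<^esub>"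
      using of_vec_mem[OF mg] by (simp add: N_add N_zero)
  next
    fix y assume "y \<in> carrier (add_monoid (N n)) \<and>
      of_vec n g \<otimes>\<^bsub>add_monoid (N n)\<^esub> y = \<one>\<^bsub>add_monoid (N n)\<^esub> \<and>
      y \<otimes>\<^bsub>add_monoid (N n)\<^esub> of_vec n g = \<one>\<^bsub>add_monoid (N n)\<^esub>"
    then show "y = of_vec n (- g)" by (intro unique) simp_all
  qed
qed

lemma submodule_iff:
  assumes L: "L \<subseteq> vecs n"
  shows "submodule (of_vec n ` L) R (N n) \<longleftrightarrow> rsub n L"
proof -
  have mem: "of_vec n g \<in> of_vec n ` L \<longleftrightarrow> g \<in> L" if "g \<in> vecs n" for g
    using inj_on_image_mem_iff[OF bij_betw_imp_inj_on[OF of_vec_bij] that L] .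
  have aP: "add_subgrp (vecs n :: (nat \<Rightarrow> 'c) set)" by (rule add_subgrp_vecs)
  have LP: "g \<in> vecs n" if "g \<in> L" for g using L that by blast
  show ?thesis
  proof
    assume sub: "submodule (of_vec n ` L) R (N n)"
    interpret S: submodule "of_vec n ` L" R "N n" by (rule sub)
    have "add_subgrp L"
    proof (rule add_subgrpI)
      have "of_vec n 0 \<in> of_vec n ` L" using S.one_closed by (simp add: N_zero)
      then show "0 \<in> L" using mem[OF add_subgrp_0[OF aP]] by simp
      fix g h assume gh: "g \<in> L" "h \<in> L"
      have "of_vec n (- h) \<in> of_vec n ` L" using S.m_inv_closed[of "of_vec n h"] gh N_inv[OF LP] by simp
      then have "of_vec n g \<oplus>\<^bsub>N n\<^esub> of_vec n (- h) \<in> of_vec n ` L"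
        using S.m_closed[of "of_vec n g" "of_vec n (- h)"] gh by simp
      then have "of_vec n (g - h) \<in> of_vec n ` L" by (simp add: N_add)
      then show "g - h \<in> L" using mem[OF add_subgrp_diff[OF aP LP LP]] gh by simp
    qed
    moreover have "vmul r g \<in> L" if "r \<in> R0" "g \<in> L" for r g
    proof -
      obtain a where a: "a \<in> carrier R" "f a = r" using R0_preimage \<open>r \<in> R0\<close> by blast
      have "a \<odot>\<^bsub>N n\<^esub> of_vec n g \<in> of_vec n ` L" using S.smult_closed[OF a(1)] that by blast
      then have "of_vec n (vmul r g) \<in> of_vec n ` L" using a by (simp add: N_smult)
      then show ?thesis using mem[OF vmul_vecs[OF LP]] that by simp
    qed
    ultimately show "rsub n L" using L by (simp add: rsub_def)
  next
    assume "rsub n L"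
    then have r: "add_subgrp L" "\<And>r g. r \<in> R0 \<Longrightarrow> g \<in> L \<Longrightarrow> vmul r g \<in> L" by (auto simp: rsub_def)
    show "submodule (of_vec n ` L) R (N n)"
    proof unfold_locales
      show "of_vec n ` L \<subseteq> carrier (add_monoid (N n))" using of_vec_mem LP by auto
      show "\<one>\<^bsub>add_monoid (N n)\<^esub> \<in> of_vec n ` L" using add_subgrp_0[OF r(1)] by (auto simp: N_zero)
      fix y assume "y \<in> of_vec n ` L"
      then obtain g where g: "g \<in> L" "y = of_vec n g" by blast
      show "inv\<^bsub>add_monoid (N n)\<^esub> y \<in> of_vec n ` L"
        using N_inv[OF LP[OF g(1)]] add_subgrp_minus[OF r(1) g(1)] g(2) by simp
      fix z assume "z \<in> of_vec n ` L"
      then obtain h where h: "h \<in> L" "z = of_vec n h" by blast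
      show "y \<otimes>\<^bsub>add_monoid (N n)\<^esub> z \<in> of_vec n ` L"
        using add_subgrp_add[OF r(1) g(1) h(1)] g(2) h(2) by (simp add: N_add)
    next
      fix a y assume a: "a \<in> carrier R" "y \<in> of_vec n ` L"
      then obtain g where g: "g \<in> L" "y = of_vec n g" by blast
      show "a \<odot>\<^bsub>N n\<^esub> y \<in> of_vec n ` L"
        using r(2)[OF f_in_R0[OF a(1)] g(1)] a(1) g(2) by (simp add: N_smult)
    qed
  qed
qed

lemma rcosets_eq:
  assumes L: "L \<subseteq> vecs n"
  shows "a_rcosets\<^bsub>N n\<^esub> (of_vec n ` L) = (`) (of_vec n) ` cosets L (vecs n)"
proof -
  have "of_vec n ` L +>\<^bsub>N n\<^esub> of_vec n g = of_vec n ` ((+) g ` L)" for g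
    by (auto simp: a_r_coset_def r_coset_def N_add add.commute image_image)
  moreover have "a_rcosets\<^bsub>N n\<^esub> (of_vec n ` L) = (\<lambda>F. of_vec n ` L +>\<^bsub>N n\<^esub> F) ` carrier (N n)"
    by (auto simp: A_RCOSETS_def RCOSETS_def a_r_coset_def)
  ultimately show ?thesis
    unfolding bij_betw_imp_surj_on[OF of_vec_bij, symmetric] cosets_def by (simp add: image_image)
qed

lemma submodules_of_index_eq:
  "submodules_of_index R (N n) k =
    (`) (of_vec n) ` {L. rsub n L \<and> finite (cosets L (vecs n)) \<and> idx L (vecs n) = k}"
  and inj_of_vec_image: "inj_on ((`) (of_vec n)) {L. L \<subseteq> vecs n}"
proof -
  show inj: "inj_on ((`) (of_vec n)) {L. L \<subseteq> vecs n}"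
    using inj_on_image_eq_iff[OF bij_betw_imp_inj_on[OF of_vec_bij]] by (auto intro!: inj_onI)
  have aP: "add_subgrp (vecs n :: (nat \<Rightarrow> 'c) set)" by (rule add_subgrp_vecs)
  have index: "(finite (a_rcosets\<^bsub>N n\<^esub> (of_vec n ` L)) \<longleftrightarrow> finite (cosets L (vecs n))) \<and>
    card (a_rcosets\<^bsub>N n\<^esub> (of_vec n ` L)) = idx L (vecs n)" if L: "L \<subseteq> vecs n" for L
  proof -
    have "(+) g ` L \<subseteq> vecs n" if "g \<in> vecs n" for g
      using add_subgrp_add[OF aP that] L by blast
    then have "cosets L (vecs n) \<subseteq> {L. L \<subseteq> vecs n}" by (auto simp: cosets_def)
    then have "inj_on ((`) (of_vec n)) (cosets L (vecs n))" by (rule inj_on_subset[OF inj])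
    then show ?thesis unfolding rcosets_eq[OF L] idx_def by (simp add: card_image finite_image_iff)
  qed
  show "submodules_of_index R (N n) k =
    (`) (of_vec n) ` {L. rsub n L \<and> finite (cosets L (vecs n)) \<and> idx L (vecs n) = k}"
  proof
    show "submodules_of_index R (N n) k \<subseteq>
      (`) (of_vec n) ` {L. rsub n L \<and> finite (cosets L (vecs n)) \<and> idx L (vecs n) = k}"
    proof
      fix L' assume L': "L' \<in> submodules_of_index R (N n) k"
      then have "L' \<subseteq> carrier (N n)"
        using subgroup.subset[of L' "add_monoid (N n)"] by (auto simp: submodules_of_index_def submodule_def)
      then obtain L where L: "L \<subseteq> vecs n" "L' = of_vec n ` L"
        unfolding bij_betw_imp_surj_on[OF of_vec_bij, symmetric] by (auto simp: subset_image_iff)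
      have "rsub n L" "finite (cosets L (vecs n))" "idx L (vecs n) = k"
        using L' submodule_iff[OF L(1)] index[OF L(1)] unfolding L(2) submodules_of_index_def by auto
      then show "L' \<in> (`) (of_vec n) ` {L. rsub n L \<and> finite (cosets L (vecs n)) \<and> idx L (vecs n) = k}"
        using L(2) by blast
    qed
    show "(`) (of_vec n) ` {L. rsub n L \<and> finite (cosets L (vecs n)) \<and> idx L (vecs n) = k} \<subseteq>
      submodules_of_index R (N n) k"
    proof
      fix L' assume "L' \<in> (`) (of_vec n) ` {L. rsub n L \<and> finite (cosets L (vecs n)) \<and> idx L (vecs n) = k}"
      then obtain L where L: "rsub n L" "finite (cosets L (vecs n))" "idx L (vecs n) = k" "L' = of_vec n ` L"
        by blast
      then have "L \<subseteq> vecs n" by (simp add: rsub_def)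
      then show "L' \<in> submodules_of_index R (N n) k"
        using L submodule_iff[of L n] index[of L] by (simp add: submodules_of_index_def)
    qed
  qed
qed

lemma card_submodules_of_index:
  "card (submodules_of_index R (N n) k) =
    card {L. rsub n L \<and> finite (cosets L (vecs n)) \<and> idx L (vecs n) = k}"
  unfolding submodules_of_index_eq
  by (rule card_image, rule inj_on_subset[OF inj_of_vec_image]) (auto simp: rsub_def)

lemma dir_nth_module_zeta:
  "k > 0 \<Longrightarrow> dir_nth (module_zeta R (N n)) k =
    of_nat (card {L. rsub n L \<and> finite (cosets L (vecs n)) \<and> idx L (vecs n) = k})"
  by (simp add: module_zeta_def Abs_dirichlet_inverse card_submodules_of_index)

lemma has_zetaI:
  "(\<And>k. finite {L. rsub n L \<and> finite (cosets L (vecs n)) \<and> idx L (vecs n) = k}) \<Longrightarrow> has_zeta R (N n)"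
  by (simp add: has_zeta_def submodules_of_index_eq)

end

section \<open>Integral closedness\<close>

lemma heval_homogeneous: "heval cs (z * a) (z * w) = z ^ length cs * heval cs a w"
  by (induction cs) (simp_all add: power_mult_distrib algebra_simps)

lemma heval_nth_0: "c $ 0 = 0 \<Longrightarrow> heval cs a c $ 0 = (0 :: 'a::field)"
  by (induction cs) simp_all

text \<open>If \<open>w\<close> does not divide \<open>a\<close>, then \<open>w = a c\<close> with
  \<open>c\<close> without constant term. Dividing the equation by \<open>w\<close> and a power of
  \<open>a\<close> leaves \<open>1 + heval cs 1 c = 0\<close>, which fails at the constant
  term.\<close>

lemma integrally_closed_fps: "integrally_closed_type TYPE('a::field fps)"
  unfolding integrally_closed_type_def
proof (intro allI impI)
  fix cs and a w :: "'a fps"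
  assume w: "non_zero_divisor w" and root: "heval (1 # cs) a w = 0"
  have w0: "w \<noteq> 0" using w unfolding non_zero_divisor_def by (metis mult_zero_right one_neq_zero)
  show "w dvd a"
  proof (cases "a = 0 \<or> subdegree w \<le> subdegree a")
    case True
    then show ?thesis using w0 by (cases "a = 0") (simp_all add: fps_dvd_iff)
  next
    case False
    then have "a dvd w" using w0 by (simp add: fps_dvd_iff)
    then obtain c where c: "w = a * c" by blast
    have c0: "c $ 0 = 0"
    proof (rule ccontr)
      assume "c $ 0 \<noteq> 0"
      then have "subdegree c = 0" by (simp add: subdegree_eq_0_iff)
      then have "subdegree w = subdegree a" using c w0 by (simp add: subdegree_mult)
      then show False using False by simp
    qed
    have "w * (a ^ length cs + heval cs a w) = 0" using root by (simp add: algebra_simps)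
    then have "a ^ length cs + heval cs (a * 1) (a * c) = 0" using w0 c by simp
    then have "a ^ length cs * (1 + heval cs 1 c) = 0" unfolding heval_homogeneous by (simp add: algebra_simps)
    then have "1 + heval cs 1 c = 0" using False by simp
    then have "(1 + heval cs 1 c) $ 0 = 0" by simp
    then show ?thesis using heval_nth_0[OF c0, of cs 1] by simp
  qed
qed

lemma heval_fun: "heval cs a w i = heval (map (\<lambda>c. c i) cs) (a i) (w i)"
  for a w :: "'i \<Rightarrow> 'c::comm_ring_1"
proof -
  have "(z ^ k) i = z i ^ k" for z :: "'i \<Rightarrow> 'c" and k by (induction k) simp_all
  then show ?thesis by (induction cs) simp_all
qed

text \<open>The equation and divisibility are componentwise; testing \<open>w\<close> against
  functions supported at one point shows that its components are nonzerodivisors.\<close>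

lemma integrally_closed_fun:
  assumes "integrally_closed_type TYPE('c::comm_ring_1)"
  shows "integrally_closed_type TYPE('i \<Rightarrow> 'c)"
  unfolding integrally_closed_type_def
proof (intro allI impI)
  fix cs and a w :: "'i \<Rightarrow> 'c"
  assume w: "non_zero_divisor w" and root: "heval (1 # cs) a w = 0"
  have "w i dvd a i" for i
  proof -
    have "non_zero_divisor (w i)"
      unfolding non_zero_divisor_def
    proof (intro allI impI)
      fix s assume s: "s * w i = 0"
      have "(\<lambda>j. if j = i then s else 0) * w = 0" using s by (auto simp: fun_eq_iff)
      then have "(\<lambda>j. if j = i then s else 0) = 0" using w unfolding non_zero_divisor_def by blast
      from fun_cong[OF this, of i] show "s = 0" by simp
    qed
    moreover have "heval (1 # map (\<lambda>c. c i) cs) (a i) (w i) = 0"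
      using root heval_fun[of "1 # cs" a w i] by simp
    ultimately show ?thesis using assms unfolding integrally_closed_type_def by blast
  qed
  then obtain g where "\<And>i. a i = w i * g i" unfolding dvd_def by metis
  then have "a = w * g" by (auto simp: fun_eq_iff)
  then show "w dvd a" by simp
qed

text \<open>Coefficients of the quotient of \<open>F\<close> by \<open>Y\<^sup>2 - u Y - v\<close>: if \<open>u\<close> and \<open>v\<close> have no constant
  term, then \<open>Q\<^sub>j = F\<^sub>j\<^sub>+\<^sub>2 + u Q\<^sub>j\<^sub>+\<^sub>1 + v Q\<^sub>j\<^sub>+\<^sub>2\<close> determines the coefficients of \<open>X\<^sup>N\<close> from lower ones.\<close>

fun quot_coeff :: "'a::comm_ring_1 fps \<Rightarrow> 'a fps \<Rightarrow> 'a fps fps \<Rightarrow> nat \<Rightarrow> nat \<Rightarrow> 'a" where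
  "quot_coeff u v F N j = F $ (j + 2) $ N +
     (\<Sum>i<N. quot_coeff u v F i (j + 1) * u $ (N - i) + quot_coeff u v F i (j + 2) * v $ (N - i))"

declare quot_coeff.simps [simp del]

definition monic_quadratic :: "'a::comm_ring_1 fps \<Rightarrow> 'a fps \<Rightarrow> 'a fps fps" where
  "monic_quadratic u v = fps_X ^ 2 - fps_const u * fps_X - fps_const v"

lemma mult_monic_quadratic_nth:
  "(Q * monic_quadratic u v) $ 0 = - (v * Q $ 0)"
  "(Q * monic_quadratic u v) $ Suc 0 = - (u * Q $ 0) - v * Q $ Suc 0"
  "(Q * monic_quadratic u v) $ Suc (Suc j) = Q $ j - u * Q $ Suc j - v * Q $ Suc (Suc j)"
proof -
  have "Q * monic_quadratic u v = fps_X ^ 2 * Q - fps_const u * (fps_X * Q) - fps_const v * Q"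
    by (simp add: monic_quadratic_def algebra_simps)
  then show "(Q * monic_quadratic u v) $ 0 = - (v * Q $ 0)"
    "(Q * monic_quadratic u v) $ Suc 0 = - (u * Q $ 0) - v * Q $ Suc 0"
    "(Q * monic_quadratic u v) $ Suc (Suc j) = Q $ j - u * Q $ Suc j - v * Q $ Suc (Suc j)"
    by (simp_all add: fps_X_power_mult_nth)
qed

text \<open>Weierstrass division by a distinguished polynomial of degree 2. The coefficients of
  \<open>F\<close> at \<open>Y^2\<close> and higher prescribe the quotient; those at 1 and
  \<open>Y\<close> then give the remainder.\<close>

lemma monic_quadratic_division:
  assumes "u $ 0 = 0" "v $ 0 = 0"
  shows "\<exists>Q a b. F = Q * monic_quadratic u v + (fps_const a + fps_const b * fps_X)"
proof -
  define Q where "Q = Abs_fps (\<lambda>j. Abs_fps (\<lambda>N. quot_coeff u v F N j))"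
  have mult: "(z * c) $ N = (\<Sum>i<N. z $ i * c $ (N - i))" if "c $ 0 = 0" for z c :: "'a fps" and N
    unfolding fps_mult_nth using that
    by (intro sum.mono_neutral_right) auto
  have Q: "Q $ j = F $ (j + 2) + Q $ (j + 1) * u + Q $ (j + 2) * v" for j
  proof (rule fps_ext)
    fix N
    show "Q $ j $ N = (F $ (j + 2) + Q $ (j + 1) * u + Q $ (j + 2) * v) $ N"
      unfolding fps_add_nth mult[OF assms(1)] mult[OF assms(2)]
      using quot_coeff.simps[of u v F N j] by (simp add: Q_def sum.distrib add.assoc)
  qed
  define a where "a = F $ 0 + v * Q $ 0"
  define b where "b = F $ 1 + u * Q $ 0 + v * Q $ 1"
  have "F = Q * monic_quadratic u v + (fps_const a + fps_const b * fps_X)"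
  proof (rule fps_ext)
    fix j
    consider "j = 0" | "j = 1" | k where "j = Suc (Suc k)" by (metis One_nat_def old.nat.exhaust)
    then show "F $ j = (Q * monic_quadratic u v + (fps_const a + fps_const b * fps_X)) $ j"
    proof cases
      case 1
      show ?thesis unfolding 1 fps_add_nth mult_monic_quadratic_nth(1) by (simp add: a_def)
    next
      case 2
      show ?thesis unfolding 2 One_nat_def fps_add_nth mult_monic_quadratic_nth(2) by (simp add: b_def)
    next
      case (3 k)
      then show ?thesis using Q[of k] by (simp add: mult_monic_quadratic_nth algebra_simps)
    qed
  qed
  then show ?thesis by blast
qed

text \<open>At \<open>Y^2\<close> and higher the product must vanish, which expresses each
  coefficient of \<open>Q\<close> at \<open>X^N\<close> by coefficients at lower powers of
  \<open>X\<close>; so \<open>Q = 0\<close> by induction on \<open>N\<close>.\<close>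

lemma monic_quadratic_remainder_unique:
  assumes uv: "u $ 0 = 0" "v $ 0 = 0"
    and eq: "Q * monic_quadratic u v = fps_const a + fps_const b * fps_X"
  shows "a = 0" "b = 0"
proof -
  have Q: "Q $ j = u * Q $ Suc j + v * Q $ Suc (Suc j)" for j
    using arg_cong[OF eq, of "\<lambda>z. z $ Suc (Suc j)"] by (simp add: mult_monic_quadratic_nth algebra_simps)
  have "Q $ j $ N = 0" for j N
  proof (induction N arbitrary: j rule: less_induct)
    case (less N)
    have z: "(c * Q $ k) $ N = 0" if "c $ 0 = 0" for c k
    proof -
      have "c $ i * Q $ k $ (N - i) = 0" if "i \<in> {0..N}" for i
      proof (cases "i = 0")
        case False
        then show ?thesis using less[of "N - i" k] that by simp
      qed (simp add: \<open>c $ 0 = 0\<close>)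
      then show ?thesis unfolding fps_mult_nth by (intro sum.neutral) blast
    qed
    have "Q $ j $ N = (u * Q $ Suc j) $ N + (v * Q $ Suc (Suc j)) $ N" by (subst Q) simp
    then show ?case using z uv by simp
  qed
  then have "Q $ j = 0" for j by (simp add: fps_eq_iff)
  then have "Q = 0" by (intro fps_ext) simp
  then have "fps_const a + fps_const b * fps_X = 0" using eq by simp
  then have "(fps_const a + fps_const b * fps_X) $ 0 = 0" "(fps_const a + fps_const b * fps_X) $ 1 = 0"
    by (simp_all only: fps_zero_nth)
  then show "a = 0" "b = 0" by simp_all
qed

section \<open>The order as a quotient of a power series ring in two variables\<close>

context quadratic_order
begin

text \<open>Scaling the relation of \<open>\<beta>\<close> by \<open>x^m\<close> gives
  \<open>y^2 = xu y + xv\<close> for \<open>y = x^m \<beta>\<close>, the image of \<open>Y\<close>.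
  As \<open>m \<ge> 1\<close>, both coefficients lack a constant term, which the division
  requires.\<close>

definition xu :: "'b fps" where "xu = fps_X ^ m * u"
definition xv :: "'b fps" where "xv = fps_X ^ (2 * m) * v"
definition y :: 'c where "y = x ^ m * \<beta>"

lemma xu_xv_0: "xu $ 0 = 0" "xv $ 0 = 0"
  using m_pos by (simp_all add: xu_def xv_def fps_X_power_mult_nth)

lemma y_square: "y * y = \<iota> xu * y + \<iota> xv"
proof -
  have xu: "\<iota> xu = x ^ m * \<iota> u" by (simp add: xu_def \<iota>_mult \<iota>_power x_def)
  have xv: "\<iota> xv = x ^ m * x ^ m * \<iota> v" by (simp add: xv_def \<iota>_mult \<iota>_power x_def mult_2 power_add)
  have "y * y = x ^ m * x ^ m * (\<beta> * \<beta>)" by (simp add: y_def mult_ac)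
  then show ?thesis unfolding \<beta>_square xu xv y_def by (simp add: algebra_simps)
qed

text \<open>Substitution of \<open>x\<close> and \<open>y\<close>, defined through the remainder of
  \<open>F\<close> so that no infinite sum in \<open>S\<close> has to be formed.\<close>

definition eval_xy :: "'b fps fps \<Rightarrow> 'c" where
  "eval_xy F = (SOME s. \<exists>Q a b. F = Q * monic_quadratic xu xv + (fps_const a + fps_const b * fps_X) \<and> s = \<iota> a + \<iota> b * y)"

lemma eval_xy_eq:
  assumes "F = Q * monic_quadratic xu xv + (fps_const a + fps_const b * fps_X)"
  shows "eval_xy F = \<iota> a + \<iota> b * y"
  unfolding eval_xy_def
proof (rule some_equality)
  show "\<exists>Q a' b'. F = Q * monic_quadratic xu xv + (fps_const a' + fps_const b' * fps_X) \<and> \<iota> a + \<iota> b * y = \<iota> a' + \<iota> b' * y"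
    using assms by blast
  fix s assume "\<exists>Q a b. F = Q * monic_quadratic xu xv + (fps_const a + fps_const b * fps_X) \<and> s = \<iota> a + \<iota> b * y"
  then obtain Q' a' b' where *: "F = Q' * monic_quadratic xu xv + (fps_const a' + fps_const b' * fps_X)"
    "s = \<iota> a' + \<iota> b' * y" by blast
  have "(Q' - Q) * monic_quadratic xu xv = fps_const (a - a') + fps_const (b - b') * fps_X"
    using *(1) assms by (simp add: algebra_simps flip: fps_const_sub)
  from monic_quadratic_remainder_unique[OF xu_xv_0 this] show "s = \<iota> a + \<iota> b * y" using *(2) by simp
qed

lemma eval_xy_cases:
  obtains Q a b where "F = Q * monic_quadratic xu xv + (fps_const a + fps_const b * fps_X)"
    "eval_xy F = \<iota> a + \<iota> b * y"
  using monic_quadratic_division[OF xu_xv_0, of F] eval_xy_eq by metis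

lemma eval_xy_add: "eval_xy (F + G) = eval_xy F + eval_xy G"
proof -
  obtain Q a b where F: "F = Q * monic_quadratic xu xv + (fps_const a + fps_const b * fps_X)"
    "eval_xy F = \<iota> a + \<iota> b * y" by (rule eval_xy_cases)
  obtain Q' a' b' where G: "G = Q' * monic_quadratic xu xv + (fps_const a' + fps_const b' * fps_X)"
    "eval_xy G = \<iota> a' + \<iota> b' * y" by (rule eval_xy_cases)
  have "F + G = (Q + Q') * monic_quadratic xu xv + (fps_const (a + a') + fps_const (b + b') * fps_X)"
    unfolding F(1) G(1) by (simp add: algebra_simps flip: fps_const_add)
  from eval_xy_eq[OF this] show ?thesis unfolding F(2) G(2) by (simp add: \<iota>_add algebra_simps)
qed

lemma eval_xy_mult: "eval_xy (F * G) = eval_xy F * eval_xy G"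
proof -
  obtain Q a b where F: "F = Q * monic_quadratic xu xv + (fps_const a + fps_const b * fps_X)"
    "eval_xy F = \<iota> a + \<iota> b * y" by (rule eval_xy_cases)
  obtain Q' a' b' where G: "G = Q' * monic_quadratic xu xv + (fps_const a' + fps_const b' * fps_X)"
    "eval_xy G = \<iota> a' + \<iota> b' * y" by (rule eval_xy_cases)
  let ?r = "fps_const a + fps_const b * fps_X" and ?r' = "fps_const a' + fps_const b' * fps_X"
  have "?r * ?r' = fps_const b * fps_const b' * monic_quadratic xu xv +
      (fps_const (a * a' + b * b' * xv) + fps_const (a * b' + a' * b + b * b' * xu) * fps_X)"
    unfolding fps_const_add[symmetric] fps_const_mult[symmetric] monic_quadratic_def
    by (simp add: power2_eq_square algebra_simps del: fps_const_add fps_const_mult)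
  moreover have "(Q * z + r) * (Q' * z + r') = (Q * (Q' * z + r') + r * Q') * z + r * r'" for z r r'
    by (simp add: algebra_simps)
  ultimately have "F * G = (Q * (Q' * monic_quadratic xu xv + ?r') + ?r * Q') * monic_quadratic xu xv +
      (fps_const b * fps_const b' * monic_quadratic xu xv +
      (fps_const (a * a' + b * b' * xv) + fps_const (a * b' + a' * b + b * b' * xu) * fps_X))"
    unfolding F(1) G(1) by (simp only:)
  then have "F * G = (Q * (Q' * monic_quadratic xu xv + ?r') + ?r * Q' + fps_const b * fps_const b') * monic_quadratic xu xv +
      (fps_const (a * a' + b * b' * xv) + fps_const (a * b' + a' * b + b * b' * xu) * fps_X)"
    by (simp only: distrib_right add.assoc)
  from eval_xy_eq[OF this] have "eval_xy (F * G) = \<iota> (a * a' + b * b' * xv) + \<iota> (a * b' + a' * b + b * b' * xu) * y" .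
  also have "\<dots> = \<iota> a * \<iota> a' + (\<iota> a * \<iota> b' + \<iota> a' * \<iota> b) * y + \<iota> b * \<iota> b' * (\<iota> xu * y + \<iota> xv)"
    by (simp add: \<iota>_add \<iota>_mult algebra_simps)
  also have "\<dots> = eval_xy F * eval_xy G"
    unfolding F(2) G(2) y_square[symmetric] by (simp add: algebra_simps)
  finally show ?thesis .
qed

lemma eval_xy_1: "eval_xy 1 = 1"
  using eval_xy_eq[of 1 0 1 0] by (simp add: \<iota>_1 \<iota>_0)

lemma eval_xy_kernel:
  assumes K: "K = UNIV"
  shows "eval_xy F = 0 \<longleftrightarrow> (\<exists>Q. F = Q * monic_quadratic xu xv)"
proof
  assume z: "eval_xy F = 0"
  obtain Q a b where F: "F = Q * monic_quadratic xu xv + (fps_const a + fps_const b * fps_X)"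
    "eval_xy F = \<iota> a + \<iota> b * y" by (rule eval_xy_cases)
  have B: "c \<in> B" for c using K by (simp add: coeffs_in_def)
  have "\<iota> a + \<iota> (b * fps_X ^ m) * \<beta> = 0" using F(2) z by (simp add: y_def x_def \<iota>_mult \<iota>_power mult.assoc)
  then have "a = 0 \<and> b * fps_X ^ m = 0" by (rule independent[OF B B])
  then have "a = 0" "b = 0" by simp_all
  then show "\<exists>Q. F = Q * monic_quadratic xu xv" using F(1) by auto
next
  assume "\<exists>Q. F = Q * monic_quadratic xu xv"
  then obtain Q where "F = Q * monic_quadratic xu xv + (fps_const 0 + fps_const 0 * fps_X)" by auto
  from eval_xy_eq[OF this] show "eval_xy F = 0" by (simp add: \<iota>_0)
qed

lemma eval_xy_range:
  assumes K: "K = UNIV" shows "range eval_xy = R0"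
proof
  have B: "c \<in> B" for c using K by (simp add: coeffs_in_def)
  show "range eval_xy \<subseteq> R0"
  proof
    fix s assume "s \<in> range eval_xy"
    then obtain F where "s = eval_xy F" by blast
    moreover obtain a b where "eval_xy F = \<iota> a + \<iota> b * y" using eval_xy_cases by metis
    ultimately have "s = \<iota> a + x ^ m * (\<iota> b * \<beta>)" by (simp add: y_def mult_ac)
    then show "s \<in> R0" unfolding R0_def using B by blast
  qed
  show "R0 \<subseteq> range eval_xy"
  proof
    fix s assume "s \<in> R0"
    then obtain a b where "s = \<iota> a + x ^ m * (\<iota> b * \<beta>)" by (auto simp: R0_def)
    moreover have "eval_xy (fps_const a + fps_const b * fps_X) = \<iota> a + \<iota> b * y"
      by (rule eval_xy_eq[of _ 0]) simp
    ultimately have "s = eval_xy (fps_const a + fps_const b * fps_X)" by (simp add: y_def mult_ac)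
    then show "s \<in> range eval_xy" by blast
  qed
qed

text \<open>The first isomorphism theorem for \<open>eval_xy\<close>. With \<open>K = UNIV\<close>
  every remainder has its coefficients in \<open>B\<close>, which settles both kernel and
  image.\<close>

theorem quotient_presentation:
  assumes K: "K = UNIV" and ic: "integrally_closed_type TYPE('c)"
  shows "\<exists>f. order_presentation \<iota> K \<beta> u v m
    (ring_of_type_algebra Quot (PIdl\<^bsub>ring_of_type_algebra\<^esub> (monic_quadratic xu xv))) f"
proof -
  let ?A = "ring_of_type_algebra :: 'b fps fps ring" and ?S = "ring_of_type_algebra :: 'c ring"
  let ?I = "PIdl\<^bsub>?A\<^esub> (monic_quadratic xu xv)"
  have A: "cring ?A" "cring ?S" by (rule cring_from_type_algebra)+
  have "eval_xy \<in> ring_hom ?A ?S"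
    by (rule ring_hom_memI) (simp_all add: ring_of_type_algebra_def eval_xy_add eval_xy_mult eval_xy_1)
  then have h: "ring_hom_ring ?A ?S eval_xy"
    by (rule ring_hom_ringI2[OF cring.axioms(1)[OF A(1)] cring.axioms(1)[OF A(2)]])
  have kernel: "a_kernel ?A ?S eval_xy = ?I"
    using eval_xy_kernel[OF K] by (auto simp: a_kernel_def' cgenideal_def ring_of_type_algebra_def)
  define f where "f = (\<lambda>Z. the_elem (eval_xy ` Z))"
  have image: "eval_xy ` carrier ?A = R0" using eval_xy_range[OF K] by (simp add: ring_of_type_algebra_def)
  have f: "f \<in> ring_iso (?A Quot ?I) (?S\<lparr>carrier := R0\<rparr>)"
    using ring_hom_ring.FactRing_iso_set_aux[OF h] unfolding kernel image f_def .
  have I: "ideal ?I ?A" by (rule cring.cgenideal_ideal[OF A(1)]) (simp add: ring_of_type_algebra_def)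
  have Q: "cring (?A Quot ?I)" by (rule ideal.quotient_is_cring[OF I A(1)])
  have "order_presentation \<iota> K \<beta> u v m (?A Quot ?I) f"
  proof (intro order_presentation.intro quadratic_order_axioms Q order_presentation_axioms.intro)
    show "f (a \<otimes>\<^bsub>?A Quot ?I\<^esub> b) = f a * f b"
      if "a \<in> carrier (?A Quot ?I)" "b \<in> carrier (?A Quot ?I)" for a b
      using f that by (simp add: ring_iso_def ring_hom_def ring_of_type_algebra_def[where 'a='c])
    show "f (a \<oplus>\<^bsub>?A Quot ?I\<^esub> b) = f a + f b"
      if "a \<in> carrier (?A Quot ?I)" "b \<in> carrier (?A Quot ?I)" for a b
      using f that by (simp add: ring_iso_def ring_hom_def ring_of_type_algebra_def[where 'a='c])
    show "f \<one>\<^bsub>?A Quot ?I\<^esub> = 1"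
      using f by (simp add: ring_iso_def ring_hom_def ring_of_type_algebra_def[where 'a='c])
    show "inj_on f (carrier (?A Quot ?I))" "f ` carrier (?A Quot ?I) = R0"
      using f by (auto simp: ring_iso_def bij_betw_def)
  qed (rule ic)
  then show ?thesis by blast
qed

end

context order_presentation
begin

theorem zeta_presentation:
  fixes M :: "'i \<Rightarrow> (nat \<Rightarrow> 'c) set" and \<mu> :: "'i \<Rightarrow> rat"
    and \<phi> :: "'i \<Rightarrow> (nat \<Rightarrow> 'c) \<Rightarrow> nat \<Rightarrow> 'c" and d :: "'i \<Rightarrow> nat"
  assumes I: "finite I"
    and M: "\<And>i. i \<in> I \<Longrightarrow> vsub n (M i)" "\<And>i. i \<in> I \<Longrightarrow> vmul x ` vecs n \<subseteq> M i"
      "\<And>i. i \<in> I \<Longrightarrow> idx (M i) (vecs n) = card K ^ d i"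
    and \<phi>: "\<And>i f g. i \<in> I \<Longrightarrow> \<phi> i (f - g) = \<phi> i f - \<phi> i g"
      "\<And>i r f. i \<in> I \<Longrightarrow> \<phi> i (vmul r f) = vmul r (\<phi> i f)"
      "\<And>i. i \<in> I \<Longrightarrow> inj_on (\<phi> i) (vecs n)" "\<And>i. i \<in> I \<Longrightarrow> \<phi> i ` vecs n = M i"
    and moebius: "\<And>L W. vsub n W \<Longrightarrow> finite (cosets W (vecs n)) \<Longrightarrow> L \<subseteq> W \<Longrightarrow> W \<noteq> vecs n \<Longrightarrow>
      (\<Sum>i | i \<in> I \<and> L \<subseteq> M i. \<mu> i) = 0"
  shows "has_zeta R (normalization_power R n)"
    and "(\<Sum>i\<in>I. dconst (\<mu> i) * dir_monom 1 (card K) ^ d i) * module_zeta R (normalization_power R n) =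
      (\<Sum>i\<in>I. dconst (\<mu> i) * (\<Sum>s\<in>int_lists (2 * n) m.
        dconst (Gq (replicate (m - 1) (int (2 * n)) @ [int (2 * n - d i)]) s (of_nat (card K)))
          * dir_monom 1 (card K) ^ nat (int m * int (2 * n) - sum_list s)))"
proof -
  show "has_zeta R (normalization_power R n)"
    by (rule has_zetaI, rule zeta_identity_order(1)[where I = I and M = M and d = d and \<mu> = \<mu> and \<phi> = \<phi>
          and Z = "module_zeta R (normalization_power R n)", OF I M \<phi> moebius dir_nth_module_zeta])
  show "(\<Sum>i\<in>I. dconst (\<mu> i) * dir_monom 1 (card K) ^ d i) * module_zeta R (normalization_power R n) =
      (\<Sum>i\<in>I. dconst (\<mu> i) * (\<Sum>s\<in>int_lists (2 * n) m.
        dconst (Gq (replicate (m - 1) (int (2 * n)) @ [int (2 * n - d i)]) s (of_nat (card K)))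
          * dir_monom 1 (card K) ^ nat (int m * int (2 * n) - sum_list s)))"
    by (rule zeta_identity_order(2)[where I = I and M = M and d = d and \<mu> = \<mu> and \<phi> = \<phi>
          and Z = "module_zeta R (normalization_power R n)", OF I M \<phi> moebius dir_nth_module_zeta])
qed

end

section \<open>The identity when \<open>S\<close> is a single power series ring\<close>

lemma card_field_ge_2: "CARD('f::{field,finite}) \<ge> 2"
proof -
  have "card {0 :: 'f, 1} \<le> CARD('f)" by (rule card_mono) auto
  then show ?thesis by simp
qed

lemma q_not_root_of_unity_card: "q_not_root_of_unity (rat_of_nat CARD('f::{field,finite}))"
  by (rule q_not_root_of_unity_of_nat[OF card_field_ge_2])

lemma qpoch_dirichlet:
  assumes "q_not_root_of_unity (rat_of_nat q)"
  shows "qpoch T (of_nat q) n = (\<Sum>r\<le>n. dconst (qbinom (rat_of_nat q) (int n) (int r)) * (dconst (mu (of_nat q) r) * T ^ r))"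
proof -
  interpret q_not_root_of_unity "rat_of_nat q" by (rule assms)
  show ?thesis
    using qpoch_expand[of dconst T n] by (simp add: dir_monom_add dconst_mult dconst_of_nat mu_def mult.assoc)
qed

definition umods_map :: "nat \<Rightarrow> (nat \<Rightarrow> 'f::{field,finite} fps) set \<Rightarrow> (nat \<Rightarrow> 'f fps) \<Rightarrow> nat \<Rightarrow> 'f fps" where
  "umods_map n M = (SOME \<phi>. (\<forall>f g. \<phi> (f - g) = \<phi> f - \<phi> g) \<and> (\<forall>r f. \<phi> (vmul r f) = vmul r (\<phi> f)) \<and>
    inj_on \<phi> (vecs n) \<and> \<phi> ` vecs n = M)"

lemma umods_map:
  assumes "M \<in> umods n"
  shows "umods_map n M (f - g) = umods_map n M f - umods_map n M g"
    "umods_map n M (vmul r f) = vmul r (umods_map n M f)"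
    "inj_on (umods_map n M) (vecs n)" "umods_map n M ` vecs n = M"
  using someI_ex[OF umods_image[OF assms]] unfolding umods_map_def by blast+

text \<open>Nakayama provides a proper member of \<open>umods\<close> above \<open>L\<close>, and
  then the Moebius sum over all members above \<open>L\<close> cancels.\<close>

lemma umods_moebius_dichotomy:
  fixes W :: "(nat \<Rightarrow> 'f::{field,finite} fps) set"
  assumes W: "vsub n W" "finite (cosets W (vecs n))" "L \<subseteq> W" "W \<noteq> vecs n"
  shows "(\<Sum>M | M \<in> umods n \<and> L \<subseteq> M. mu (rat_of_nat CARD('f)) (codim n M)) = 0"
proof -
  have "\<exists>M\<in>umods n. L \<subseteq> M \<and> M \<noteq> vecs n" using umods_nakayama[OF W(1-3)] W(4) by blast
  then show ?thesis using umods_moebius by blast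
qed

text \<open>Here \<open>e\<close> is the residue degree: 1 in the ramified case, 2 in the inert one.
  Codimension \<open>r\<close> over the residue field means index \<open>card K ^ (e r)\<close>, so
  \<open>t^e\<close> enters the Pochhammer symbol. The hypothesis on \<open>\<iota> fps_X\<close>
  ensures \<open>x P \<subseteq> X P\<close>; it also admits \<open>x = X^2\<close>.\<close>

lemma zeta_fps:
  fixes \<iota> :: "'b::field fps \<Rightarrow> 'f::{field,finite} fps"
  assumes pres: "order_presentation \<iota> K \<beta> u v m R f" and X: "fps_X dvd \<iota> fps_X"
    and card: "CARD('f) = card K ^ e"
  shows "has_zeta R (normalization_power R n)"
    and "qpoch (dir_monom 1 (card K) ^ e) (of_nat CARD('f)) n * module_zeta R (normalization_power R n) =
      (\<Sum>r\<le>n. dconst (qbinom (rat_of_nat CARD('f)) (int n) (int r) * mu (of_nat CARD('f)) r) *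
        (\<Sum>s\<in>int_lists (2 * n) m.
        dconst (Gq (replicate (m - 1) (int (2 * n)) @ [int (2 * n - e * r)]) s (of_nat (card K)))
          * dir_monom 1 (card K) ^ nat (int m * int (2 * n) - sum_list s)))"
proof -
  interpret order_presentation \<iota> K \<beta> u v m R f by (rule pres)
  let ?M = "\<lambda>M :: (nat \<Rightarrow> 'f fps) set. M"
  let ?\<mu> = "\<lambda>M :: (nat \<Rightarrow> 'f fps) set. mu (rat_of_nat CARD('f)) (codim n M)"
  let ?d = "\<lambda>M :: (nat \<Rightarrow> 'f fps) set. e * codim n M"
  obtain z where z: "x = fps_X * z" using X by (auto simp: x_def)
  have M: "vsub n M" "vmul x ` vecs n \<subseteq> M" "idx M (vecs n) = card K ^ ?d M"
    if "M \<in> umods n" for M :: "(nat \<Rightarrow> 'f fps) set"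
  proof -
    show "vsub n M" using that by (simp add: umods_def)
    have "vmul x g \<in> M" if g: "g \<in> vecs n" for g
    proof -
      have "vmul x g = vmul fps_X (vmul z g)" by (simp add: z vmul_simps)
      then show ?thesis using vmul_vecs[OF g, of z] \<open>M \<in> umods n\<close> unfolding umods_def by blast
    qed
    then show "vmul x ` vecs n \<subseteq> M" by blast
    show "idx M (vecs n) = card K ^ ?d M" using idx_umods(1)[OF that] card by (simp add: power_mult)
  qed
  note Z = zeta_presentation[where I = "umods n" and M = ?M and \<mu> = ?\<mu> and \<phi> = "umods_map n" and d = ?d,
      OF finite_umods M umods_map umods_moebius_dichotomy]
  show "has_zeta R (normalization_power R n)" by (rule Z(1))
  let ?H = "\<lambda>r. (\<Sum>s\<in>int_lists (2 * n) m.
        dconst (Gq (replicate (m - 1) (int (2 * n)) @ [int (2 * n - e * r)]) s (of_nat (card K)))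
          * dir_monom (1 :: rat) (card K) ^ nat (int m * int (2 * n) - sum_list s))"
  have "(\<Sum>M\<in>umods n. dconst (?\<mu> M) * dir_monom 1 (card K) ^ ?d M) =
      qpoch (dir_monom 1 (card K) ^ e) (of_nat CARD('f)) n"
    unfolding qpoch_dirichlet[OF q_not_root_of_unity_card]
    using sum_umods[of "\<lambda>r. dconst (mu (rat_of_nat CARD('f)) r) * (dir_monom 1 (card K) ^ e) ^ r" n, where 'f = 'f]
    by (simp add: power_mult)
  moreover have "(\<Sum>M\<in>umods n. dconst (?\<mu> M) * ?H (codim n M)) =
      (\<Sum>r\<le>n. dconst (qbinom (rat_of_nat CARD('f)) (int n) (int r) * mu (of_nat CARD('f)) r) * ?H r)"
    using sum_umods[of "\<lambda>r. dconst (mu (rat_of_nat CARD('f)) r) * ?H r" n, where 'f = 'f]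
    by (simp only: dconst_mult mult.assoc)
  ultimately show "qpoch (dir_monom 1 (card K) ^ e) (of_nat CARD('f)) n * module_zeta R (normalization_power R n) =
      (\<Sum>r\<le>n. dconst (qbinom (rat_of_nat CARD('f)) (int n) (int r) * mu (of_nat CARD('f)) r) * ?H r)"
    using Z(2) by simp
qed

section \<open>The identity when \<open>S\<close> is a product of two power series rings\<close>

definition join :: "(nat \<Rightarrow> 'a) \<Rightarrow> (nat \<Rightarrow> 'a) \<Rightarrow> nat \<Rightarrow> bool \<Rightarrow> 'a" where
  "join a b = (\<lambda>i c. if c then a i else b i)"

definition part :: "bool \<Rightarrow> (nat \<Rightarrow> bool \<Rightarrow> 'a) \<Rightarrow> nat \<Rightarrow> 'a" where
  "part c p = (\<lambda>i. p i c)"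

lemma part_join: "part c (join a b) = (if c then a else b)"
  by (simp add: part_def join_def)

lemma join_part: "join (part True p) (part False p) = p"
  by (auto simp: part_def join_def fun_eq_iff)

lemma part_eqI: "part True p = part True p' \<Longrightarrow> part False p = part False p' \<Longrightarrow> p = p'"
  by (metis join_part)

lemma part_diff: "part c (p - p') = part c p - part c (p' :: nat \<Rightarrow> bool \<Rightarrow> 'a::ab_group_add)"
  by (simp add: part_def fun_eq_iff)

lemma part_add: "part c (p + p') = part c p + part c (p' :: nat \<Rightarrow> bool \<Rightarrow> 'a::ab_group_add)"
  by (simp add: part_def fun_eq_iff)

lemma part_vmul: "part c (vmul r p) = vmul (r c) (part c p)"
  by (simp add: part_def vmul_def fun_eq_iff)

lemma part_vecs: "p \<in> vecs n \<Longrightarrow> part c p \<in> vecs n"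
  by (simp add: part_def vecs_def)

lemma join_vecs: "a \<in> vecs n \<Longrightarrow> b \<in> vecs n \<Longrightarrow> join a b \<in> vecs n"
  by (simp add: join_def vecs_def fun_eq_iff)

definition prod_mod :: "nat \<Rightarrow> (nat \<Rightarrow> 'a::zero) set \<Rightarrow> (nat \<Rightarrow> 'a) set \<Rightarrow> (nat \<Rightarrow> bool \<Rightarrow> 'a) set" where
  "prod_mod n A A' = {p \<in> vecs n. part True p \<in> A \<and> part False p \<in> A'}"

lemma add_subgrp_prod_mod:
  fixes A :: "(nat \<Rightarrow> 'a::ab_group_add) set"
  assumes "add_subgrp A" "add_subgrp A'"
  shows "add_subgrp (prod_mod n A A')"
proof (rule add_subgrpI)
  have 0: "part c 0 = (0 :: nat \<Rightarrow> 'a)" for c by (simp add: part_def fun_eq_iff)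
  show "0 \<in> prod_mod n A A'"
    using assms by (simp add: prod_mod_def 0 add_subgrp_0 add_subgrp_vecs)
  fix p p' assume "p \<in> prod_mod n A A'" "p' \<in> prod_mod n A A'"
  then show "p - p' \<in> prod_mod n A A'"
    using assms by (simp add: prod_mod_def part_diff add_subgrp_diff add_subgrp_vecs)
qed

text \<open>The index is computed through the product of \<open>A\<close> with the full space; each
  of the two steps is seen by one projection.\<close>

lemma idx_prod_mod:
  fixes A :: "(nat \<Rightarrow> 'a::ab_group_add) set"
  assumes A: "add_subgrp A" "A \<subseteq> vecs n" "finite (cosets A (vecs n))"
    and A': "add_subgrp A'" "A' \<subseteq> vecs n" "finite (cosets A' (vecs n))"
  shows "idx (prod_mod n A A') (vecs n) = idx A (vecs n) * idx A' (vecs n)"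
proof -
  have aV: "add_subgrp (vecs n :: (nat \<Rightarrow> 'a) set)" "add_subgrp (vecs n :: (nat \<Rightarrow> bool \<Rightarrow> 'a) set)"
    by (rule add_subgrp_vecs)+
  let ?M = "prod_mod n A A'" and ?M' = "prod_mod n A (vecs n)"
  note sub = add_subgrp_prod_mod[OF A(1) A'(1), of n] add_subgrp_prod_mod[OF A(1) aV(1), of n]
  have 1: "idx ?M ?M' = idx A' (vecs n)" "finite (cosets ?M ?M') \<longleftrightarrow> finite (cosets A' (vecs n))"
  proof -
    have onto: "\<exists>p\<in>?M'. b - part False p \<in> A'" if "b \<in> vecs n" for b
      using that add_subgrp_0[OF A(1)] add_subgrp_0[OF A'(1)] add_subgrp_0[OF aV(1)]
      by (intro bexI[of _ "join 0 b"]) (simp_all add: part_join prod_mod_def join_vecs)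
    show "idx ?M ?M' = idx A' (vecs n)" "finite (cosets ?M ?M') \<longleftrightarrow> finite (cosets A' (vecs n))"
      using cosets_bij[OF sub(1,2) A'(1), where f = "part False" and C' = "vecs n", OF part_diff onto]
      by (auto simp: prod_mod_def)
  qed
  have 2: "idx ?M' (vecs n) = idx A (vecs n)" "finite (cosets ?M' (vecs n)) \<longleftrightarrow> finite (cosets A (vecs n))"
  proof -
    have onto: "\<exists>p\<in>vecs n. b - part True p \<in> A" if "b \<in> vecs n" for b
      using that add_subgrp_0[OF A(1)] add_subgrp_0[OF aV(1)]
      by (intro bexI[of _ "join b 0"]) (simp_all add: part_join join_vecs)
    show "idx ?M' (vecs n) = idx A (vecs n)" "finite (cosets ?M' (vecs n)) \<longleftrightarrow> finite (cosets A (vecs n))"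
      using cosets_bij[OF sub(2) aV(2) A(1), where f = "part True" and C' = "vecs n", OF part_diff onto part_vecs]
      by (auto simp: prod_mod_def part_vecs)
  qed
  have le: "?M \<subseteq> ?M'" "?M' \<subseteq> vecs n" by (auto simp: prod_mod_def part_vecs)
  show ?thesis using cosets_tower[OF sub aV(2) le] 1 2 A(3) A'(3) by simp
qed

text \<open>The modules between \<open>J P\<close> and \<open>P\<close> are products of one module
  for each factor of \<open>S\<close>. Codimensions add and Moebius functions multiply, whence the
  square of the Pochhammer symbol and the double sum.\<close>

lemma zeta_fun:
  fixes \<iota> :: "'b::field fps \<Rightarrow> bool \<Rightarrow> 'f::{field,finite} fps"
  assumes pres: "order_presentation \<iota> K \<beta> u v m R f" and X: "\<And>c. fps_X dvd \<iota> fps_X c"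
    and card: "CARD('f) = card K"
  shows "has_zeta R (normalization_power R n)"
    and "qpoch (dir_monom 1 (card K)) (of_nat CARD('f)) n ^ 2 * module_zeta R (normalization_power R n) =
      (\<Sum>r1\<le>n. \<Sum>r2\<le>n. dconst (qbinom (rat_of_nat CARD('f)) (int n) (int r1) * mu (of_nat CARD('f)) r1) *
        (dconst (qbinom (rat_of_nat CARD('f)) (int n) (int r2) * mu (of_nat CARD('f)) r2) *
        (\<Sum>s\<in>int_lists (2 * n) m.
        dconst (Gq (replicate (m - 1) (int (2 * n)) @ [int (2 * n - (r1 + r2))]) s (of_nat (card K)))
          * dir_monom 1 (card K) ^ nat (int m * int (2 * n) - sum_list s))))"
proof -
  interpret order_presentation \<iota> K \<beta> u v m R f by (rule pres)
  let ?U = "umods n :: (nat \<Rightarrow> 'f fps) set set"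
  let ?\<mu> = "\<lambda>M :: (nat \<Rightarrow> 'f fps) set. mu (rat_of_nat CARD('f)) (codim n M)"
  let ?T = "dir_monom (1 :: rat) (card K)"
  define M where "M i = prod_mod n (fst i) (snd i)" for i :: "(nat \<Rightarrow> 'f fps) set \<times> (nat \<Rightarrow> 'f fps) set"
  define d where "d i = codim n (fst i) + codim n (snd i)" for i :: "(nat \<Rightarrow> 'f fps) set \<times> (nat \<Rightarrow> 'f fps) set"
  define \<phi> where "\<phi> i p = join (umods_map n (fst i) (part True p)) (umods_map n (snd i) (part False p))"
    for i :: "(nat \<Rightarrow> 'f fps) set \<times> (nat \<Rightarrow> 'f fps) set" and p
  have U: "add_subgrp A" "A \<subseteq> vecs n" "\<And>r g. g \<in> A \<Longrightarrow> vmul r g \<in> A" "vmul fps_X ` vecs n \<subseteq> A"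
    if "A \<in> ?U" for A
    using that by (auto simp: umods_def vsub_def)
  have fin: "finite (?U \<times> ?U)" using finite_umods by blast
  have M: "vsub n (M i)" "vmul x ` vecs n \<subseteq> M i" "idx (M i) (vecs n) = card K ^ d i" if i: "i \<in> ?U \<times> ?U" for i
  proof -
    obtain A A' where A: "i = (A, A')" "A \<in> ?U" "A' \<in> ?U" using i by blast
    have MA: "M i = prod_mod n A A'" by (simp add: M_def A(1))
    show "vsub n (M i)"
      unfolding MA vsub_def using add_subgrp_prod_mod[OF U(1)[OF A(2)] U(1)[OF A(3)]] U(3)[OF A(2)] U(3)[OF A(3)]
      by (auto simp: prod_mod_def part_vmul vmul_vecs)
    show "vmul x ` vecs n \<subseteq> M i"
    proof
      fix p assume "p \<in> vmul x ` vecs n"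
      then obtain p' where p': "p' \<in> vecs n" "p = vmul x p'" by blast
      have "vmul (x c) (part c p') \<in> A''" if A'': "A'' \<in> ?U" for A'' c
      proof -
        obtain z where "x c = fps_X * z" using X[of c] by (auto simp: x_def)
        then have "vmul (x c) (part c p') = vmul fps_X (vmul z (part c p'))" by (simp add: vmul_simps)
        moreover have "vmul z (part c p') \<in> vecs n" using vmul_vecs part_vecs p' by blast
        ultimately show ?thesis using U(4)[OF A''] by auto
      qed
      then show "p \<in> M i" unfolding MA using A p' by (simp add: prod_mod_def part_vmul vmul_vecs)
    qed
    show "idx (M i) (vecs n) = card K ^ d i"
      unfolding MA using idx_prod_mod[OF U(1,2)[OF A(2)] idx_umods(3)[OF A(2)] U(1,2)[OF A(3)] idx_umods(3)[OF A(3)]]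
        idx_umods(1)[OF A(2)] idx_umods(1)[OF A(3)] card by (simp add: d_def A(1) power_add)
  qed
  have \<phi>: "\<phi> i (p - p') = \<phi> i p - \<phi> i p'" "\<phi> i (vmul r p) = vmul r (\<phi> i p)"
    "inj_on (\<phi> i) (vecs n)" "\<phi> i ` vecs n = M i" if i: "i \<in> ?U \<times> ?U" for i r p p'
  proof -
    obtain A A' where A: "i = (A, A')" "A \<in> ?U" "A' \<in> ?U" using i by blast
    note h = umods_map[OF A(2)] and h' = umods_map[OF A(3)]
    have part: "part True (\<phi> i p) = umods_map n A (part True p)"
      "part False (\<phi> i p) = umods_map n A' (part False p)" for p
      by (simp_all add: \<phi>_def part_join A(1))
    show "\<phi> i (p - p') = \<phi> i p - \<phi> i p'"
      by (rule part_eqI) (simp_all add: part part_diff h(1) h'(1))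
    show "\<phi> i (vmul r p) = vmul r (\<phi> i p)"
      by (rule part_eqI) (simp_all add: part part_vmul h(2) h'(2))
    show "inj_on (\<phi> i) (vecs n)"
    proof (rule inj_onI)
      fix p p' assume p: "p \<in> vecs n" "p' \<in> vecs n" "\<phi> i p = \<phi> i p'"
      then have "umods_map n A (part True p) = umods_map n A (part True p')"
        "umods_map n A' (part False p) = umods_map n A' (part False p')" by (simp_all flip: part)
      then have "part True p = part True p'" "part False p = part False p'"
        using inj_onD[OF h(3) _ part_vecs part_vecs, OF _ p(1,2)]
          inj_onD[OF h'(3) _ part_vecs part_vecs, OF _ p(1,2)] by blast+
      then show "p = p'" by (rule part_eqI)
    qed
    show "\<phi> i ` vecs n = M i"
    proof
      show "\<phi> i ` vecs n \<subseteq> M i"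
      proof
        fix p assume "p \<in> \<phi> i ` vecs n"
        then obtain p' where p': "p' \<in> vecs n" "p = \<phi> i p'" by blast
        have "umods_map n A (part True p') \<in> A" using h(4) part_vecs[OF p'(1)] by blast
        moreover have "umods_map n A' (part False p') \<in> A'" using h'(4) part_vecs[OF p'(1)] by blast
        moreover have "p \<in> vecs n"
          using calculation U(2)[OF A(2)] U(2)[OF A(3)] unfolding p'(2) \<phi>_def A(1) by (auto intro: join_vecs)
        moreover have "M i = prod_mod n A A'" by (simp add: M_def A(1))
        ultimately show "p \<in> M i" unfolding prod_mod_def p'(2) by (simp add: part)
      qed
      show "M i \<subseteq> \<phi> i ` vecs n"
      proof
        fix p assume "p \<in> M i"
        then have p: "part True p \<in> A" "part False p \<in> A'" by (auto simp: M_def A(1) prod_mod_def)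
        have "part True p \<in> umods_map n A ` vecs n" unfolding h(4) by (rule p(1))
        then obtain a where a: "part True p = umods_map n A a" "a \<in> vecs n" by (rule imageE)
        have "part False p \<in> umods_map n A' ` vecs n" unfolding h'(4) by (rule p(2))
        then obtain b where b: "part False p = umods_map n A' b" "b \<in> vecs n" by (rule imageE)
        have "\<phi> i (join a b) = p" by (rule part_eqI) (simp_all add: part part_join a b)
        then show "p \<in> \<phi> i ` vecs n" using join_vecs[OF a(2) b(2)] by blast
      qed
    qed
  qed
  \<comment> \<open>The sum factors over the two projections of \<open>L\<close>. If
    \<open>W\<close> is proper, then so is one of its projections, and the corresponding factor
    vanishes.\<close>
  have moebius: "(\<Sum>i | i \<in> ?U \<times> ?U \<and> L \<subseteq> M i. ?\<mu> (fst i) * ?\<mu> (snd i)) = 0"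
    if W: "vsub n W" "finite (cosets W (vecs n))" and LW: "L \<subseteq> W" and ne: "W \<noteq> vecs n" for L W
  proof -
    have aW: "add_subgrp W" "W \<subseteq> vecs n" "\<And>r g. g \<in> W \<Longrightarrow> vmul r g \<in> W" using W by (auto simp: vsub_def)
    have aV: "add_subgrp (vecs n :: (nat \<Rightarrow> 'f fps) set)" "add_subgrp (vecs n :: (nat \<Rightarrow> bool \<Rightarrow> 'f fps) set)"
      by (rule add_subgrp_vecs)+
    have Lv: "L \<subseteq> vecs n" using LW aW(2) by blast
    let ?W = "\<lambda>c. part c ` W"
    have Wc: "vsub n (?W c)" "finite (cosets (?W c) (vecs n))" for c
    proof -
      have sub: "add_subgrp (?W c)"
      proof (rule add_subgrpI)
        have "part c 0 = (0 :: nat \<Rightarrow> 'f fps)" by (simp add: part_def fun_eq_iff)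
        then show "0 \<in> ?W c" using add_subgrp_0[OF aW(1)] by (metis imageI)
        fix a b assume "a \<in> ?W c" "b \<in> ?W c"
        then obtain p p' where "p \<in> W" "p' \<in> W" "a = part c p" "b = part c p'" by blast
        then show "a - b \<in> ?W c" using add_subgrp_diff[OF aW(1), of p p'] by (auto simp flip: part_diff)
      qed
      have "vmul r a \<in> ?W c" if a: "a \<in> ?W c" for r a
      proof -
        obtain p where p: "p \<in> W" "a = part c p" using a by blast
        have "vmul r a = part c (vmul (\<lambda>_. r) p)" by (simp add: part_vmul p)
        then show ?thesis using aW(3)[OF p(1)] by blast
      qed
      then show "vsub n (?W c)" using sub aW(2) part_vecs unfolding vsub_def by blast
      \<comment> \<open>The preimage of the projection contains \<open>W\<close>, so it has finite
        index, and the projection has finite index along with it.\<close>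
      let ?W' = "{p \<in> vecs n. part c p \<in> ?W c}"
      have sub': "add_subgrp ?W'"
      proof (rule add_subgrpI)
        have "part c 0 = (0 :: nat \<Rightarrow> 'f fps)" by (simp add: part_def fun_eq_iff)
        then show "0 \<in> ?W'" using add_subgrp_0[OF sub] add_subgrp_0[OF aV(2)] by simp
        fix p p' assume "p \<in> ?W'" "p' \<in> ?W'"
        then show "p - p' \<in> ?W'"
          using add_subgrp_diff[OF sub] add_subgrp_diff[OF aV(2)] by (simp add: part_diff)
      qed
      have "W \<subseteq> ?W'" "?W' \<subseteq> vecs n" using aW(2) by auto
      then have f: "finite (cosets ?W' (vecs n))"
        using cosets_tower(1)[OF aW(1) sub' aV(2)] W(2) by blast
      have onto: "\<exists>p\<in>vecs n. b - part c p \<in> ?W c" if "b \<in> vecs n" for b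
        using that add_subgrp_0[OF sub]
        by (intro bexI[of _ "join b b"]) (simp_all add: part_join join_vecs)
      show "finite (cosets (?W c) (vecs n))"
        using cosets_bij(2)[OF sub' aV(2) sub, where f = "part c" and C' = "vecs n", OF part_diff onto part_vecs] f
        by simp
    qed
    have "\<exists>c. ?W c \<noteq> vecs n"
    proof (rule ccontr)
      assume "\<not> (\<exists>c. ?W c \<noteq> vecs n)"
      then have eq: "?W c = vecs n" for c by blast
      have "p \<in> W" if p: "p \<in> vecs n" for p
      proof -
        obtain a where a: "a \<in> W" "part True a = part True p" using eq[of True] part_vecs[OF p, of True] by (metis imageE)
        obtain b where b: "b \<in> W" "part False b = part False p" using eq[of False] part_vecs[OF p, of False] by (metis imageE)
        \<comment> \<open>The two idempotents of \<open>S\<close> reassemble \<open>p\<close> from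
          elements of \<open>W\<close> that have the right components.\<close>
        let ?e = "\<lambda>c. if c then 1 else 0 :: 'f fps" and ?e' = "\<lambda>c. if c then 0 else 1 :: 'f fps"
        have "p = vmul ?e a + vmul ?e' b"
          by (rule part_eqI) (simp_all add: part_add part_vmul a(2) b(2) vmul_simps)
        then show ?thesis using add_subgrp_add[OF aW(1) aW(3)[OF a(1)] aW(3)[OF b(1)]] by simp
      qed
      then show False using ne aW(2) by blast
    qed
    then obtain c where c: "?W c \<noteq> vecs n" by blast
    let ?S = "\<lambda>c. (\<Sum>A | A \<in> ?U \<and> part c ` L \<subseteq> A. ?\<mu> A)"
    have "part c ` L \<subseteq> ?W c" using LW by blast
    then have S0: "?S c = 0" using umods_moebius_dichotomy[OF Wc(1,2)] c by blast
    have "{i. i \<in> ?U \<times> ?U \<and> L \<subseteq> M i} =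
        {A. A \<in> ?U \<and> part True ` L \<subseteq> A} \<times> {A. A \<in> ?U \<and> part False ` L \<subseteq> A}"
      using Lv by (auto simp: M_def prod_mod_def)
    then have "(\<Sum>i | i \<in> ?U \<times> ?U \<and> L \<subseteq> M i. ?\<mu> (fst i) * ?\<mu> (snd i)) = ?S True * ?S False"
      by (simp add: sum_product sum.cartesian_product case_prod_unfold)
    also have "\<dots> = 0" using S0 by (cases c) auto
    finally show ?thesis .
  qed
  note Z = zeta_presentation[where I = "?U \<times> ?U" and M = M and \<mu> = "\<lambda>i. ?\<mu> (fst i) * ?\<mu> (snd i)" and \<phi> = \<phi> and d = d,
      OF fin M \<phi> moebius]
  show "has_zeta R (normalization_power R n)" by (rule Z(1))
  let ?H = "\<lambda>r. (\<Sum>s\<in>int_lists (2 * n) m.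
        dconst (Gq (replicate (m - 1) (int (2 * n)) @ [int (2 * n - r)]) s (of_nat (card K)))
          * ?T ^ nat (int m * int (2 * n) - sum_list s))"
  let ?q = "\<lambda>r. dconst (qbinom (rat_of_nat CARD('f)) (int n) (int r))"
  let ?m = "\<lambda>r. dconst (mu (rat_of_nat CARD('f)) r)"
  have q: "(\<Sum>A\<in>?U. dconst (?\<mu> A) * ?T ^ codim n A) = qpoch ?T (of_nat CARD('f)) n"
    unfolding qpoch_dirichlet[OF q_not_root_of_unity_card]
    by (rule sum_umods[of "\<lambda>r. ?m r * ?T ^ r" n, where 'f = 'f])
  have eq1: "(\<Sum>i\<in>?U \<times> ?U. dconst (?\<mu> (fst i) * ?\<mu> (snd i)) * ?T ^ d i) = qpoch ?T (of_nat CARD('f)) n ^ 2"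
    unfolding q[symmetric] power2_eq_square sum_product sum.cartesian_product
    by (intro sum.cong) (auto simp: dconst_mult d_def power_add mult_ac)
  have eq2: "(\<Sum>i\<in>?U \<times> ?U. dconst (?\<mu> (fst i) * ?\<mu> (snd i)) * ?H (d i)) =
      (\<Sum>r1\<le>n. \<Sum>r2\<le>n. (?q r1 * ?m r1) * ((?q r2 * ?m r2) * ?H (r1 + r2)))"
  proof -
    have "(\<Sum>i\<in>?U \<times> ?U. dconst (?\<mu> (fst i) * ?\<mu> (snd i)) * ?H (d i)) =
        (\<Sum>A\<in>?U. \<Sum>A'\<in>?U. ?m (codim n A) * (?m (codim n A') * ?H (codim n A + codim n A')))"
      unfolding sum.cartesian_product by (intro sum.cong) (auto simp: dconst_mult d_def mult.assoc)
    also have "\<dots> = (\<Sum>A\<in>?U. \<Sum>r2\<le>n. ?q r2 * (?m (codim n A) * (?m r2 * ?H (codim n A + r2))))"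
      by (intro sum.cong refl sum_umods[of "\<lambda>r2. ?m r * (?m r2 * ?H (r + r2))" n for r, where 'f = 'f])
    also have "\<dots> = (\<Sum>r1\<le>n. ?q r1 * (\<Sum>r2\<le>n. ?q r2 * (?m r1 * (?m r2 * ?H (r1 + r2)))))"
      by (rule sum_umods[of "\<lambda>r1. \<Sum>r2\<le>n. ?q r2 * (?m r1 * (?m r2 * ?H (r1 + r2)))" n, where 'f = 'f])
    also have "\<dots> = (\<Sum>r1\<le>n. \<Sum>r2\<le>n. (?q r1 * ?m r1) * ((?q r2 * ?m r2) * ?H (r1 + r2)))"
      unfolding sum_distrib_left[of "?q r" for r] by (intro sum.cong refl) (simp only: mult_ac)
    finally show ?thesis .
  qed
  have "qpoch ?T (of_nat CARD('f)) n ^ 2 * module_zeta R (normalization_power R n) =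
      (\<Sum>r1\<le>n. \<Sum>r2\<le>n. (?q r1 * ?m r1) * ((?q r2 * ?m r2) * ?H (r1 + r2)))"
    using Z(2) unfolding eq1 eq2 .
  then show "qpoch ?T (of_nat CARD('f)) n ^ 2 * module_zeta R (normalization_power R n) =
      (\<Sum>r1\<le>n. \<Sum>r2\<le>n. dconst (qbinom (rat_of_nat CARD('f)) (int n) (int r1) * mu (of_nat CARD('f)) r1) *
        (dconst (qbinom (rat_of_nat CARD('f)) (int n) (int r2) * mu (of_nat CARD('f)) r2) * ?H (r1 + r2)))"
    by (simp only: dconst_mult)
qed

section \<open>The ramified, split and inert orders\<close>

lemma fps_compose_X_square_nth:
  "(a oo fps_X ^ 2) $ j = (if even j then a $ (j div 2) else (0 :: 'a::comm_ring_1))"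
proof -
  have "(a oo fps_X ^ 2) $ j = (\<Sum>i=0..j. if 2 * i = j then a $ i else 0)"
    unfolding fps_compose_nth by (intro sum.cong) (auto simp: fps_X_power_nth simp flip: power_mult)
  also have "\<dots> = (\<Sum>i\<in>{i. i \<le> j \<and> 2 * i = j}. a $ i)"
    by (subst sum.If_cases) (auto intro!: sum.cong)
  also have "{i. i \<le> j \<and> 2 * i = j} = (if even j then {j div 2} else {})" by auto
  finally show ?thesis by simp
qed

text \<open>\<open>S\<close> is \<open>k[[T]]\<close> with \<open>x = T^2\<close> and
  \<open>\<beta> = T\<close>; the coordinates are the even and the odd part of a series. Then
  \<open>y = T^(2m+1)\<close>, the usual parametrisation of the cusp.\<close>

lemma quadratic_order_ramified:
  assumes "m \<ge> 1"
  shows "quadratic_order (\<lambda>a :: 'a::{field,finite} fps. a oo fps_X ^ 2) UNIV fps_X 0 fps_X m"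
proof
  fix s :: "'a fps"
  have "s = (Abs_fps (\<lambda>i. s $ (2 * i)) oo fps_X ^ 2) + (Abs_fps (\<lambda>i. s $ (2 * i + 1)) oo fps_X ^ 2) * fps_X"
  proof (rule fps_ext)
    fix j show "s $ j = ((Abs_fps (\<lambda>i. s $ (2 * i)) oo fps_X ^ 2) + (Abs_fps (\<lambda>i. s $ (2 * i + 1)) oo fps_X ^ 2) * fps_X) $ j"
      by (cases "even j") (auto simp: fps_compose_X_square_nth elim!: oddE)
  qed
  then show "\<exists>f\<in>coeffs_in UNIV. \<exists>g\<in>coeffs_in UNIV. s = (f oo fps_X ^ 2) + (g oo fps_X ^ 2) * fps_X"
    by (auto simp: coeffs_in_def)
next
  fix f g :: "'a fps"
  assume eq: "(f oo fps_X ^ 2) + (g oo fps_X ^ 2) * fps_X = 0"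
  have "f $ j = 0" for j
    using arg_cong[OF eq, of "\<lambda>z. z $ (2 * j)"] by (auto simp: fps_compose_X_square_nth split: if_splits)
  moreover have "g $ j = 0" for j
    using arg_cong[OF eq, of "\<lambda>z. z $ (2 * j + 1)"] by (auto simp: fps_compose_X_square_nth split: if_splits)
  ultimately show "f = 0 \<and> g = 0" by (simp add: fps_eq_iff)
next
  show "fps_X * fps_X = ((0 :: 'a fps) oo fps_X ^ 2) * fps_X + (fps_X oo fps_X ^ 2)"
    by (simp add: power2_eq_square)
qed (use assms in \<open>auto simp: coeffs_in_def add_subgrp_def fps_compose_add_distrib fps_compose_mult_distrib\<close>)

lemma ramified_presentation:
  assumes "m \<ge> 1"
  shows "\<exists>f. order_presentation (\<lambda>a :: 'a::{field,finite} fps. a oo fps_X ^ 2) UNIV fps_X 0 fps_X m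
    (ramified_ring m :: 'a fps fps set ring) f"
proof -
  interpret quadratic_order "\<lambda>a :: 'a fps. a oo fps_X ^ 2" UNIV fps_X 0 fps_X m
    by (rule quadratic_order_ramified[OF assms])
  have xu: "xu = 0" by (simp add: xu_def)
  have xv: "xv = fps_X ^ (2 * m + 1)" by (simp add: xv_def mult.commute)
  have "monic_quadratic xu xv = pY ^ 2 - pX ^ (2 * m + 1)"
    unfolding monic_quadratic_def xu xv pX_def pY_def fps_const_power by simp
  then show ?thesis
    using quotient_presentation[OF refl integrally_closed_fps] unfolding ramified_ring_def by (simp only:)
qed

text \<open>\<open>S\<close> is the product of the two branches, with \<open>B\<close> embedded
  diagonally and \<open>\<beta>\<close> the idempotent of one branch. Then
  \<open>y = x^m \<beta>\<close> is 0 on the branch \<open>Y = 0\<close> and \<open>x^m\<close> on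
  the branch \<open>Y = X^m\<close>.\<close>

lemma quadratic_order_split:
  assumes "m \<ge> 1"
  shows "quadratic_order (\<lambda>(a :: 'a::{field,finite} fps) (_ :: bool). a) UNIV (\<lambda>c. if c then 0 else 1) 1 0 m"
proof
  fix s :: "bool \<Rightarrow> 'a fps"
  have "s = (\<lambda>_. s True) + (\<lambda>_. s False - s True) * (\<lambda>c. if c then 0 else 1)" by (auto simp: fun_eq_iff)
  then show "\<exists>f\<in>coeffs_in UNIV. \<exists>g\<in>coeffs_in UNIV. s = (\<lambda>_. f) + (\<lambda>_. g) * (\<lambda>c. if c then 0 else 1)"
    by (auto simp: coeffs_in_def)
next
  fix f g :: "'a fps"
  assume eq: "(\<lambda>_. f) + (\<lambda>_. g) * (\<lambda>c. if c then 0 else 1) = (0 :: bool \<Rightarrow> 'a fps)"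
  show "f = 0 \<and> g = 0" using fun_cong[OF eq, of True] fun_cong[OF eq, of False] by simp
qed (use assms in \<open>auto simp: coeffs_in_def add_subgrp_def fun_eq_iff\<close>)

lemma split_presentation:
  assumes "m \<ge> 1"
  shows "\<exists>f. order_presentation (\<lambda>(a :: 'a::{field,finite} fps) (_ :: bool). a) UNIV (\<lambda>c. if c then 0 else 1) 1 0 m
    (split_ring m :: 'a fps fps set ring) f"
proof -
  interpret quadratic_order "\<lambda>(a :: 'a fps) (_ :: bool). a" UNIV "\<lambda>c. if c then 0 else 1" 1 0 m
    by (rule quadratic_order_split[OF assms])
  have xu: "xu = fps_X ^ m" by (simp add: xu_def)
  have xv: "xv = 0" by (simp add: xv_def)
  have "monic_quadratic xu xv = pY * (pY - pX ^ m)"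
    unfolding monic_quadratic_def xu xv pX_def pY_def fps_const_power
    by (simp add: power2_eq_square right_diff_distrib mult.commute)
  then show ?thesis
    using quotient_presentation[OF refl integrally_closed_fun[OF integrally_closed_fps]]
    unfolding split_ring_def by (simp only:)
qed

context quadratic_order
begin

lemma R0_iff: "r \<in> R0 \<longleftrightarrow> (\<exists>f\<in>B. \<exists>s. r = \<iota> f + x ^ m * s)"
proof
  assume "\<exists>f\<in>B. \<exists>s. r = \<iota> f + x ^ m * s"
  then obtain f s where fs: "f \<in> B" "r = \<iota> f + x ^ m * s" by blast
  have "r = \<iota> (f + fps_X ^ m * coord1 s) + x ^ m * (\<iota> (coord2 s) * \<beta>)"
    unfolding fs(2) by (subst coords(3)[of s, symmetric]) (simp add: x_def \<iota>_add \<iota>_mult \<iota>_power algebra_simps)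
  moreover have "f + fps_X ^ m * coord1 s \<in> B"
    using add_subgrp_add[OF add_subgrp_B fs(1) B_mult[OF X_power_B coords(1)]] .
  ultimately show "r \<in> R0" unfolding R0_def using coords(2) by blast
qed (auto simp: R0_def)

lemma R0_mult: "r \<in> R0 \<Longrightarrow> r' \<in> R0 \<Longrightarrow> r * r' \<in> R0"
proof -
  assume "r \<in> R0" "r' \<in> R0"
  then obtain f s f' s' where *: "f \<in> B" "r = \<iota> f + x ^ m * s" "f' \<in> B" "r' = \<iota> f' + x ^ m * s'"
    unfolding R0_iff by blast
  have "r * r' = \<iota> (f * f') + x ^ m * (s * \<iota> f' + \<iota> f * s' + x ^ m * s * s')"
    unfolding *(2,4) by (simp add: \<iota>_mult algebra_simps)
  then show ?thesis unfolding R0_iff using B_mult[OF *(1,3)] by blast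
qed

lemma add_subgrp_R0: "add_subgrp R0"
proof (rule add_subgrpI)
  show "0 \<in> R0" using \<iota>_in_R0[OF add_subgrp_0[OF add_subgrp_B]] by (simp add: \<iota>_0)
  fix r r' assume "r \<in> R0" "r' \<in> R0"
  then obtain f s f' s' where *: "f \<in> B" "r = \<iota> f + x ^ m * s" "f' \<in> B" "r' = \<iota> f' + x ^ m * s'"
    unfolding R0_iff by blast
  have "r - r' = \<iota> (f - f') + x ^ m * (s - s')"
    unfolding *(2,4) by (simp add: \<iota>_diff algebra_simps)
  then show "r - r' \<in> R0" unfolding R0_iff using add_subgrp_diff[OF add_subgrp_B *(1,3)] by blast
qed

text \<open>In the inert case the ring is the subring itself and not a quotient, so the ring axioms
  must come from closure of \<open>R0\<close>.\<close>

lemma cring_R0: "cring (ring_of_type_algebra\<lparr>carrier := R0\<rparr>)"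
proof -
  have car: "carrier ring_of_type_algebra = (UNIV :: 'c set)" by (simp add: ring_of_type_algebra_def)
  have A: "cring (ring_of_type_algebra :: 'c ring)" by (rule cring_from_type_algebra)
  have inv: "\<ominus>\<^bsub>ring_of_type_algebra\<^esub> h = - h" for h :: 'c
  proof (rule abelian_group.minus_equality)
    show "abelian_group (ring_of_type_algebra :: 'c ring)"
      by (rule ring.is_abelian_group[OF cring.axioms(1)[OF A]])
  qed (simp_all add: ring_of_type_algebra_def)
  have "subring R0 (ring_of_type_algebra :: 'c ring)"
  proof (rule ring.subringI[OF cring.axioms(1)[OF A]])
    show "\<one>\<^bsub>ring_of_type_algebra\<^esub> \<in> R0"
      using \<iota>_in_R0[of 1] X_power_B[of 0] by (simp add: ring_of_type_algebra_def \<iota>_1)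
  qed (simp_all add: inv car add_subgrp_minus[OF add_subgrp_R0], simp_all add: ring_of_type_algebra_def R0_mult
      add_subgrp_add[OF add_subgrp_R0])
  then show ?thesis
    using ring.subcring_iff[OF cring.axioms(1)[OF A]] cring.subcringI'[OF A] by (simp add: car)
qed

end

text \<open>Any \<open>\<alpha>\<close> outside \<open>k\<close> gives a basis of the large field
  over \<open>k\<close>, and its quadratic equation, with constant coefficients, serves as the
  relation of \<open>\<beta>\<close>.\<close>

lemma inert_presentation:
  fixes k :: "'b::{field,finite} set"
  assumes m: "m \<ge> 1" and k: "subfield k (ring_of_type_algebra :: 'b ring)" and card: "CARD('b) = card k ^ 2"
  shows "\<exists>\<beta> u v f. order_presentation (\<lambda>a. a) k \<beta> u v m (inert_ring k m) f"
proof -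
  let ?A = "ring_of_type_algebra :: 'b ring"
  have A: "ring ?A" by (rule ring_from_type_algebra)
  note sr = subringE[OF subfieldE(1)[OF k]]
  have k0: "0 \<in> k" and k1: "1 \<in> k" using sr(2,3) by (simp_all add: ring_of_type_algebra_def)
  have k_mult: "a * b \<in> k" and k_add: "a + b \<in> k" if "a \<in> k" "b \<in> k" for a b
    using sr(6)[OF that] sr(7)[OF that] by (simp_all add: ring_of_type_algebra_def)
  have neg: "- a \<in> k" if "a \<in> k" for a
  proof -
    have "\<ominus>\<^bsub>?A\<^esub> a = - a"
      by (rule abelian_group.minus_equality[OF ring.is_abelian_group[OF A]])
        (simp_all add: ring_of_type_algebra_def)
    then show ?thesis using sr(5)[OF that] by simp
  qed
  have k_diff: "a - b \<in> k" if "a \<in> k" "b \<in> k" for a b using k_add[OF that(1) neg[OF that(2)]] by simp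
  have k_inv: "inverse a \<in> k" if a: "a \<in> k" for a
  proof (cases "a = 0")
    case False
    then have "a \<in> k - {\<zero>\<^bsub>?A\<^esub>}" using a by (simp add: ring_of_type_algebra_def)
    note i = ring.subfield_m_inv[OF A k this]
    have "a * (inv\<^bsub>?A\<^esub> a) = 1" using i(2) by (simp add: ring_of_type_algebra_def)
    then have "inverse a = inv\<^bsub>?A\<^esub> a" by (rule inverse_unique)
    then show ?thesis using i(1) by simp
  qed (use k0 in simp)
  have fin: "finite k" by simp
  have "card {0 :: 'b, 1} \<le> card k" using k0 k1 by (intro card_mono) auto
  then have k2: "card k \<ge> 2" by simp
  have "k \<noteq> UNIV"
  proof
    assume "k = UNIV"
    then show False using card k2 by (simp add: power2_eq_square)
  qed
  then obtain \<alpha> where \<alpha>: "\<alpha> \<notin> k" by blast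
  have indep: "a = 0 \<and> b = 0" if ab: "a \<in> k" "b \<in> k" "a + b * \<alpha> = 0" for a b
  proof (cases "b = 0")
    case False
    then have "\<alpha> = - a * inverse b" using ab(3) by (simp add: field_simps eq_neg_iff_add_eq_0)
    then show ?thesis using \<alpha> k_mult[OF neg[OF ab(1)] k_inv[OF ab(2)]] by simp
  qed (use ab in simp)
  have inj: "inj_on (\<lambda>(a, b). a + b * \<alpha>) (k \<times> k)"
  proof (rule inj_onI, clarsimp)
    fix a b a' b' assume *: "a \<in> k" "b \<in> k" "a' \<in> k" "b' \<in> k" "a + b * \<alpha> = a' + b' * \<alpha>"
    then have "(a - a') + (b - b') * \<alpha> = 0" by (simp add: algebra_simps)
    then show "a = a' \<and> b = b'" using indep[OF k_diff k_diff, of a a' b b'] * by simp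
  qed
  \<comment> \<open>Injectivity on \<open>k \<times> k\<close> together with equal cardinalities
    takes the place of a degree argument.\<close>
  have surj: "(\<lambda>(a, b). a + b * \<alpha>) ` (k \<times> k) = UNIV"
    by (rule card_subset_eq) (simp_all add: card_image[OF inj] card_cartesian_product card power2_eq_square)
  have "\<exists>a b. a \<in> k \<and> b \<in> k \<and> c = a + b * \<alpha>" for c
  proof -
    have "c \<in> (\<lambda>(a, b). a + b * \<alpha>) ` (k \<times> k)" unfolding surj by simp
    then show ?thesis by fast
  qed
  \<comment> \<open>\<open>p\<close> and \<open>r\<close> are the coordinates with respect to 1 and
    \<open>\<alpha>\<close>; those of the square of \<open>\<alpha>\<close> become \<open>v\<close>
    and \<open>u\<close>.\<close>
  then obtain p r where pr: "\<And>c. p c \<in> k" "\<And>c. r c \<in> k" "\<And>c. c = p c + r c * \<alpha>" by metis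
  interpret quadratic_order "\<lambda>a :: 'b fps. a" k "fps_const \<alpha>" "fps_const (r (\<alpha> * \<alpha>))" "fps_const (p (\<alpha> * \<alpha>))" m
  proof
    show "add_subgrp k" using k0 k_diff by (auto simp: add_subgrp_def)
    show "fps_const \<alpha> * fps_const \<alpha> = fps_const (r (\<alpha> * \<alpha>)) * fps_const \<alpha> + fps_const (p (\<alpha> * \<alpha>))"
      using pr(3)[of "\<alpha> * \<alpha>"] by (simp add: add.commute)
    show "fps_const (r (\<alpha> * \<alpha>)) \<in> coeffs_in k" "fps_const (p (\<alpha> * \<alpha>)) \<in> coeffs_in k"
      using pr k0 by (auto simp: coeffs_in_def)
    show "\<exists>f\<in>coeffs_in k. \<exists>g\<in>coeffs_in k. s = f + g * fps_const \<alpha>" for s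
    proof (intro bexI)
      show "s = Abs_fps (\<lambda>i. p (s $ i)) + Abs_fps (\<lambda>i. r (s $ i)) * fps_const \<alpha>"
        using pr(3) by (intro fps_ext) simp
    qed (use pr in \<open>auto simp: coeffs_in_def\<close>)
    fix f g assume fg: "f \<in> coeffs_in k" "g \<in> coeffs_in k" "f + g * fps_const \<alpha> = 0"
    have "f $ i = 0 \<and> g $ i = 0" for i
      using indep[of "f $ i" "g $ i"] fg(1,2) arg_cong[OF fg(3), of "\<lambda>z. z $ i"] by (simp add: coeffs_in_def)
    then show "f = 0 \<and> g = 0" by (simp add: fps_eq_iff)
  qed (use k1 k_mult k_inv m in auto)
  have "{a + fps_X ^ m * b | a b. \<forall>i. a $ i \<in> k} = R0"
    using R0_iff unfolding coeffs_in_def x_def by blast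
  then have R: "inert_ring k m = ring_of_type_algebra\<lparr>carrier := R0\<rparr>" by (simp add: inert_ring_def)
  have "order_presentation (\<lambda>a :: 'b fps. a) k (fps_const \<alpha>) (fps_const (r (\<alpha> * \<alpha>))) (fps_const (p (\<alpha> * \<alpha>))) m
      (inert_ring k m) (\<lambda>a. a)"
    unfolding R
  proof (intro order_presentation.intro quadratic_order_axioms cring_R0 order_presentation_axioms.intro
      integrally_closed_fps)
  qed (simp_all add: ring_of_type_algebra_def)
  then show ?thesis by blast
qed

section \<open>From sums over all integers and tuples to finite sums\<close>

lemma Gq_support:
  assumes "k \<ge> 2" and s: "Gq (replicate (m - 1) (2 * int n) @ [c]) s (rat_of_nat k) \<noteq> 0"
    and len: "length s = m" and m: "m \<ge> 1" and c: "c \<le> 2 * int n"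
  shows "s \<in> int_lists (2 * n) m"
proof -
  interpret q_not_root_of_unity "rat_of_nat k" by (rule q_not_root_of_unity_of_nat[OF assms(1)])
  have "set s \<subseteq> {0..2 * int n}"
    by (rule Gend_nonzero[OF s[unfolded Gq_eq_Gend]]) (use len m c in auto)
  moreover have "z \<in> int ` {..2 * n}" if "z \<in> {0..2 * int n}" for z
    using that by (intro image_eqI[of _ _ "nat z"]) auto
  ultimately show ?thesis using len by (auto simp: int_lists_def)
qed

text \<open>\<open>Sum_any\<close> requires finite support: the coefficient \<open>A\<close> bounds
  \<open>r\<close>, and nonvanishing of \<open>Gq\<close> then confines \<open>s\<close> to
  \<open>int_lists\<close>.\<close>

lemma Sum_any_single:
  assumes k: "k \<ge> 2" and m: "m \<ge> 1"
    and A: "\<And>r. A r \<noteq> 0 \<Longrightarrow> 0 \<le> r \<and> r \<le> int n"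
    and c: "\<And>r. 0 \<le> r \<Longrightarrow> r \<le> int n \<Longrightarrow> c r \<le> 2 * int n"
  shows "Sum_any (\<lambda>(r, s). if length s = m then
      dir_monom (A r * Gq (replicate (m - 1) (2 * int n) @ [c r]) s (rat_of_nat k)) 1 * T ^ nat (e - sum_list s) else 0) =
    (\<Sum>r\<le>n. dconst (A (int r)) * (\<Sum>s\<in>int_lists (2 * n) m.
      dconst (Gq (replicate (m - 1) (2 * int n) @ [c (int r)]) s (of_nat k)) * T ^ nat (e - sum_list s)))"
    (is "Sum_any ?F = _")
proof -
  let ?S = "int_lists (2 * n) m"
  have "Sum_any ?F = sum ?F (int ` {..n} \<times> ?S)"
  proof (rule Sum_any.expand_superset)
    show "finite (int ` {..n} \<times> ?S)" using finite_int_lists by blast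
    show "{a. ?F a \<noteq> 0} \<subseteq> int ` {..n} \<times> ?S"
    proof (rule subrelI)
      fix r s assume "(r, s) \<in> {a. ?F a \<noteq> 0}"
      then have nz: "?F (r, s) \<noteq> 0" by blast
      then have len: "length s = m" by (simp split: if_splits)
      then have "A r * Gq (replicate (m - 1) (2 * int n) @ [c r]) s (rat_of_nat k) \<noteq> 0" using nz by auto
      then have "A r \<noteq> 0" "Gq (replicate (m - 1) (2 * int n) @ [c r]) s (rat_of_nat k) \<noteq> 0" by simp_all
      moreover from this have r: "0 \<le> r" "r \<le> int n" using A by auto
      ultimately have "s \<in> ?S" using Gq_support[OF k _ len m c] by blast
      moreover have "r \<in> int ` {..n}" using r by (intro image_eqI[of _ _ "nat r"]) auto
      ultimately show "(r, s) \<in> int ` {..n} \<times> ?S" by blast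
    qed
  qed
  also have "\<dots> = (\<Sum>r\<in>int ` {..n}. \<Sum>s\<in>?S. ?F (r, s))" by (simp only: sum.cartesian_product)
      (simp only: case_prod_unfold prod.collapse)
  also have "\<dots> = (\<Sum>r\<le>n. \<Sum>s\<in>?S. ?F (int r, s))" by (subst sum.reindex) (simp_all add: o_def)
  also have "\<dots> = (\<Sum>r\<le>n. dconst (A (int r)) * (\<Sum>s\<in>?S.
      dconst (Gq (replicate (m - 1) (2 * int n) @ [c (int r)]) s (of_nat k)) * T ^ nat (e - sum_list s)))"
    unfolding sum_distrib_left by (intro sum.cong refl) (simp add: int_lists_def dconst_mult mult.assoc)
  finally show ?thesis .
qed

lemma Sum_any_double:
  assumes k: "k \<ge> 2" and m: "m \<ge> 1"
    and A: "\<And>r r'. A r r' \<noteq> 0 \<Longrightarrow> 0 \<le> r \<and> r \<le> int n \<and> 0 \<le> r' \<and> r' \<le> int n"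
    and c: "\<And>r r'. 0 \<le> r \<Longrightarrow> 0 \<le> r' \<Longrightarrow> c r r' \<le> 2 * int n"
  shows "Sum_any (\<lambda>(r, r', s). if length s = m then
      dir_monom (A r r' * Gq (replicate (m - 1) (2 * int n) @ [c r r']) s (rat_of_nat k)) 1 * T ^ nat (e - sum_list s) else 0) =
    (\<Sum>r\<le>n. \<Sum>r'\<le>n. dconst (A (int r) (int r')) * (\<Sum>s\<in>int_lists (2 * n) m.
      dconst (Gq (replicate (m - 1) (2 * int n) @ [c (int r) (int r')]) s (of_nat k)) * T ^ nat (e - sum_list s)))"
    (is "Sum_any ?F = _")
proof -
  let ?S = "int_lists (2 * n) m"
  have "Sum_any ?F = sum ?F (int ` {..n} \<times> int ` {..n} \<times> ?S)"
  proof (rule Sum_any.expand_superset)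
    show "finite (int ` {..n} \<times> int ` {..n} \<times> ?S)" using finite_int_lists by blast
    show "{a. ?F a \<noteq> 0} \<subseteq> int ` {..n} \<times> int ` {..n} \<times> ?S"
    proof (rule subsetI, elim CollectE)
      fix a assume nz': "?F a \<noteq> 0"
      obtain r r' s where a: "a = (r, r', s)" by (rule prod_cases3)
      have nz: "?F (r, r', s) \<noteq> 0" using nz' unfolding a .
      then have len: "length s = m" by (simp split: if_splits)
      then have "A r r' * Gq (replicate (m - 1) (2 * int n) @ [c r r']) s (rat_of_nat k) \<noteq> 0" using nz by auto
      then have "A r r' \<noteq> 0" "Gq (replicate (m - 1) (2 * int n) @ [c r r']) s (rat_of_nat k) \<noteq> 0" by simp_all
      moreover from this have r: "0 \<le> r" "r \<le> int n" "0 \<le> r'" "r' \<le> int n" using A by auto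
      ultimately have "s \<in> ?S" using Gq_support[OF k _ len m c] by blast
      moreover have "r \<in> int ` {..n}" using r by (intro image_eqI[of _ _ "nat r"]) auto
      moreover have "r' \<in> int ` {..n}" using r by (intro image_eqI[of _ _ "nat r'"]) auto
      ultimately show "a \<in> int ` {..n} \<times> int ` {..n} \<times> ?S" unfolding a by blast
    qed
  qed
  also have "\<dots> = (\<Sum>r\<in>int ` {..n}. \<Sum>r'\<in>int ` {..n}. \<Sum>s\<in>?S. ?F (r, r', s))"
    by (simp only: sum.cartesian_product) (simp only: case_prod_unfold prod.collapse)
  also have "\<dots> = (\<Sum>r\<le>n. \<Sum>r'\<le>n. \<Sum>s\<in>?S. ?F (int r, int r', s))"
    by (simp only: sum.reindex[OF inj_on_of_nat] o_def)
  also have "\<dots> = (\<Sum>r\<le>n. \<Sum>r'\<le>n. dconst (A (int r) (int r')) * (\<Sum>s\<in>?S.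
      dconst (Gq (replicate (m - 1) (2 * int n) @ [c (int r) (int r')]) s (of_nat k)) * T ^ nat (e - sum_list s)))"
    unfolding sum_distrib_left by (intro sum.cong refl) (simp add: int_lists_def dconst_mult mult.assoc)
  finally show ?thesis .
qed

lemma mu_powi: "mu (Q :: 'a::field) r = (-1) powi int r * Q powi (int r * (int r - 1) div 2)"
proof -
  have "int r * (int r - 1) div 2 = int (r * (r - 1) div 2)"
    by (cases r) (simp_all add: zdiv_int algebra_simps)
  then show ?thesis by (simp add: mu_def)
qed

text \<open>For the residue field with \<open>q^2\<close> elements the exponent
  \<open>r(r-1)/2\<close> doubles to \<open>r^2 - r\<close>.\<close>

lemma mu_square: "mu (Q ^ 2 :: 'a::field) r = (-1) powi int r * Q powi (int r ^ 2 - int r)"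
proof -
  have "r * (r - 1) = 2 * (r * (r - 1) div 2)" by (cases r) auto
  moreover have "int r ^ 2 - int r = int (r * (r - 1))"
    by (cases r) (simp_all add: power2_eq_square algebra_simps)
  ultimately have "int r ^ 2 - int r = int (2 * (r * (r - 1) div 2))" by simp
  then show ?thesis unfolding mu_def by (simp only: power_int_of_nat power_mult)
qed

lemma qbinom_nonzeroD: "qbinom Q n r * a * b \<noteq> 0 \<Longrightarrow> 0 \<le> r \<and> r \<le> n"
  by (simp add: qbinom_def split: if_splits)

lemma qbinom_mult_nonzeroD:
  "qbinom Q n r * qbinom Q n r' * a * b \<noteq> 0 \<Longrightarrow> 0 \<le> r \<and> r \<le> n \<and> 0 \<le> r' \<and> r' \<le> n"
  by (simp add: qbinom_def split: if_splits)

text \<open>On the support all entries of \<open>s\<close> are at most \<open>2n\<close>, so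
  \<open>|s| \<le> 2mn\<close> and \<open>nat\<close> truncates no exponent that counts.\<close>

lemma zeta_ramified:
  assumes m: "m \<ge> 1" and q: "CARD('a::{field,finite}) = q"
  defines "R \<equiv> (ramified_ring m :: 'a fps fps set ring)"
  shows "has_zeta R (normalization_power R n)"
    and "qpoch (dir_monom 1 q) (of_nat q) n * module_zeta R (normalization_power R n) =
      Sum_any (\<lambda>(r, s). if length s = m then
        dir_monom (qbinom (rat_of_nat q) (int n) r * (-1) powi r * rat_of_nat q powi (r * (r - 1) div 2) *
            Gq (replicate (m - 1) (2 * int n) @ [2 * int n - r]) s (rat_of_nat q)) 1 *
          dir_monom 1 q ^ nat (2 * int m * int n - sum_list s)
        else 0)" (is "?lhs = ?rhs")
proof -
  obtain f where f: "order_presentation (\<lambda>a :: 'a fps. a oo fps_X ^ 2) UNIV fps_X 0 fps_X m R f"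
    using ramified_presentation[OF m] unfolding R_def by blast
  have X: "fps_X dvd (fps_X :: 'a fps) oo fps_X ^ 2" by (simp add: power2_eq_square)
  have c: "CARD('a) = CARD('a) ^ 1" by simp
  note Z = zeta_fps[OF f X c]
  show "has_zeta R (normalization_power R n)" by (rule Z(1))
  have q2: "q \<ge> 2" using card_field_ge_2[where 'f = 'a] q by simp
  show "?lhs = ?rhs"
  proof (subst Sum_any_single[OF q2 m])
    show "?lhs =
      (\<Sum>r\<le>n. dconst (qbinom (rat_of_nat q) (int n) (int r) * (-1) powi int r *
          rat_of_nat q powi (int r * (int r - 1) div 2)) *
        (\<Sum>s\<in>int_lists (2 * n) m. dconst (Gq (replicate (m - 1) (2 * int n) @ [2 * int n - int r]) s (rat_of_nat q)) *
          dir_monom 1 q ^ nat (2 * int m * int n - sum_list s)))"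
      using Z(2)[of n] unfolding q power_one_right
      by (simp add: mu_powi mult.assoc mult.left_commute[of "int m"] of_nat_diff cong: sum.cong_simp)
  qed (erule qbinom_nonzeroD, simp)
qed

lemma zeta_split:
  assumes m: "m \<ge> 1" and q: "CARD('a::{field,finite}) = q"
  defines "R \<equiv> (split_ring m :: 'a fps fps set ring)"
  shows "has_zeta R (normalization_power R n)"
    and "(qpoch (dir_monom 1 q) (of_nat q) n) ^ 2 * module_zeta R (normalization_power R n) =
      Sum_any (\<lambda>(r1, r2, s). if length s = m then
        dir_monom (qbinom (rat_of_nat q) (int n) r1 * qbinom (rat_of_nat q) (int n) r2 * (-1) powi (r1 + r2) *
            rat_of_nat q powi (r1 * (r1 - 1) div 2 + r2 * (r2 - 1) div 2) *
            Gq (replicate (m - 1) (2 * int n) @ [2 * int n - r1 - r2]) s (rat_of_nat q)) 1 *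
          dir_monom 1 q ^ nat (2 * int m * int n - sum_list s)
        else 0)" (is "?lhs = ?rhs")
proof -
  obtain f where f: "order_presentation (\<lambda>(a :: 'a fps) (_ :: bool). a) UNIV (\<lambda>c. if c then 0 else 1) 1 0 m R f"
    using split_presentation[OF m] unfolding R_def by blast
  note Z = zeta_fun[OF f dvd_refl refl]
  show "has_zeta R (normalization_power R n)" by (rule Z(1))
  have q2: "q \<ge> 2" using card_field_ge_2[where 'f = 'a] q by simp
  have mu: "mu (rat_of_nat q) r1 * mu (rat_of_nat q) r2 = (-1) powi (int r1 + int r2) *
      rat_of_nat q powi (int r1 * (int r1 - 1) div 2 + int r2 * (int r2 - 1) div 2)" for r1 r2
    using q2 by (simp add: mu_powi power_int_add)
  show "?lhs = ?rhs"
  proof (subst Sum_any_double[OF q2 m])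
    have [simp]: "int (2 * n - (r1 + r2)) = 2 * int n - int r1 - int r2" if "r1 \<le> n" "r2 \<le> n" for r1 r2
      using that by linarith
    have [simp]: "dconst (qbinom (rat_of_nat q) (int n) (int r1) * mu (rat_of_nat q) r1) *
        (dconst (qbinom (rat_of_nat q) (int n) (int r2) * mu (rat_of_nat q) r2) * w) =
        dconst (qbinom (rat_of_nat q) (int n) (int r1) * qbinom (rat_of_nat q) (int n) (int r2) *
          (-1) powi (int r1 + int r2) *
          rat_of_nat q powi (int r1 * (int r1 - 1) div 2 + int r2 * (int r2 - 1) div 2)) * w" for r1 r2 w
      unfolding mult.assoc mu[symmetric] by (simp only: dconst_mult ac_simps)
    show "?lhs =
      (\<Sum>r1\<le>n. \<Sum>r2\<le>n. dconst (qbinom (rat_of_nat q) (int n) (int r1) * qbinom (rat_of_nat q) (int n) (int r2) *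
          (-1) powi (int r1 + int r2) *
          rat_of_nat q powi (int r1 * (int r1 - 1) div 2 + int r2 * (int r2 - 1) div 2)) *
        (\<Sum>s\<in>int_lists (2 * n) m.
          dconst (Gq (replicate (m - 1) (2 * int n) @ [2 * int n - int r1 - int r2]) s (rat_of_nat q)) *
          dir_monom 1 q ^ nat (2 * int m * int n - sum_list s)))"
      using Z(2)[of n] unfolding q
      by (simp add: mult.assoc mult.left_commute[of "int m"] del: of_nat_diff cong: sum.cong_simp)
  qed (erule qbinom_mult_nonzeroD, simp)
qed

lemma zeta_inert:
  fixes k :: "'b::{field,finite} set"
  assumes m: "m \<ge> 1" and q: "CARD('b) = q ^ 2" and k: "subfield k (ring_of_type_algebra :: 'b ring)" "card k = q"
  defines "R \<equiv> inert_ring k m"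
  shows "has_zeta R (normalization_power R n)"
    and "qpoch (dir_monom 1 q ^ 2) (of_nat (q ^ 2)) n * module_zeta R (normalization_power R n) =
      Sum_any (\<lambda>(r, s). if length s = m then
        dir_monom (qbinom (rat_of_nat q ^ 2) (int n) r * (-1) powi r * rat_of_nat q powi (r ^ 2 - r) *
            Gq (replicate (m - 1) (2 * int n) @ [2 * int n - 2 * r]) s (rat_of_nat q)) 1 *
          dir_monom 1 q ^ nat (2 * int m * int n - sum_list s)
        else 0)" (is "?lhs = ?rhs")
proof -
  have card: "CARD('b) = card k ^ 2" using q k(2) by simp
  obtain \<beta> u v f where f: "order_presentation (\<lambda>a. a) k \<beta> u v m R f"
    using inert_presentation[OF m k(1) card] unfolding R_def by blast
  note Z = zeta_fps[OF f dvd_refl card]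
  show "has_zeta R (normalization_power R n)" by (rule Z(1))
  have "\<not> q ^ 2 < 2" using card_field_ge_2[where 'f = 'b] q by simp
  then have q2: "q \<ge> 2" by (cases "q = 0 \<or> q = 1") (elim disjE, simp_all)
  show "?lhs = ?rhs"
  proof (subst Sum_any_single[OF q2 m])
    show "?lhs =
      (\<Sum>r\<le>n. dconst (qbinom (rat_of_nat q ^ 2) (int n) (int r) * (-1) powi int r *
          rat_of_nat q powi (int r ^ 2 - int r)) *
        (\<Sum>s\<in>int_lists (2 * n) m. dconst (Gq (replicate (m - 1) (2 * int n) @ [2 * int n - 2 * int r]) s (rat_of_nat q)) *
          dir_monom 1 q ^ nat (2 * int m * int n - sum_list s)))"
      using Z(2)[of n] unfolding q k(2) of_nat_power
      by (simp add: mu_square mult.assoc mult.left_commute[of "int m"] of_nat_diff cong: sum.cong_simp)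
  qed (erule qbinom_nonzeroD, simp)
qed

theorem theorem3p2:
  fixes m n q :: nat and Q :: rat and t :: "rat dirichlet"
  assumes "m \<ge> 1" and "primepow q"
    and Q: "Q = of_nat q" and t: "t = dir_monom 1 q"
  shows
    "(CARD('a::{field,finite}) = q \<longrightarrow>
       (let R = (ramified_ring m :: 'a fps fps set ring); M = normalization_power R n in
        has_zeta R M \<and>
        qpoch t (of_nat q) n * module_zeta R M =
          Sum_any (\<lambda>(r, s). if length s = m then
             dir_monom (qbinom Q (int n) r * (-1) powi r * Q powi (r * (r - 1) div 2) *
                 Gq (replicate (m - 1) (2 * int n) @ [2 * int n - r]) s Q) 1 *
               t ^ nat (2 * int m * int n - sum_list s)
           else 0))) \<and>
     (CARD('a) = q \<longrightarrow>
       (let R = (split_ring m :: 'a fps fps set ring); M = normalization_power R n in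
        has_zeta R M \<and>
        (qpoch t (of_nat q) n) ^ 2 * module_zeta R M =
          Sum_any (\<lambda>(r1, r2, s). if length s = m then
             dir_monom (qbinom Q (int n) r1 * qbinom Q (int n) r2 * (-1) powi (r1 + r2) *
                 Q powi (r1 * (r1 - 1) div 2 + r2 * (r2 - 1) div 2) *
                 Gq (replicate (m - 1) (2 * int n) @ [2 * int n - r1 - r2]) s Q) 1 *
               t ^ nat (2 * int m * int n - sum_list s)
           else 0))) \<and>
     (\<forall>k. CARD('b::{field,finite}) = q ^ 2 \<and> subfield k (ring_of_type_algebra :: 'b ring) \<and> card k = q \<longrightarrow>
       (let R = inert_ring k m; M = normalization_power R n in
        has_zeta R M \<and>
        qpoch (t ^ 2) (of_nat (q ^ 2)) n * module_zeta R M =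
          Sum_any (\<lambda>(r, s). if length s = m then
             dir_monom (qbinom (Q ^ 2) (int n) r * (-1) powi r * Q powi (r ^ 2 - r) *
                 Gq (replicate (m - 1) (2 * int n) @ [2 * int n - 2 * r]) s Q) 1 *
               t ^ nat (2 * int m * int n - sum_list s)
           else 0)))"
  unfolding Q t Let_def
  using zeta_ramified[OF assms(1), where 'a = 'a, of q n] zeta_split[OF assms(1), where 'a = 'a, of q n]
    zeta_inert[OF assms(1), where 'b = 'b, of q _ n] by blast

end
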